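(* Let $a_0>0$, $\alpha=0$ and $\beta\in\left(0,\frac{\sqrt3}{3}\right)$. Then there exists a unique FLRW solution $(g,\phi)\in C^2((-\infty,+\infty))$ (spatially flat, homogeneous and isotropic, existing for all $t\in\mathbb{R}$, hence globally singularity-free) of the ESGB field equations with initial data $(a,H,\phi)|_{t=0}=(a_0,\beta,0)$ and $\dot\phi(0)>0$. Moreover this solution satisfies the following estimates. (1) Scalar field. For $t\in(-\infty,0)$, $$\frac{\sqrt3}{12}\left(1-e^{-12t}\right)<\phi(t)<\mathfrak{H}(t),\qquad \mathfrak{H}(t):=\begin{cases}\frac{\sqrt3}{6\beta^2}\left(1-e^{-6\beta^3t}\right), & 0<\beta\le\sqrt{\frac{5}{27}},\\ \frac{25\sqrt3}{24}\left(1-e^{-\frac{48}{125}t}\right), & \sqrt{\frac{5}{27}}<\beta<\frac{\sqrt3}{3}.\end{cases}$$ For $t\in(0,+\infty)$, $$\frac{-1+\sqrt{1+\frac{24\beta^2}{5}\ln(1+5\beta t)}}{4\sqrt3\,\beta^2}<\phi(t)<\sqrt3\,\ln(\beta t+1).$$ (2) Hubble parameter. For $t\in(-\infty,0)$, $$\mathfrak{L}(t)<H(t)<\frac{2\beta+\sqrt2-(\sqrt2-2\beta)e^{3\sqrt2\,t}}{\sqrt2\left(2\beta+\sqrt2+(\sqrt2-2\beta)e^{3\sqrt2\,t}\right)},$$ where $$\mathfrak{L}(t):=\begin{cases}\frac{227\beta}{2e^{\frac{454\beta t}{45}}+225}>\beta, & 0<\beta\le\sqrt{\frac{5}{27}},\\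 \frac{2\beta}{5\beta-(5\beta-2)e^{4t}}>\frac25, & \sqrt{\frac{5}{27}}<\beta<\frac{\sqrt3}{3}.\end{cases}$$ For $t\in(0,+\infty)$, $$\frac{1}{5t+\frac1\beta}<H(t)<\frac{1}{t+\frac1\beta}.$$ (3) Derivative of the scalar field. For $t\in(-\infty,0)$, $$\mathfrak{W}(t)<\dot\phi(t)<\sqrt3\,e^{-12t},\qquad \mathfrak{W}(t):=\begin{cases}\sqrt3\,\beta e^{-6\beta^3t}, & 0<\beta\le\sqrt{\frac{5}{27}},\\ \frac{2\sqrt3}{5}e^{-\frac{48}{125}t}, & \sqrt{\frac{5}{27}}<\beta<\frac{\sqrt3}{3}.\end{cases}$$ For $t\in(0,+\infty)$, $$\frac{1}{\sqrt{1+12\beta^2\ln(\beta t+1)}}\cdot\frac{\sqrt3}{5t+\frac1\beta}<\dot\phi(t)<\frac{\sqrt3}{t+\frac1\beta}.$$ (4) Scale factor. For $t\in(-\infty,0)$, $$a_0\left(\frac{2}{(\sqrt2\beta+1)+(1-\sqrt2\beta)e^{3\sqrt2\,t}}\right)^{\frac13}e^{\frac{\sqrt2}{2}t}<a(t)<a_0\,\mathfrak{G}(t),$$ where $$\mathfrak{G}(t):=\begin{cases}\left(\frac{227}{225e^{-\frac{454\beta t}{45}}+2}\right)^{\frac1{10}}, & 0<\beta\le\sqrt{\frac{5}{27}},\\ \left(\frac{2}{5\beta e^{-4t}-(5\beta-2)}\right)^{\frac1{10}}, & \sqrt{\frac{5}{27}}<\beta<\frac{\sqrt3}{3}.\end{cases}$$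 For $t\in(0,+\infty)$, $$a_0(5\beta t+1)^{\frac15}<a(t)<a_0(\beta t+1).$$
   Context: The Einstein-scalar-Gauss-Bonnet (ESGB) field equations with coupling function $f(\phi)=\frac12\phi^2$ for a Lorentzian metric $g$ and scalar field $\phi$ are $$R_{\mu\nu}-\tfrac12Rg_{\mu\nu}+\Gamma_{\mu\nu}=2\partial_\mu\phi\partial_\nu\phi-(\nabla\phi)^2g_{\mu\nu},\qquad \frac{1}{\sqrt{-g}}\partial_\mu\left[\sqrt{-g}\,\partial^\mu\phi\right]-\tfrac14\phi R_{\mathrm{GB}}^2=0,$$ where $R_{\mathrm{GB}}^2=R^2-4R_{\mu\nu}R^{\mu\nu}+R_{\mu\nu\rho\sigma}R^{\mu\nu\rho\sigma}$ and $$\Gamma_{\mu\nu}=2R\nabla_\mu\nabla_\nu f+4(R_{\mu\nu}-\tfrac12Rg_{\mu\nu})\nabla^\alpha\nabla_\alpha f-8R_{\alpha(\mu}\nabla^\alpha\nabla_{\nu)}f+4R^{\alpha\beta}g_{\mu\nu}\nabla_\alpha\nabla_\beta f-4R^{\beta}{}_{\mu\alpha\nu}\nabla^\alpha\nabla_\beta f,\quad f=f(\phi).$$ An FLRW solution is a pair $(g,\phi)$ with $g=-dt^2+a^2(t)\left(dr^2+r^2(d\theta^2+\sin^2\theta\,d\varphi^2)\right)$, $a(t)>0$, $\phi=\phi(t)$. The Hubble parameter is $H=\dot a/a$ (dot $=d/dt$), so $a(t)=a_0e^{\int_0^tH(s)ds}$. For FLRW pairs the field equations reduce to the ODE system $$3H^2=\dot\phi^2+12H^3\phi\dot\phi,$$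 $$2\dot H+3H^2=-\dot\phi^2+8(\dot H+H^2)H\phi\dot\phi+4H^2(\dot\phi^2+\phi\ddot\phi),$$ $$\ddot\phi+3\dot\phi H+6\phi(H^2+\dot H)H^2=0.$$ The first equation is a constraint, which determines $\dot\phi(0)$ from $(H,\phi)(0)$ up to the choice of root of a quadratic; the condition $\dot\phi(0)>0$ selects the root. *)

theory Defs
  imports "HOL-Analysis.Analysis"
begin

section \<open>Coordinate tensor calculus on a four-dimensional spacetime\<close>

text \<open>
  Points are coordinate tuples. The index type \<open>4\<close> has the elements \<open>0, 1, 2, 3\<close> (with
  \<open>4 = 0\<close>), and index \<open>0\<close> is the time coordinate. Tensor fields are given by their components,
  as functions of the indices and the point.
\<close>

type_synonym event = "real ^ 4"
type_synonym metric = "event \<Rightarrow> real ^ 4 ^ 4"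
type_synonym scalar = "event \<Rightarrow> real"

definition lorentzian :: "real ^ 4 ^ 4 \<Rightarrow> bool" where
  "lorentzian A \<longleftrightarrow> transpose A = A \<and>
     (\<exists>P :: real ^ 4 ^ 4. invertible P \<and>
        transpose P ** A ** P = (\<chi> i j. if i = j then (if i = 0 then - 1 else 1) else 0))"

definition partial :: "4 \<Rightarrow> scalar \<Rightarrow> scalar" where
  "partial i u x = deriv (\<lambda>h. u (x + h *\<^sub>R axis i 1)) 0"

abbreviation ginv :: "metric \<Rightarrow> 4 \<Rightarrow> 4 \<Rightarrow> scalar" where
  "ginv g i j x \<equiv> matrix_inv (g x) $ i $ j"

text \<open>\<open>christoffel g k i j\<close> is \<open>\<Gamma>\<^sup>k\<^sub>i\<^sub>j\<close>.\<close>

definition christoffel :: "metric \<Rightarrow> 4 \<Rightarrow> 4 \<Rightarrow> 4 \<Rightarrow> scalar" where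
  "christoffel g k i j x = 1 / 2 * (\<Sum>l\<in>UNIV. ginv g k l x *
     (partial i (\<lambda>y. g y $ j $ l) x + partial j (\<lambda>y. g y $ i $ l) x - partial l (\<lambda>y. g y $ i $ j) x))"

text \<open>
  \<open>riemann g r s m n\<close> is \<open>R\<^sup>r\<^sub>s\<^sub>m\<^sub>n\<close>, and the Ricci tensor contracts the first with the third index.
  This sign convention gives spheres positive curvature; the field equations depend on it.
\<close>

definition riemann :: "metric \<Rightarrow> 4 \<Rightarrow> 4 \<Rightarrow> 4 \<Rightarrow> 4 \<Rightarrow> scalar" where
  "riemann g r s m n x =
     partial m (christoffel g r n s) x - partial n (christoffel g r m s) x
     + (\<Sum>l\<in>UNIV. christoffel g r m l x * christoffel g l n s x)
     - (\<Sum>l\<in>UNIV. christoffel g r n l x * christoffel g l m s x)"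

definition riemann_low :: "metric \<Rightarrow> 4 \<Rightarrow> 4 \<Rightarrow> 4 \<Rightarrow> 4 \<Rightarrow> scalar" where
  "riemann_low g r s m n x = (\<Sum>l\<in>UNIV. g x $ r $ l * riemann g l s m n x)"

definition ricci :: "metric \<Rightarrow> 4 \<Rightarrow> 4 \<Rightarrow> scalar" where
  "ricci g m n x = (\<Sum>l\<in>UNIV. riemann g l m l n x)"

definition ricci_up :: "metric \<Rightarrow> 4 \<Rightarrow> 4 \<Rightarrow> scalar" where
  "ricci_up g m n x = (\<Sum>a\<in>UNIV. \<Sum>b\<in>UNIV. ginv g m a x * ginv g n b x * ricci g a b x)"

definition scalar_curvature :: "metric \<Rightarrow> scalar" where
  "scalar_curvature g x = (\<Sum>m\<in>UNIV. \<Sum>n\<in>UNIV. ginv g m n x * ricci g m n x)"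

definition einstein :: "metric \<Rightarrow> 4 \<Rightarrow> 4 \<Rightarrow> scalar" where
  "einstein g m n x = ricci g m n x - 1 / 2 * scalar_curvature g x * g x $ m $ n"

definition riemann_up :: "metric \<Rightarrow> 4 \<Rightarrow> 4 \<Rightarrow> 4 \<Rightarrow> 4 \<Rightarrow> scalar" where
  "riemann_up g r s m n x = (\<Sum>a\<in>UNIV. \<Sum>b\<in>UNIV. \<Sum>c\<in>UNIV. \<Sum>d\<in>UNIV.
     ginv g r a x * ginv g s b x * ginv g m c x * ginv g n d x * riemann_low g a b c d x)"

definition gauss_bonnet :: "metric \<Rightarrow> scalar" where
  "gauss_bonnet g x = (scalar_curvature g x)\<^sup>2
     - 4 * (\<Sum>m\<in>UNIV. \<Sum>n\<in>UNIV. ricci g m n x * ricci_up g m n x)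
     + (\<Sum>r\<in>UNIV. \<Sum>s\<in>UNIV. \<Sum>m\<in>UNIV. \<Sum>n\<in>UNIV. riemann_low g r s m n x * riemann_up g r s m n x)"

text \<open>\<open>\<nabla>\<^sub>m \<nabla>\<^sub>n u\<close> and \<open>\<nabla>\<^sup>m \<nabla>\<^sub>n u\<close> for a scalar field \<open>u\<close>.\<close>

definition hessian :: "metric \<Rightarrow> scalar \<Rightarrow> 4 \<Rightarrow> 4 \<Rightarrow> scalar" where
  "hessian g u m n x = partial m (partial n u) x - (\<Sum>l\<in>UNIV. christoffel g l m n x * partial l u x)"

definition hessian_mixed :: "metric \<Rightarrow> scalar \<Rightarrow> 4 \<Rightarrow> 4 \<Rightarrow> scalar" where
  "hessian_mixed g u m n x = (\<Sum>l\<in>UNIV. ginv g m l x * hessian g u l n x)"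

definition grad_up :: "metric \<Rightarrow> scalar \<Rightarrow> 4 \<Rightarrow> scalar" where
  "grad_up g u m x = (\<Sum>l\<in>UNIV. ginv g m l x * partial l u x)"

definition grad_sq :: "metric \<Rightarrow> scalar \<Rightarrow> scalar" where
  "grad_sq g u x = (\<Sum>m\<in>UNIV. grad_up g u m x * partial m u x)"


section \<open>The field equations with coupling function \<open>f(\<phi>) = \<phi>\<^sup>2 / 2\<close>\<close>

definition coupling :: "real \<Rightarrow> real" where
  "coupling y = 1 / 2 * y\<^sup>2"

text \<open>
  The tensor \<open>\<Gamma>\<^sub>\<mu>\<^sub>\<nu>\<close> of the field equations, with \<open>u\<close> the coupling function evaluated on the scalar
  field. Round brackets around indices are symmetrisation with weight \<open>1/2\<close>, so the prefactor
  \<open>8\<close> of that term appears as \<open>4\<close>.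
\<close>

definition gb_tensor :: "metric \<Rightarrow> scalar \<Rightarrow> 4 \<Rightarrow> 4 \<Rightarrow> scalar" where
  "gb_tensor g u m n x =
     2 * scalar_curvature g x * hessian g u m n x
     + 4 * einstein g m n x * (\<Sum>a\<in>UNIV. hessian_mixed g u a a x)
     - 4 * (\<Sum>a\<in>UNIV. ricci g a m x * hessian_mixed g u a n x + ricci g a n x * hessian_mixed g u a m x)
     + 4 * (\<Sum>a\<in>UNIV. \<Sum>b\<in>UNIV. ricci_up g a b x * g x $ m $ n * hessian g u a b x)
     - 4 * (\<Sum>a\<in>UNIV. \<Sum>b\<in>UNIV. riemann g b m a n x * hessian_mixed g u a b x)"

definition metric_equation :: "metric \<Rightarrow> scalar \<Rightarrow> event \<Rightarrow> bool" where
  "metric_equation g \<Phi> x \<longleftrightarrow> (\<forall>m n.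
     einstein g m n x + gb_tensor g (\<lambda>y. coupling (\<Phi> y)) m n x
       = 2 * partial m \<Phi> x * partial n \<Phi> x - grad_sq g \<Phi> x * g x $ m $ n)"

definition scalar_equation :: "metric \<Rightarrow> scalar \<Rightarrow> event \<Rightarrow> bool" where
  "scalar_equation g \<Phi> x \<longleftrightarrow>
     1 / sqrt (- det (g x)) *
       (\<Sum>m\<in>UNIV. partial m (\<lambda>y. sqrt (- det (g y)) * grad_up g \<Phi> m y) x)
     - 1 / 4 * \<Phi> x * gauss_bonnet g x = 0"

definition esgb_solution_on :: "event set \<Rightarrow> metric \<Rightarrow> scalar \<Rightarrow> bool" where
  "esgb_solution_on U g \<Phi> \<longleftrightarrow>
     (\<forall>x\<in>U. lorentzian (g x) \<and> metric_equation g \<Phi> x \<and> scalar_equation g \<Phi> x)"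


section \<open>FLRW pairs\<close>

text \<open>Coordinates are \<open>(t, r, \<theta>, \<phi>) = (x $ 0, x $ 1, x $ 2, x $ 3)\<close>.\<close>

definition spherical_chart :: "event set" where
  "spherical_chart = {x. 0 < x $ 1 \<and> 0 < x $ 2 \<and> x $ 2 < pi \<and> 0 < x $ 3 \<and> x $ 3 < 2 * pi}"

definition flrw_metric :: "(real \<Rightarrow> real) \<Rightarrow> metric" where
  "flrw_metric a x = (\<chi> i j. if i \<noteq> j then 0
     else if i = 0 then - 1
     else if i = 1 then (a (x $ 0))\<^sup>2
     else if i = 2 then (a (x $ 0))\<^sup>2 * (x $ 1)\<^sup>2
     else (a (x $ 0))\<^sup>2 * (x $ 1)\<^sup>2 * (sin (x $ 2))\<^sup>2)"

definition flrw_scalar :: "(real \<Rightarrow> real) \<Rightarrow> scalar" where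
  "flrw_scalar \<phi> x = \<phi> (x $ 0)"

definition C2_real :: "(real \<Rightarrow> real) \<Rightarrow> bool" where
  "C2_real u \<longleftrightarrow> u differentiable_on UNIV \<and> deriv u C1_differentiable_on UNIV"

text \<open>
  An FLRW pair is represented by its profile functions \<open>a\<close> and \<open>\<phi>\<close>; since \<open>a > 0\<close>, they are
  determined by the metric and the scalar field. The time coordinate ranges over all reals.
\<close>

definition esgb_flrw_solution :: "(real \<Rightarrow> real) \<Rightarrow> (real \<Rightarrow> real) \<Rightarrow> bool" where
  "esgb_flrw_solution a \<phi> \<longleftrightarrow> (\<forall>t. 0 < a t) \<and> C2_real a \<and> C2_real \<phi> \<and>
     esgb_solution_on spherical_chart (flrw_metric a) (flrw_scalar \<phi>)"

definition hubble :: "(real \<Rightarrow> real) \<Rightarrow> real \<Rightarrow> real" where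
  "hubble a t = deriv a t / a t"

definition esgb_flrw_ivp ::
  "real \<Rightarrow> real \<Rightarrow> real \<Rightarrow> (real \<Rightarrow> real) \<Rightarrow> (real \<Rightarrow> real) \<Rightarrow> bool" where
  "esgb_flrw_ivp a0 \<beta> \<alpha> a \<phi> \<longleftrightarrow> esgb_flrw_solution a \<phi> \<and>
     a 0 = a0 \<and> hubble a 0 = \<beta> \<and> \<phi> 0 = \<alpha> \<and> 0 < deriv \<phi> 0"


section \<open>Barrier functions with a case distinction in \<open>\<beta>\<close>\<close>

definition frakH :: "real \<Rightarrow> real \<Rightarrow> real" where
  "frakH \<beta> t = (if \<beta> \<le> sqrt (5 / 27)
     then sqrt 3 / (6 * \<beta>\<^sup>2) * (1 - exp (- 6 * \<beta> ^ 3 * t))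
     else 25 * sqrt 3 / 24 * (1 - exp (- (48 / 125) * t)))"

definition frakL :: "real \<Rightarrow> real \<Rightarrow> real" where
  "frakL \<beta> t = (if \<beta> \<le> sqrt (5 / 27)
     then 227 * \<beta> / (2 * exp (454 * \<beta> * t / 45) + 225)
     else 2 * \<beta> / (5 * \<beta> - (5 * \<beta> - 2) * exp (4 * t)))"

definition frakW :: "real \<Rightarrow> real \<Rightarrow> real" where
  "frakW \<beta> t = (if \<beta> \<le> sqrt (5 / 27)
     then sqrt 3 * \<beta> * exp (- 6 * \<beta> ^ 3 * t)
     else 2 * sqrt 3 / 5 * exp (- (48 / 125) * t))"

definition frakG :: "real \<Rightarrow> real \<Rightarrow> real" where
  "frakG \<beta> t = (if \<beta> \<le> sqrt (5 / 27)
     then (227 / (225 * exp (- (454 * \<beta> * t / 45)) + 2)) powr (1 / 10)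
     else (2 / (5 * \<beta> * exp (- 4 * t) - (5 * \<beta> - 2))) powr (1 / 10))"

end

theory Submission
  imports Defs
begin

text \<open>
  Write \<open>H\<close> for the Hubble parameter and \<open>\<psi>\<close> for the time derivative of \<open>\<phi>\<close>. On an FLRW pair all
  tensors are diagonal and the field equations become three scalar equations. In the variable
  \<open>p = H / \<psi>\<close> the constraint can be solved for \<open>\<phi>\<close>, namely \<open>\<phi> = (3 p\<^sup>2 - 1) / (12 p H\<^sup>2)\<close>, and the other
  two equations are equivalent to an autonomous rational system for \<open>(H, p)\<close> with no singularities,
  started at \<open>(\<beta>, 1 / sqrt 3)\<close>. The trajectory stays in the unit square: in the future
  \<open>1 / sqrt 3 < p\<close>, \<open>H < p\<close> and \<open>p\<^sup>2 + 2 H\<^sup>2\<close> decreases; in the past \<open>p < 1 / sqrt 3\<close> and \<open>H < 1 / sqrt 2\<close>.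
  Hence the system may be clamped to the square, which makes it globally Lipschitz, and global
  existence and uniqueness follow. Each estimate on \<open>H\<close> compares the solution with a barrier that solves a Riccati
  equation and can only be crossed in one direction; those on \<open>\<psi>\<close>, \<open>\<phi>\<close> and \<open>a\<close> follow by integration.
\<close>

section \<open>Ordinary differential equations on the real line\<close>

text \<open>In the unknowns H, \<phi>, \<psi> the two evolution equations are linear in a''/a and
  \<phi>'', with determinant 2 - 8 H \<phi> \<psi> + 24 H^4 \<phi>^2, which has no evident sign.
  Inserting the constraint and multiplying by 6 p^2 turns it into (3 p^2 - 1)^2 + 4; this is what
  the variable p is for. The start p = 1 / sqrt 3 is forced by \<phi> = 0. Nothing guarantees
  beforehand that an arbitrary solution keeps H and \<psi> positive, so division by \<psi> is
  justified only up to an unknown time. Therefore the estimates are proved on a compact interval on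
  which positivity is given, with margins that survive the limit at its end. A continuation argument
  uses them twice: to see that the clamp never acts, which gives existence, and to extend positivity
  along any solution, which gives uniqueness. The condition on \<beta> enters as 1/3 + 2 \<beta>^2 <
  1, the bound that keeps p below 1 in the future.\<close>

lemma global_antiderivative:
  fixes g :: "real \<Rightarrow> 'a::euclidean_space"
  assumes "continuous_on UNIV g"
  obtains G where "G 0 = 0" "\<And>t. (G has_vector_derivative g t) (at t)"
proof -
  have "isCont g x" for x
    using assms by (simp add: continuous_on_eq_continuous_at)
  then obtain F where F: "\<And>t. (F has_vector_derivative g t) (at t)"
    using einterval_antiderivative[of "-\<infinity>" "\<infinity>" g] by auto
  show thesis
    by (rule that[of "\<lambda>t. F t - F 0"]) (auto intro!: derivative_eq_intros F)
qed

text \<open>Integrating the exponential weight gains a factor 1 / K. The bound keeps the Picard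
  operator below inside the weighted space, and the gained factor makes it contract. Negative times
  are reduced to positive ones by reflection.\<close>

lemma norm_le_exp_of_derivative:
  fixes G :: "real \<Rightarrow> 'a::euclidean_space"
  assumes G0: "G 0 = 0" and der: "\<And>t. (G has_vector_derivative g t) (at t)"
    and bd: "\<And>t. norm (g t) \<le> c * exp (K * \<bar>t\<bar>)" and K: "K > 0" and c: "c \<ge> 0"
  shows "norm (G t) \<le> c / K * exp (K * \<bar>t\<bar>)"
proof -
  have pos: "norm (F t) \<le> c / K * exp (K * t)"
    if "t > 0" "F 0 = 0" "\<And>t. (F has_vector_derivative f t) (at t)" "\<And>t. norm (f t) \<le> c * exp (K * \<bar>t\<bar>)"
    for t and F f :: "real \<Rightarrow> 'a"
  proof -
    have cF: "continuous_on {0..t} F"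
      using that(3) by (meson continuous_at_imp_continuous_on has_vector_derivative_continuous)
    have "norm (F t - F 0) \<le> c / K * exp (K * t) - c / K * exp (K * 0)"
      by (rule differentiable_bound_general[where f' = f and \<phi>' = "\<lambda>s. c * exp (K * s)" and a = 0 and b = t])
        (use that K cF in \<open>auto intro!: continuous_intros derivative_eq_intros simp: has_real_derivative_iff_has_vector_derivative[symmetric]
           simp del: exp_zero, metis abs_of_pos\<close>)
    moreover have "0 \<le> c / K" using K c by simp
    ultimately show ?thesis using that(2) by simp
  qed
  consider "t = 0" | "t > 0" | "t < 0" by linarith
  thus ?thesis
  proof cases
    case 1 thus ?thesis using G0 K c by simp
  next
    case 2 thus ?thesis using pos[OF 2 G0 der bd] by simp
  next
    case 3
    have "((\<lambda>t. G (- t)) has_vector_derivative - g (- t)) (at t)" for t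
    proof -
      have "((\<lambda>t. G (- t)) has_vector_derivative (- 1) *\<^sub>R g (- t)) (at t)"
        by (rule vector_diff_chain_at[where f = uminus and g = G, unfolded o_def])
           (auto intro!: derivative_eq_intros der)
      thus ?thesis by simp
    qed
    from pos[of "- t" "\<lambda>t. G (- t)" "\<lambda>t. - g (- t)", OF _ _ this] show ?thesis
      using 3 G0 bd[of "- _"] by simp
  qed
qed

text \<open>
  Banach's fixed point theorem for the unknown \<open>exp (- K \<bar>t\<bar>) (x t - x0)\<close>, which is bounded on the
  whole line: the weight makes the Picard operator a contraction on all of it at once.
\<close>

lemma global_ode_solution:
  fixes f :: "'a::euclidean_space \<Rightarrow> 'a"
  assumes lip: "\<And>x y. dist (f x) (f y) \<le> L * dist x y"
  obtains x where "x 0 = x0" "\<And>t. (x has_vector_derivative f (x t)) (at t)"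
proof -
  \<comment> \<open>The contraction factor will be the Lipschitz constant over K, hence at most 1/2;
    the summand 1 keeps K positive when L is 0.\<close>
  define K where "K = 2 * \<bar>L\<bar> + 1"
  have K: "K > 0" "\<bar>L\<bar> \<le> K / 2" by (auto simp: K_def)
  have lip': "dist (f x) (f y) \<le> K / 2 * dist x y" for x y
    using lip[of x y] K by (meson abs_le_D1 dual_order.trans mult_right_mono zero_le_dist)
  have "continuous_on UNIV f"
    by (rule lipschitz_on_continuous_on[of "K/2"]) (use lip' K in \<open>auto simp: lipschitz_on_def\<close>)
  hence cf: "continuous_on S (\<lambda>t. f (h t))" if "continuous_on S h" for S and h :: "real \<Rightarrow> 'a"
    using that by (rule continuous_on_compose2) auto
  define h where "h = (\<lambda>(y :: real \<Rightarrow>\<^sub>C 'a) t. f (x0 + exp (K * \<bar>t\<bar>) *\<^sub>R apply_bcontfun y t))"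
  have "continuous_on UNIV (apply_bcontfun y)" for y :: "real \<Rightarrow>\<^sub>C 'a"
    using apply_bcontfun[of y] by (simp add: bcontfun_def)
  hence "continuous_on UNIV (\<lambda>t. x0 + exp (K * \<bar>t\<bar>) *\<^sub>R apply_bcontfun y t)" for y :: "real \<Rightarrow>\<^sub>C 'a"
    by (intro continuous_on_add continuous_on_scaleR continuous_on_const continuous_on_exp continuous_on_mult_left
        continuous_on_rabs continuous_on_id)
  from cf[OF this] have ch: "continuous_on UNIV (h y)" for y
    unfolding h_def .
  \<comment> \<open>The antiderivative vanishing at 0 plays the part of the Picard integral and
    serves both half-lines without oriented integrals.\<close>
  define A where "A = (\<lambda>g :: real \<Rightarrow> 'a. SOME G. G 0 = 0 \<and> (\<forall>t. (G has_vector_derivative g t) (at t)))"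
  have A: "A (h y) 0 = 0 \<and> (\<forall>t. (A (h y) has_vector_derivative h y t) (at t))" for y
  proof -
    obtain G where "G 0 = 0" "\<And>t. (G has_vector_derivative h y t) (at t)"
      using global_antiderivative[OF ch[of y]] by blast
    hence "\<exists>G. G 0 = 0 \<and> (\<forall>t. (G has_vector_derivative h y t) (at t))" by blast
    thus ?thesis unfolding A_def by (rule someI_ex)
  qed
  hence cA: "continuous_on UNIV (A (h y))" for y
    by (meson continuous_at_imp_continuous_on has_vector_derivative_continuous)
  define T where "T = (\<lambda>y. Bcontfun (\<lambda>t. exp (- (K * \<bar>t\<bar>)) *\<^sub>R A (h y) t))"
  have ee: "exp (- (K * \<bar>t\<bar>)) * (c * exp (K * \<bar>t\<bar>)) = c" for t c
    by (simp add: exp_minus)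
  have bcf: "(\<lambda>t. exp (- (K * \<bar>t\<bar>)) *\<^sub>R A (h y) t) \<in> bcontfun" for y
  proof -
    define B where "B = norm y"
    have B: "norm (apply_bcontfun y t) \<le> B" for t
      unfolding B_def by (rule norm_bounded)
    define c where "c = norm (f x0) + K / 2 * B"
    have B0: "B \<ge> 0" using B[of 0] norm_ge_zero order_trans by blast
    have "norm (h y t) \<le> c * exp (K * \<bar>t\<bar>)" for t
    proof -
      have "norm (h y t) \<le> norm (f x0) + dist (h y t) (f x0)"
        using norm_triangle_ineq[of "f x0" "h y t - f x0"] by (simp add: dist_norm)
      also have "dist (h y t) (f x0) \<le> K / 2 * (exp (K * \<bar>t\<bar>) * norm (apply_bcontfun y t))"
        unfolding h_def using lip'[of "x0 + exp (K * \<bar>t\<bar>) *\<^sub>R apply_bcontfun y t" x0] by (simp add: dist_norm)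
      also have "\<dots> \<le> K / 2 * (exp (K * \<bar>t\<bar>) * B)"
        using B K by (intro mult_left_mono) auto
      also have "norm (f x0) \<le> norm (f x0) * exp (K * \<bar>t\<bar>)"
        using K by (simp add: mult_le_cancel_left1)
      finally show ?thesis by (simp add: c_def algebra_simps)
    qed
    hence "norm (A (h y) t) \<le> c / K * exp (K * \<bar>t\<bar>)" for t
      using A K B0 by (intro norm_le_exp_of_derivative[where g = "h y"]) (auto simp: c_def)
    hence "norm (exp (- (K * \<bar>t\<bar>)) *\<^sub>R A (h y) t) \<le> c / K" for t
      using mult_left_mono[of "norm (A (h y) t)" "c / K * exp (K * \<bar>t\<bar>)" "exp (- (K * \<bar>t\<bar>))"] ee by simp
    thus ?thesis
      by (intro bcontfun_normI continuous_intros cA)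
  qed
  have T: "apply_bcontfun (T y) t = exp (- (K * \<bar>t\<bar>)) *\<^sub>R A (h y) t" for y t
    unfolding T_def using bcf by (simp add: Bcontfun_inverse)
  have "dist (T y) (T z) \<le> 1 / 2 * dist y z" for y z
  proof (rule dist_bound)
    fix t
    let ?D = "\<lambda>t. A (h y) t - A (h z) t"
    have "norm (h y t - h z t) \<le> K / 2 * dist y z * exp (K * \<bar>t\<bar>)" for t
    proof -
      have "norm (h y t - h z t) \<le> K / 2 * (exp (K * \<bar>t\<bar>) * dist (apply_bcontfun y t) (apply_bcontfun z t))"
        using lip'[of "x0 + exp (K * \<bar>t\<bar>) *\<^sub>R apply_bcontfun y t" "x0 + exp (K * \<bar>t\<bar>) *\<^sub>R apply_bcontfun z t"]
        unfolding h_def by (simp add: dist_norm scaleR_diff_right[symmetric])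
      also have "\<dots> \<le> K / 2 * (exp (K * \<bar>t\<bar>) * dist y z)"
        using K by (intro mult_left_mono dist_bounded) auto
      finally show ?thesis by (simp add: mult_ac)
    qed
    hence "norm (?D t) \<le> (K / 2 * dist y z) / K * exp (K * \<bar>t\<bar>)"
      using A K by (intro norm_le_exp_of_derivative[where g = "\<lambda>t. h y t - h z t"]) (auto intro!: derivative_eq_intros)
    hence "norm (?D t) \<le> 1 / 2 * dist y z * exp (K * \<bar>t\<bar>)" using K by simp
    hence "exp (- (K * \<bar>t\<bar>)) * norm (?D t) \<le> 1 / 2 * dist y z"
      using mult_left_mono[of "norm (?D t)" _ "exp (- (K * \<bar>t\<bar>))"] ee by (metis exp_ge_zero)
    thus "dist (apply_bcontfun (T y) t) (apply_bcontfun (T z) t) \<le> 1 / 2 * dist y z"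
      by (simp add: T dist_norm scaleR_diff_right[symmetric])
  qed
  hence "\<exists>!y. T y = y"
    by (intro banach_fix_type[of "1 / 2"] allI) simp_all
  then obtain y where y: "T y = y" by blast
  have eA: "exp (K * \<bar>t\<bar>) *\<^sub>R apply_bcontfun y t = A (h y) t" for t
    using T[of y t] unfolding y by (simp add: exp_minus)
  have hy: "h y t = f (x0 + A (h y) t)" for t
    unfolding eA[symmetric] by (simp add: h_def)
  show thesis
  proof (rule that[of "\<lambda>t. x0 + A (h y) t"])
    show "((\<lambda>t. x0 + A (h y) t) has_vector_derivative f (x0 + A (h y) t)) (at t)" for t
      using A[of y] hy[of t] by (auto intro!: derivative_eq_intros)
  qed (simp add: A)
qed

section \<open>The planar system\<close>

lemma barrier_future:
  fixes f f' :: "real \<Rightarrow> real"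
  assumes f0: "0 \<le> f 0" and der: "\<And>t. t \<in> {0..T} \<Longrightarrow> (f has_real_derivative f' t) (at t)"
    and zero: "\<And>t. t \<in> {0..T} \<Longrightarrow> f t = 0 \<Longrightarrow> 0 < f' t" and t: "t \<in> {0<..T}"
  shows "0 < f t"
proof (rule ccontr)
  assume "\<not> 0 < f t"
  have cont: "isCont f s" if "s \<in> {0..T}" for s
    using der[OF that] DERIV_isCont by blast
  \<comment> \<open>Solutions often start on their barrier, so f 0 = 0 is allowed. The positive
    derivative at 0 then lifts f off zero, and the first later zero is sought beyond e.\<close>
  obtain e where e: "0 < e" "e < t" "0 < f e"
  proof (cases "f 0 = 0")
    case True
    then obtain d where d: "d > 0" "\<And>h. 0 < h \<Longrightarrow> h < d \<Longrightarrow> f 0 < f (0 + h)"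
      using DERIV_pos_inc_right[OF der zero, of 0] t by auto
    show thesis
      by (rule that[of "min d t / 2"]) (use d(2)[of "min d t / 2"] d(1) t True in auto)
  next
    case False
    hence "\<forall>\<^sub>F s in at 0. 0 < f s"
      using cont[of 0] t f0 by (intro order_tendstoD) (auto simp: isCont_def)
    then obtain d where d: "d > 0" "\<And>s. s \<noteq> 0 \<Longrightarrow> \<bar>s\<bar> < d \<Longrightarrow> 0 < f s"
      by (auto simp: eventually_at dist_real_def)
    show thesis
      by (rule that[of "min d t / 2"]) (use d(2)[of "min d t / 2"] d(1) t in auto)
  qed
  let ?Z = "{s \<in> {e..t}. f s \<le> 0}"
  have "continuous_on {e..t} f"
    using cont e t by (auto intro!: continuous_at_imp_continuous_on)
  hence "closed ?Z" by (rule continuous_on_closed_Collect_le) auto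
  hence "compact ?Z"
    by (auto simp: compact_eq_bounded_closed intro: bounded_subset[of "{e..t}"])
  moreover have "?Z \<noteq> {}" using \<open>\<not> 0 < f t\<close> e by auto
  ultimately obtain s where s: "s \<in> ?Z" "\<And>r. r \<in> ?Z \<Longrightarrow> s \<le> r"
    using compact_attains_inf[of ?Z] by blast
  have es: "e < s" using s e by (cases "s = e") auto
  have below: "0 < f r" if "e \<le> r" "r < s" for r
    using s(2)[of r] s(1) that by force
  have sT: "s \<in> {0..T}" using s es e t by auto
  have "0 \<le> f s"
  proof (rule tendsto_lowerbound)
    show "(f \<longlongrightarrow> f s) (at_left s)" using cont[OF sT] by (simp add: isCont_def filterlim_at_split)
    show "\<forall>\<^sub>F r in at_left s. 0 \<le> f r"
      by (rule eventually_mono[OF eventually_at_left_real[OF es]]) (rule less_imp_le, rule below, auto)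
  qed simp
  hence "f s = 0" using s by auto
  \<comment> \<open>At its first zero f arrives from positive values, whereas a positive derivative
    there would make it negative just before.\<close>
  from DERIV_pos_inc_left[OF der[OF sT] zero[OF sT this]]
  obtain d where d: "d > 0" "\<And>h. 0 < h \<Longrightarrow> h < d \<Longrightarrow> f (s - h) < f s" by auto
  define h where "h = min d (s - e) / 2"
  have "0 < h" "h < d" "h < s - e" using d es by (auto simp: h_def min_def)
  thus False using d(2)[of h] below[of "s - h"] \<open>f s = 0\<close> by auto
qed

lemma barrier_past:
  fixes f f' :: "real \<Rightarrow> real"
  assumes f0: "0 \<le> f 0" and der: "\<And>t. t \<in> {T..0} \<Longrightarrow> (f has_real_derivative f' t) (at t)"
    and zero: "\<And>t. t \<in> {T..0} \<Longrightarrow> f t = 0 \<Longrightarrow> f' t < 0" and t: "t \<in> {T..<0}"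
  shows "0 < f t"
proof -
  have "0 < f (- (- t))"
  proof (rule barrier_future[where f = "\<lambda>t. f (- t)" and f' = "\<lambda>t. - f' (- t)" and T = "- T"])
    show "((\<lambda>t. f (- t)) has_real_derivative - f' (- s)) (at s)" if "s \<in> {0..- T}" for s
      using DERIV_mirror[of f "f' (- s)" s] der[of "- s"] that by simp
  qed (use assms in auto)
  thus ?thesis by simp
qed

text \<open>Continuous induction: a failure on a compact interval would have a least time, and
  \<open>step\<close> excludes it. Since \<open>step\<close> knows P only before T, its user has to
  pass to the limit at T and still recover strict inequalities.\<close>

lemma bootstrap_future:
  fixes P :: "real \<Rightarrow> bool"
  assumes P0: "P 0" and op: "open {t. P t}" and step: "\<And>T. 0 < T \<Longrightarrow> (\<And>t. t \<in> {0..<T} \<Longrightarrow> P t) \<Longrightarrow> P T"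
    and t: "0 \<le> t"
  shows "P t"
proof (rule ccontr)
  assume "\<not> P t"
  let ?Z = "{0..t} \<inter> - {t. P t}"
  have "compact ?Z" using op by (intro compact_Int_closed) auto
  moreover have "?Z \<noteq> {}" using \<open>\<not> P t\<close> t by auto
  ultimately obtain s where s: "s \<in> ?Z" "\<And>r. r \<in> ?Z \<Longrightarrow> s \<le> r"
    using compact_attains_inf[of ?Z] by blast
  hence "0 < s" using P0 by (cases "s = 0") auto
  moreover have "P r" if "r \<in> {0..<s}" for r
    using s(2)[of r] s(1) that by force
  ultimately have "P s" by (rule step)
  thus False using s by auto
qed

lemma bootstrap_past:
  fixes P :: "real \<Rightarrow> bool"
  assumes P0: "P 0" and op: "open {t. P t}" and step: "\<And>T. T < 0 \<Longrightarrow> (\<And>t. t \<in> {T<..0} \<Longrightarrow> P t) \<Longrightarrow> P T"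
    and t: "t \<le> 0"
  shows "P t"
proof -
  have "P (- (- t))"
  proof (rule bootstrap_future[where P = "\<lambda>t. P (- t)" and t = "- t"])
    show "open {t. P (- t)}"
      using open_vimage[OF op continuous_on_minus[OF continuous_on_id]] by (simp add: vimage_def)
    show "P (- T)" if T: "0 < T" "\<And>t. t \<in> {0..<T} \<Longrightarrow> P (- t)" for T
    proof (rule step)
      fix t assume "t \<in> {- T<..0}"
      thus "P t" using T(2)[of "- t"] by auto
    qed (use T in auto)
  qed (use P0 t in auto)
  thus ?thesis by simp
qed

text \<open>Positivity is asked only inside the interval, because strict estimates such as
  \<open>p_sq_gt\<close> degenerate at time 0.\<close>

lemma strictly_increasing:
  fixes f f' :: "real \<Rightarrow> real"
  assumes "a < b" and der: "\<And>x. x \<in> {a..b} \<Longrightarrow> (f has_real_derivative f' x) (at x)"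
    and pos: "\<And>x. x \<in> {a<..<b} \<Longrightarrow> 0 < f' x"
  shows "f a < f b"
proof (rule DERIV_pos_imp_increasing_open[OF \<open>a < b\<close>])
  show "\<exists>y. (f has_real_derivative y) (at x) \<and> 0 < y" if "a < x" "x < b" for x
    using der[of x] pos[of x] that by (intro exI[of _ "f' x"]) auto
  show "continuous_on {a..b} f"
    using der by (meson continuous_at_imp_continuous_on DERIV_isCont)
qed

section \<open>The vector field in the variables H and p\<close>

definition planar_D :: "real \<Rightarrow> real" where
  "planar_D p = 5 - 6 * p\<^sup>2 + 9 * p ^ 4"

definition planar_N :: "real \<Rightarrow> real \<Rightarrow> real" where
  "planar_N H p = 24 * H\<^sup>2 - 5 - 18 * p\<^sup>2 - 9 * p ^ 4"

definition planar_M :: "real \<Rightarrow> real \<Rightarrow> real" where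
  "planar_M H p = (5 + 3 * p\<^sup>2) * (1 - 3 * p\<^sup>2) + 6 * H\<^sup>2 * (1 + 3 * p\<^sup>2)"

text \<open>\<open>planar_D\<close> is 6 p^2 times the determinant of the evolution equations after
  the constraint has removed \<phi>. This bound is the absence of singularities: the equations can
  be solved for the highest derivatives at every p.\<close>

lemma planar_D_ge: "4 \<le> planar_D p"
proof -
  have "planar_D p = (3 * p\<^sup>2 - 1)\<^sup>2 + 4"
    by (simp add: planar_D_def power2_eq_square power4_eq_xxxx algebra_simps)
  thus ?thesis by simp
qed

lemma planar_D_pos: "0 < planar_D p"
  using planar_D_ge[of p] by simp

text \<open>The set S is a parameter because positivity is at first known only up to the time
  reached by a continuation argument, and the estimates must already be available there.\<close>

locale planar =
  fixes H p :: "real \<Rightarrow> real" and S :: "real set"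
  assumes H_pos: "t \<in> S \<Longrightarrow> 0 < H t" and p_pos: "t \<in> S \<Longrightarrow> 0 < p t"
    and H_deriv: "t \<in> S \<Longrightarrow>
      (H has_real_derivative (H t)\<^sup>2 * planar_N (H t) (p t) / planar_D (p t)) (at t)"
    and p_deriv: "t \<in> S \<Longrightarrow>
      (p has_real_derivative 2 * H t * p t * planar_M (H t) (p t) / planar_D (p t)) (at t)"
begin

lemma p_sq_deriv: "t \<in> S \<Longrightarrow>
   ((\<lambda>t. (p t)\<^sup>2) has_real_derivative 4 * H t * ((p t)\<^sup>2 * planar_M (H t) (p t)) / planar_D (p t)) (at t)"
  by (rule DERIV_cong[OF DERIV_power[OF p_deriv, of _ 2]]) (auto simp: power2_eq_square)

lemma inverse_H_deriv: "t \<in> S \<Longrightarrow>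
   ((\<lambda>t. 1 / H t) has_real_derivative - (planar_N (H t) (p t) / planar_D (p t))) (at t)"
  by (rule DERIV_cong[OF DERIV_divide[OF DERIV_const H_deriv]]) (auto simp: power2_eq_square dest: H_pos)

lemma psi_deriv: "t \<in> S \<Longrightarrow> ((\<lambda>t. H t / p t) has_real_derivative
   H t / p t * (H t * ((planar_N (H t) (p t) - 2 * planar_M (H t) (p t)) / planar_D (p t)))) (at t)"
  by (rule DERIV_cong[OF DERIV_divide[OF H_deriv p_deriv]])
    (use p_pos[of t] in \<open>auto simp: power2_eq_square diff_divide_distrib right_diff_distrib mult_ac\<close>)

end

text \<open>The difference of the two sides factors over \<open>planar_D\<close> as - (5 + 3 y) (3 y
  - 1) (y - h). Consequently p^2 grows at a rate below 4 H^3, which is what the decay of 2 H^2 can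
  absorb.\<close>

lemma p_sq_growth:
  assumes "h < y" "1 < 3 * y" "y = p\<^sup>2" "h = H\<^sup>2"
  shows "y * planar_M H p / planar_D p < h"
proof -
  have "y * planar_M H p - h * planar_D p = - ((5 + 3 * y) * (3 * y - 1) * (y - h))"
    unfolding planar_M_def planar_D_def assms by algebra
  moreover have "0 < (5 + 3 * y) * (3 * y - 1) * (y - h)"
    using assms(1,2) by (intro mult_pos_pos) auto
  ultimately show ?thesis using planar_D_pos[of p] by (simp add: divide_less_eq)
qed

section \<open>The trajectory for positive times\<close>

locale planar_future = planar H p "{0..T}" for H p :: "real \<Rightarrow> real" and T :: real +
  fixes \<beta> :: real
  assumes \<beta>: "0 < \<beta>" "3 * \<beta>\<^sup>2 < 1" and H_0: "H 0 = \<beta>" and p_0: "p 0 = 1 / sqrt 3"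
begin

lemma p_sq_gt: assumes "t \<in> {0<..T}" shows "1 < 3 * (p t)\<^sup>2"
proof -
  have "0 < 3 * (p t)\<^sup>2 - 1"
  proof (rule barrier_future[where f = "\<lambda>t. 3 * (p t)\<^sup>2 - 1" and T = T])
    show "((\<lambda>t. 3 * (p t)\<^sup>2 - 1) has_real_derivative 3 * (4 * H t * ((p t)\<^sup>2 * planar_M (H t) (p t)) / planar_D (p t))) (at t)"
      if "t \<in> {0..T}" for t
      by (rule DERIV_cong[OF DERIV_diff[OF DERIV_cmult[OF p_sq_deriv[OF that]] DERIV_const]]) simp
    show "0 < 3 * (4 * H t * ((p t)\<^sup>2 * planar_M (H t) (p t)) / planar_D (p t))"
      if "t \<in> {0..T}" "3 * (p t)\<^sup>2 - 1 = 0" for t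
    proof -
      have y: "(p t)\<^sup>2 = 1 / 3" using that by simp
      have "0 < planar_M (H t) (p t)" using H_pos[OF that(1)] unfolding planar_M_def y by simp
      thus ?thesis using H_pos[OF that(1)] p_pos[OF that(1)] planar_D_pos[of "p t"] by simp
    qed
  qed (use assms in \<open>auto simp: p_0 power_divide\<close>)
  thus ?thesis by simp
qed

text \<open>On the diagonal H = p, \<open>planar_M\<close> equals \<open>planar_D\<close> and
  \<open>planar_N\<close> equals its negative, so p - H has derivative 3 p^2 there. Below the
  diagonal the expansion decelerates, since a''/a has the sign of H^2 - p^2.\<close>

lemma H_less_p: assumes "t \<in> {0..T}" shows "H t < p t"
proof -
  have "3 * \<beta>\<^sup>2 < 3 * (p 0)\<^sup>2" using \<beta> by (simp add: p_0 power_divide)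
  hence "\<beta> < p 0" using p_pos[of 0] assms by (simp add: power2_less_imp_less)
  hence 0: "H 0 < p 0" by (simp add: H_0)
  show ?thesis
  proof (cases "t = 0")
    case False
    have "0 < p t - H t"
    proof (rule barrier_future[where f = "\<lambda>t. p t - H t" and T = T])
      show "((\<lambda>t. p t - H t) has_real_derivative 2 * H t * p t * planar_M (H t) (p t) / planar_D (p t)
         - (H t)\<^sup>2 * planar_N (H t) (p t) / planar_D (p t)) (at t)" if "t \<in> {0..T}" for t
        using that by (intro DERIV_diff p_deriv H_deriv)
      show "0 < 2 * H t * p t * planar_M (H t) (p t) / planar_D (p t)
         - (H t)\<^sup>2 * planar_N (H t) (p t) / planar_D (p t)" if "t \<in> {0..T}" "p t - H t = 0" for t
      proof -
        have eq: "H t = p t" using that by simp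
        have "2 * planar_M (p t) (p t) - planar_N (p t) (p t) = 3 * planar_D (p t)"
          unfolding planar_M_def planar_D_def planar_N_def by algebra
        hence "2 * H t * p t * planar_M (H t) (p t) / planar_D (p t)
         - (H t)\<^sup>2 * planar_N (H t) (p t) / planar_D (p t) = (p t)\<^sup>2 * 3"
          using planar_D_pos[of "p t"] unfolding eq by (simp add: field_simps power2_eq_square)
        thus ?thesis using p_pos[OF that(1)] by simp
      qed
    qed (use assms 0 False in auto)
    thus ?thesis by simp
  qed (use 0 in simp)
qed

lemma H_sq_less: "t \<in> {0..T} \<Longrightarrow> (H t)\<^sup>2 < (p t)\<^sup>2"
  using H_less_p[of t] H_pos[of t] by (intro power_strict_mono) auto

text \<open>The ratio is the derivative of H divided by H^2, so 5 and 1 become the slopes of the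
  linear bounds on 1 / H. The first bound rests on a sum of squares, the second is
  \<open>H_less_p\<close> in another form.\<close>

lemma rate_bounds:
  assumes "t \<in> {0..T}"
  shows "- 5 < planar_N (H t) (p t) / planar_D (p t)" "planar_N (H t) (p t) / planar_D (p t) < - 1"
proof -
  have "planar_N (H t) (p t) + 5 * planar_D (p t) = 24 * (H t)\<^sup>2 + (6 * (p t)\<^sup>2 - 4)\<^sup>2 + 4"
    unfolding planar_D_def planar_N_def by algebra
  hence "0 < planar_N (H t) (p t) + 5 * planar_D (p t)"
    using zero_le_power2[of "H t"] zero_le_power2[of "6 * (p t)\<^sup>2 - 4"] by linarith
  thus "- 5 < planar_N (H t) (p t) / planar_D (p t)"
    using planar_D_pos[of "p t"] by (simp add: less_divide_eq)
  have "planar_N (H t) (p t) + planar_D (p t) = 24 * ((H t)\<^sup>2 - (p t)\<^sup>2)"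
    unfolding planar_D_def planar_N_def by algebra
  thus "planar_N (H t) (p t) / planar_D (p t) < - 1"
    using planar_D_pos[of "p t"] H_sq_less[OF assms] by (simp add: divide_less_eq)
qed

lemma H_bounds: assumes t: "t \<in> {0<..T}" shows "1 / (5 * t + 1 / \<beta>) < H t" "H t < 1 / (t + 1 / \<beta>)"
proof -
  have "1 / H 0 - 0 < 1 / H t - t"
  proof (rule strictly_increasing[where f = "\<lambda>t. 1 / H t - t", OF _ DERIV_diff[OF inverse_H_deriv DERIV_ident]])
    show "0 < - (planar_N (H s) (p s) / planar_D (p s)) - 1" if "s \<in> {0<..<t}" for s
      using rate_bounds(2)[of s] that t by simp
  qed (use t in auto)
  hence "t + 1 / \<beta> < 1 / H t" by (simp add: H_0)
  moreover have "0 < t + 1 / \<beta>" using t \<beta> by (simp add: add_pos_pos)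
  ultimately show "H t < 1 / (t + 1 / \<beta>)" using H_pos[of t] t by (simp add: field_simps)
  have "5 * 0 - 1 / H 0 < 5 * t - 1 / H t"
  proof (rule strictly_increasing[where f = "\<lambda>t. 5 * t - 1 / H t",
        OF _ DERIV_diff[OF DERIV_cmult[OF DERIV_ident] inverse_H_deriv]])
    show "0 < 5 * 1 - - (planar_N (H s) (p s) / planar_D (p s))" if "s \<in> {0<..<t}" for s
      using rate_bounds(1)[of s] that t by simp
  qed (use t in auto)
  hence "1 / H t < 5 * t + 1 / \<beta>" by (simp add: H_0)
  moreover have "0 < 5 * t + 1 / \<beta>" using t \<beta> by (simp add: add_pos_pos)
  ultimately show "1 / (5 * t + 1 / \<beta>) < H t" using H_pos[of t] t by (simp add: field_simps)
qed

lemma p_sq_rate: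
  assumes "t \<in> {0<..T}"
  shows "4 * H t * ((p t)\<^sup>2 * planar_M (H t) (p t)) / planar_D (p t) < 4 * H t * (H t)\<^sup>2"
proof -
  have "(p t)\<^sup>2 * planar_M (H t) (p t) / planar_D (p t) < (H t)\<^sup>2"
    using assms by (intro p_sq_growth[of "(H t)\<^sup>2" "(p t)\<^sup>2"] H_sq_less p_sq_gt) auto
  hence "4 * H t * ((p t)\<^sup>2 * planar_M (H t) (p t) / planar_D (p t)) < 4 * H t * (H t)\<^sup>2"
    using H_pos[of t] assms by (intro mult_strict_left_mono) auto
  thus ?thesis by simp
qed

text \<open>The rate of p^2 stays below 4 H^3 while that of 2 H^2 stays below - 4 H^3. The right
  side is below 1 exactly when 3 \<beta>^2 < 1, which confines p to the unit square.\<close>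

lemma p_sq_upper: assumes t: "t \<in> {0<..T}" shows "(p t)\<^sup>2 + 2 * (H t)\<^sup>2 < 1 / 3 + 2 * \<beta>\<^sup>2"
proof -
  let ?r = "\<lambda>s. planar_N (H s) (p s) / planar_D (p s)"
  have H2: "((\<lambda>t. 2 * (H t)\<^sup>2) has_real_derivative 4 * H s * (H s)\<^sup>2 * ?r s) (at s)" if "s \<in> {0..t}" for s
  proof -
    have s: "s \<in> {0..T}" using that t by auto
    show ?thesis
      by (rule DERIV_cong[OF DERIV_cmult[OF DERIV_power[OF H_deriv[OF s], of 2]]]) simp
  qed
  have "- ((p 0)\<^sup>2 + 2 * (H 0)\<^sup>2) < - ((p t)\<^sup>2 + 2 * (H t)\<^sup>2)"
  proof (rule strictly_increasing[where f = "\<lambda>t. - ((p t)\<^sup>2 + 2 * (H t)\<^sup>2)",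
        OF _ DERIV_minus[OF DERIV_add[OF p_sq_deriv H2]]])
    fix s assume s: "s \<in> {0<..<t}"
    have "4 * H s * (H s)\<^sup>2 * ?r s < 4 * H s * (H s)\<^sup>2 * (- 1)"
      using H_pos[of s] rate_bounds(2)[of s] s t by (intro mult_strict_left_mono) auto
    thus "0 < - (4 * H s * ((p s)\<^sup>2 * planar_M (H s) (p s)) / planar_D (p s) + 4 * H s * (H s)\<^sup>2 * ?r s)"
      using p_sq_rate[of s] s t by auto
  qed (use t in auto)
  thus ?thesis by (simp add: H_0 p_0 power_divide)
qed

text \<open>The derivative of 3 p^2 is below 12 H^3, hence below 12 \<beta>^2 H, and the upper bound
  on H integrates to a logarithm. This bound on p is needed to estimate \<psi> = H / p from
  below.\<close>

lemma p_sq_upper_ln: assumes t: "t \<in> {0<..T}" shows "3 * (p t)\<^sup>2 < 1 + 12 * \<beta>\<^sup>2 * ln (\<beta> * t + 1)"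
proof -
  have L: "((\<lambda>t. 12 * \<beta>\<^sup>2 * ln (\<beta> * t + 1)) has_real_derivative 12 * \<beta>\<^sup>2 * (1 / (s + 1 / \<beta>))) (at s)"
    if "0 \<le> s" for s
  proof -
    have pos: "0 < \<beta> * s + 1" using that \<beta> by (simp add: add_nonneg_pos)
    have "((\<lambda>t. \<beta> * t + 1) has_real_derivative \<beta>) (at s)" by (auto intro!: derivative_eq_intros)
    from DERIV_chain2[OF DERIV_ln_divide[OF pos] this]
    have "((\<lambda>t. ln (\<beta> * t + 1)) has_real_derivative 1 / (s + 1 / \<beta>)) (at s)"
      by (rule DERIV_cong) (use \<beta> in \<open>simp add: field_simps\<close>)
    thus ?thesis by (rule DERIV_cmult)
  qed
  have "12 * \<beta>\<^sup>2 * ln (\<beta> * 0 + 1) - 3 * (p 0)\<^sup>2 < 12 * \<beta>\<^sup>2 * ln (\<beta> * t + 1) - 3 * (p t)\<^sup>2"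
  proof (rule strictly_increasing[where f = "\<lambda>t. 12 * \<beta>\<^sup>2 * ln (\<beta> * t + 1) - 3 * (p t)\<^sup>2",
        OF _ DERIV_diff[OF L DERIV_cmult[OF p_sq_deriv]]])
    fix s assume s: "s \<in> {0<..<t}"
    have Hs: "0 < H s" "H s < 1 / (s + 1 / \<beta>)" using H_pos[of s] H_bounds(2)[of s] s t by auto
    have "1 / (s + 1 / \<beta>) \<le> 1 / (1 / \<beta>)"
      using s \<beta> by (intro divide_left_mono) (auto intro!: divide_pos_pos add_pos_pos)
    hence "1 / (s + 1 / \<beta>) \<le> \<beta>" by simp
    hence "(H s)\<^sup>2 \<le> \<beta>\<^sup>2" using Hs by (intro power_mono) auto
    hence "4 * H s * (H s)\<^sup>2 \<le> 4 * H s * \<beta>\<^sup>2" using Hs by (intro mult_left_mono) auto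
    also have "\<dots> < 4 * (1 / (s + 1 / \<beta>)) * \<beta>\<^sup>2" using Hs \<beta> by (intro mult_strict_right_mono) auto
    finally show "0 < 12 * \<beta>\<^sup>2 * (1 / (s + 1 / \<beta>))
       - 3 * (4 * H s * ((p s)\<^sup>2 * planar_M (H s) (p s)) / planar_D (p s))"
      using p_sq_rate[of s] s t by auto
  qed (use t in auto)
  thus ?thesis by (simp add: p_0 power_divide)
qed

end

section \<open>The trajectory for negative times\<close>

locale planar_past = planar H p "{T..0}" for H p :: "real \<Rightarrow> real" and T :: real +
  fixes \<beta> :: real
  assumes \<beta>: "0 < \<beta>" "3 * \<beta>\<^sup>2 < 1" and H_0: "H 0 = \<beta>" and p_0: "p 0 = 1 / sqrt 3"
begin

lemma p_sq_le: assumes "t \<in> {T..0}" shows "3 * (p t)\<^sup>2 \<le> 1" "t < 0 \<Longrightarrow> 3 * (p t)\<^sup>2 < 1"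
proof -
  show less: "3 * (p t)\<^sup>2 < 1" if "t < 0"
  proof -
    have "0 < 1 - 3 * (p t)\<^sup>2"
    proof (rule barrier_past[where f = "\<lambda>t. 1 - 3 * (p t)\<^sup>2" and T = T])
      show "((\<lambda>t. 1 - 3 * (p t)\<^sup>2) has_real_derivative - (3 * (4 * H t * ((p t)\<^sup>2 * planar_M (H t) (p t)) / planar_D (p t)))) (at t)"
        if "t \<in> {T..0}" for t
        by (rule DERIV_cong[OF DERIV_diff[OF DERIV_const DERIV_cmult[OF p_sq_deriv[OF that]]]]) simp
      show "- (3 * (4 * H t * ((p t)\<^sup>2 * planar_M (H t) (p t)) / planar_D (p t))) < 0"
        if "t \<in> {T..0}" "1 - 3 * (p t)\<^sup>2 = 0" for t
      proof -
        have y: "(p t)\<^sup>2 = 1 / 3" using that by simp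
        have "0 < planar_M (H t) (p t)" using H_pos[OF that(1)] unfolding planar_M_def y by simp
        thus ?thesis using H_pos[OF that(1)] p_pos[OF that(1)] planar_D_pos[of "p t"] by simp
      qed
    qed (use assms that in \<open>auto simp: p_0 power_divide\<close>)
    thus ?thesis by simp
  qed
  show "3 * (p t)\<^sup>2 \<le> 1"
    using less assms by (cases "t = 0") (auto simp: p_0 power_divide)
qed

text \<open>A quadratic in \<open>h\<close> whose discriminant is negative for \<open>3 y < 1\<close>.\<close>

lemma rate_lower:
  assumes "t \<in> {T..<0}"
  shows "3 * (H t)\<^sup>2 - 3 / 2 < (H t)\<^sup>2 * planar_N (H t) (p t) / planar_D (p t)"
proof -
  define y h where "y = (p t)\<^sup>2" and "h = (H t)\<^sup>2"
  have y: "0 \<le> y" "y < 1 / 3" using p_sq_le(2)[of t] assms by (auto simp: y_def)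
  \<comment> \<open>This discriminant vanishes at y = 1/3, the value at time 0, which is why the
    estimate is strict only for negative times.\<close>
  have "1296 * y ^ 4 + 144 * y\<^sup>2 + 864 * y - 320 < 0"
  proof -
    have 2: "y * y \<le> 1 / 3 * (1 / 3)" using y by (intro mult_mono) auto
    have "(y * y) * (y * y) \<le> 1 / 3 * (1 / 3) * (1 / 3 * (1 / 3))" using 2 y by (intro mult_mono) auto
    thus ?thesis using 2 y by (simp add: power2_eq_square power4_eq_xxxx mult.assoc)
  qed
  hence "0 < (48 * h - (20 + 36 * y\<^sup>2))\<^sup>2 - (1296 * y ^ 4 + 144 * y\<^sup>2 + 864 * y - 320)"
    using zero_le_power2[of "48 * h - (20 + 36 * y\<^sup>2)"] by linarith
  also have "\<dots> = 96 * (h * planar_N (H t) (p t) - (3 * h - 3 / 2) * planar_D (p t))"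
    unfolding planar_N_def planar_D_def y_def h_def by (simp add: power2_eq_square power4_eq_xxxx) algebra
  finally have "0 < h * planar_N (H t) (p t) - (3 * h - 3 / 2) * planar_D (p t)"
    by (rule zero_less_mult_pos) simp
  thus ?thesis using planar_D_pos[of "p t"] by (simp add: h_def less_divide_eq)
qed

text \<open>The solution of X' = 3 X^2 - 3/2 with X(0) = \<beta>. Backwards in time it rises to the
  equilibrium 1 / sqrt 2.\<close>

definition hubble_barrier :: "real \<Rightarrow> real" where
  "hubble_barrier t = (2 * \<beta> + sqrt 2 - (sqrt 2 - 2 * \<beta>) * exp (3 * sqrt 2 * t)) /
     (sqrt 2 * (2 * \<beta> + sqrt 2 + (sqrt 2 - 2 * \<beta>) * exp (3 * sqrt 2 * t)))"

lemma hubble_barrier_coeff_pos: "0 < sqrt 2 - 2 * \<beta>"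
proof -
  have "(2 * \<beta>)\<^sup>2 < (sqrt 2)\<^sup>2" using \<beta> by (simp add: power_mult_distrib)
  thus ?thesis using power2_less_imp_less[of "2 * \<beta>" "sqrt 2"] by simp
qed

lemma hubble_barrier_denominator: "0 < 2 * \<beta> + sqrt 2 + (sqrt 2 - 2 * \<beta>) * exp (3 * sqrt 2 * t)"
  using hubble_barrier_coeff_pos \<beta> by (intro add_pos_pos mult_pos_pos) auto

lemma hubble_barrier_less: "hubble_barrier t < 1 / sqrt 2"
  using hubble_barrier_denominator[of t] mult_pos_pos[OF hubble_barrier_coeff_pos exp_gt_zero[of "3 * sqrt 2 * t"]]
  unfolding hubble_barrier_def by (simp add: divide_less_eq)

lemma hubble_barrier_deriv: "(hubble_barrier has_real_derivative 3 * (hubble_barrier t)\<^sup>2 - 3 / 2) (at t)"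
proof -
  define A B where "A = 2 * \<beta> + sqrt 2" and "B = sqrt 2 - 2 * \<beta>"
  define E where "E = exp (3 * sqrt 2 * t)"
  have nz: "A + B * E \<noteq> 0" using hubble_barrier_denominator[of t] by (simp add: A_def B_def E_def)
  have E: "((\<lambda>t. exp (3 * sqrt 2 * t)) has_real_derivative E * (3 * sqrt 2)) (at t)"
    unfolding E_def by (auto intro!: derivative_eq_intros)
  have num: "((\<lambda>t. A - B * exp (3 * sqrt 2 * t)) has_real_derivative - (B * (E * (3 * sqrt 2)))) (at t)"
    by (rule DERIV_cong[OF DERIV_diff[OF DERIV_const DERIV_cmult[OF E]]]) simp
  have den: "((\<lambda>t. sqrt 2 * (A + B * exp (3 * sqrt 2 * t))) has_real_derivative sqrt 2 * (B * (E * (3 * sqrt 2)))) (at t)"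
    by (rule DERIV_cong[OF DERIV_cmult[OF DERIV_add[OF DERIV_const DERIV_cmult[OF E]]]]) simp
  have s2: "sqrt 2 * sqrt 2 = 2" by simp
  have "((\<lambda>t. (A - B * exp (3 * sqrt 2 * t)) / (sqrt 2 * (A + B * exp (3 * sqrt 2 * t)))) has_real_derivative
     (- (B * (E * (3 * sqrt 2))) * (sqrt 2 * (A + B * E)) - (A - B * E) * (sqrt 2 * (B * (E * (3 * sqrt 2)))))
       / ((sqrt 2 * (A + B * E)) * (sqrt 2 * (A + B * E)))) (at t)"
    using DERIV_divide[OF num den] nz by (simp add: E_def)
  moreover have "(- (B * (E * (3 * sqrt 2))) * (sqrt 2 * (A + B * E)) - (A - B * E) * (sqrt 2 * (B * (E * (3 * sqrt 2)))))
       / ((sqrt 2 * (A + B * E)) * (sqrt 2 * (A + B * E))) = 3 * ((A - B * E) / (sqrt 2 * (A + B * E)))\<^sup>2 - 3 / 2"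
  proof -
    have "- (B * (E * (3 * sqrt 2))) * (sqrt 2 * (A + B * E)) - (A - B * E) * (sqrt 2 * (B * (E * (3 * sqrt 2))))
      = - (3 * (sqrt 2 * sqrt 2) * (2 * A * B * E))" by (simp add: algebra_simps)
    moreover have "(sqrt 2 * (A + B * E)) * (sqrt 2 * (A + B * E)) = (sqrt 2 * sqrt 2) * (A + B * E)\<^sup>2"
      by (simp add: power2_eq_square algebra_simps)
    ultimately show ?thesis using nz unfolding power_divide power_mult_distrib s2
      by (simp add: divide_simps) (simp add: power2_eq_square algebra_simps)
  qed
  ultimately show ?thesis
    unfolding hubble_barrier_def[abs_def] A_def[symmetric] B_def[symmetric] E_def[symmetric] by simp
qed

lemma hubble_barrier_0: "hubble_barrier 0 = \<beta>"
  by (simp add: hubble_barrier_def field_simps)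

lemma H_upper: assumes t: "t \<in> {T..<0}" shows "H t < hubble_barrier t"
proof -
  have "0 < hubble_barrier t - H t"
  proof (rule barrier_past[where f = "\<lambda>t. hubble_barrier t - H t" and T = T])
    show "((\<lambda>t. hubble_barrier t - H t) has_real_derivative 3 * (hubble_barrier t)\<^sup>2 - 3 / 2 - (H t)\<^sup>2 * planar_N (H t) (p t) / planar_D (p t)) (at t)"
      if "t \<in> {T..0}" for t
      using that by (intro DERIV_diff hubble_barrier_deriv H_deriv)
    show "3 * (hubble_barrier t)\<^sup>2 - 3 / 2 - (H t)\<^sup>2 * planar_N (H t) (p t) / planar_D (p t) < 0"
      if t: "t \<in> {T..0}" "hubble_barrier t - H t = 0" for t
    proof (cases "t = 0")
      case False
      thus ?thesis using rate_lower[of t] t by simp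
    next
      \<comment> \<open>At time 0 the discriminant in \<open>rate_lower\<close> is zero, so the sign
        is computed directly: the remaining square vanishes only for 2 \<beta>^2 = 1, which is
        excluded.\<close>
      case True
      have r: "planar_N (H 0) (p 0) / planar_D (p 0) = 6 * \<beta>\<^sup>2 - 3"
        by (simp add: planar_N_def planar_D_def H_0 p_0 power_divide power4_eq_xxxx)
      have "3 * (hubble_barrier t)\<^sup>2 - 3 / 2 - (H t)\<^sup>2 * planar_N (H t) (p t) / planar_D (p t) = - (3 / 2 * (1 - 2 * \<beta>\<^sup>2)\<^sup>2)"
        unfolding True hubble_barrier_0 times_divide_eq_right[symmetric] unfolding r unfolding H_0 by (simp add: power2_eq_square algebra_simps)
      moreover have "0 < (1 - 2 * \<beta>\<^sup>2)\<^sup>2" using \<beta> by simp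
      ultimately show ?thesis by linarith
    qed
  qed (use t in \<open>auto simp: hubble_barrier_0 H_0\<close>)
  thus ?thesis by simp
qed

lemma H_less: assumes "t \<in> {T..0}" shows "H t < 1 / sqrt 2" "(H t)\<^sup>2 \<le> 1 / 2" "H t < 1"
proof -
  show *: "H t < 1 / sqrt 2"
    using H_upper[of t] hubble_barrier_less[of t] assms hubble_barrier_0 by (cases "t = 0") (auto simp: H_0)
  have "(H t)\<^sup>2 \<le> (1 / sqrt 2)\<^sup>2" using * H_pos[OF assms] by (intro power_mono) auto
  thus "(H t)\<^sup>2 \<le> 1 / 2" by (simp add: power_divide)
  have "1 / sqrt 2 < 1" by simp
  thus "H t < 1" using * by linarith
qed

text \<open>The right side is the value of the ratio at p = 0. Away from p = 0 the ratio is smaller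
  because H^2 \<le> 1/2, so this needs the upper barrier first.\<close>

lemma rate_upper:
  assumes "t \<in> {T..0}"
  shows "planar_N (H t) (p t) / planar_D (p t) < 24 * (H t)\<^sup>2 / 5 - 1"
proof -
  have "5 * planar_N (H t) (p t) - (24 * (H t)\<^sup>2 - 5) * planar_D (p t)
      = - (p t)\<^sup>2 * (120 - 144 * (H t)\<^sup>2 + 216 * ((H t)\<^sup>2 * (p t)\<^sup>2))"
    unfolding planar_N_def planar_D_def by (simp add: power2_eq_square power4_eq_xxxx) algebra
  moreover have "0 < (p t)\<^sup>2 * (120 - 144 * (H t)\<^sup>2 + 216 * ((H t)\<^sup>2 * (p t)\<^sup>2))"
  proof -
    have "0 \<le> (H t)\<^sup>2 * (p t)\<^sup>2" by simp
    hence "0 < 120 - 144 * (H t)\<^sup>2 + 216 * ((H t)\<^sup>2 * (p t)\<^sup>2)"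
      using H_less(2)[OF assms] by linarith
    thus ?thesis using p_pos[OF assms] by (intro mult_pos_pos) auto
  qed
  ultimately have "5 * planar_N (H t) (p t) < (24 * (H t)\<^sup>2 - 5) * planar_D (p t)" by linarith
  thus ?thesis using planar_D_pos[of "p t"] by (simp add: field_simps)
qed

text \<open>The quotient is the logarithmic derivative of \<psi> = H / p divided by H. With H < 1
  the constant 12 gives growth of \<psi> into the past by at most exp (- 12 t); the constant 3/2
  combines with a lower bound on H to give exponential growth at least.\<close>

lemma psi_rate:
  assumes "t \<in> {T..0}"
  shows "- 12 < (planar_N (H t) (p t) - 2 * planar_M (H t) (p t)) / planar_D (p t)"
    and "(planar_N (H t) (p t) - 2 * planar_M (H t) (p t)) / planar_D (p t) < - 3 / 2"
proof -
  define y h where "y = (p t)\<^sup>2" and "h = (H t)\<^sup>2"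
  have y: "0 < y" "3 * y \<le> 1" using p_sq_le(1)[OF assms] p_pos[OF assms] by (auto simp: y_def)
  have h: "0 \<le> h" "h \<le> 1 / 2" using H_less(2)[OF assms] by (auto simp: h_def)
  have yy: "0 \<le> y * y" "y * y \<le> y * 1" using y by (auto intro: mult_left_mono)
  have hy: "0 \<le> h * (1 - 3 * y)" using h y by simp
  have hy2: "h * (1 - 3 * y) \<le> 1 / 2 * (1 - 3 * y)" by (rule mult_right_mono) (use h y in auto)
  have "planar_N (H t) (p t) - 2 * planar_M (H t) (p t) + 12 * planar_D (p t)
     = 12 * (h * (1 - 3 * y)) + 45 - 66 * y + 117 * (y * y)"
    unfolding planar_N_def planar_D_def planar_M_def y_def h_def
    by (simp add: power2_eq_square power4_eq_xxxx) algebra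
  hence "0 < planar_N (H t) (p t) - 2 * planar_M (H t) (p t) + 12 * planar_D (p t)"
    using hy yy y by linarith
  thus "- 12 < (planar_N (H t) (p t) - 2 * planar_M (H t) (p t)) / planar_D (p t)"
    using planar_D_pos[of "p t"] by (simp add: less_divide_eq)
  have "planar_N (H t) (p t) - 2 * planar_M (H t) (p t) + 3 / 2 * planar_D (p t)
     = 12 * (h * (1 - 3 * y)) - 15 / 2 - 3 * y + 45 / 2 * (y * y)"
    unfolding planar_N_def planar_D_def planar_M_def y_def h_def
    by (simp add: power2_eq_square power4_eq_xxxx) algebra
  also have "\<dots> < 0"
  proof -
    have "y * y \<le> y * (1 / 3)" using y by (intro mult_left_mono) auto
    moreover have "12 * z - 15 / 2 - 3 * y + 45 / 2 * w < 0" if "z \<le> 1 / 2 * (1 - 3 * y)" "w \<le> y * (1 / 3)" for z w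
      using that y by (simp add: algebra_simps)
    ultimately show ?thesis using hy2 by blast
  qed
  finally have "planar_N (H t) (p t) - 2 * planar_M (H t) (p t) + 3 / 2 * planar_D (p t) < 0" .
  thus "(planar_N (H t) (p t) - 2 * planar_M (H t) (p t)) / planar_D (p t) < - 3 / 2"
    using planar_D_pos[of "p t"] by (simp add: divide_less_eq)
qed

lemma psi_upper: assumes t: "t \<in> {T..<0}" shows "H t / p t < sqrt 3 * exp (- 12 * t)"
proof -
  let ?q = "\<lambda>t. (planar_N (H t) (p t) - 2 * planar_M (H t) (p t)) / planar_D (p t)"
  have e: "((\<lambda>t. exp (12 * t)) has_real_derivative exp (12 * s) * 12) (at s)" for s :: real
    by (auto intro!: derivative_eq_intros)
  have "H t / p t * exp (12 * t) < H 0 / p 0 * exp (12 * 0)"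
  proof (rule strictly_increasing[where f = "\<lambda>t. H t / p t * exp (12 * t)", OF _ DERIV_mult[OF psi_deriv e]])
    fix s assume "s \<in> {t<..<0}"
    hence s: "s \<in> {T..0}" using t by auto
    have "H s * - 12 < H s * ?q s" by (rule mult_strict_left_mono[OF psi_rate(1)[OF s] H_pos[OF s]])
    hence "0 < H s * ?q s + 12" using H_less(3)[OF s] by linarith
    hence "0 < H s / p s * (exp (12 * s) * (H s * ?q s + 12))"
      using H_pos[OF s] p_pos[OF s] by simp
    thus "0 < H s / p s * (H s * ?q s) * exp (12 * s) + exp (12 * s) * 12 * (H s / p s)"
      by (simp add: algebra_simps)
  qed (use t in auto)
  also have "\<dots> = sqrt 3 * \<beta>" by (simp add: H_0 p_0)
  also have "\<dots> < sqrt 3"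
  proof -
    have "\<beta>\<^sup>2 < 1\<^sup>2" using \<beta> by simp
    hence "\<beta> < 1" by (rule power2_less_imp_less) simp
    thus ?thesis by simp
  qed
  finally show ?thesis by (simp add: exp_minus field_simps)
qed

lemma psi_lower:
  assumes t: "t \<in> {T..<0}" and k: "\<And>s. s \<in> {T..0} \<Longrightarrow> k \<le> 3 / 2 * H s"
  shows "sqrt 3 * \<beta> * exp (- k * t) < H t / p t"
proof -
  let ?q = "\<lambda>t. (planar_N (H t) (p t) - 2 * planar_M (H t) (p t)) / planar_D (p t)"
  have e: "((\<lambda>t. exp (k * t)) has_real_derivative exp (k * s) * k) (at s)" for s :: real
    by (auto intro!: derivative_eq_intros)
  have "- (H t / p t * exp (k * t)) < - (H 0 / p 0 * exp (k * 0))"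
  proof (rule strictly_increasing[where f = "\<lambda>t. - (H t / p t * exp (k * t))", OF _ DERIV_minus[OF DERIV_mult[OF psi_deriv e]]])
    fix s assume "s \<in> {t<..<0}"
    hence s: "s \<in> {T..0}" using t by auto
    have "H s * ?q s < H s * (- 3 / 2)" by (rule mult_strict_left_mono[OF psi_rate(2)[OF s] H_pos[OF s]])
    hence "0 < - (H s * ?q s + k)" using k[OF s] by linarith
    hence "0 < H s / p s * (exp (k * s) * - (H s * ?q s + k))"
      using H_pos[OF s] p_pos[OF s] by (intro mult_pos_pos) auto
    thus "0 < - (H s / p s * (H s * ?q s) * exp (k * s) + exp (k * s) * k * (H s / p s))"
      by (simp add: algebra_simps)
  qed (use t in auto)
  hence "sqrt 3 * \<beta> < H t / p t * exp (k * t)" by (simp add: H_0 p_0 mult.commute)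
  thus ?thesis by (simp add: exp_minus field_simps)
qed

text \<open>Both branches of \<open>frakL\<close> solve a logistic equation \<open>L' = 10 L\<^sup>2 - b L\<close>; the cubic estimate on the rate
  at a crossing point holds because there \<open>c \<le> L = H < 1 / sqrt 2\<close>.\<close>

lemma H_lower_logistic:
  assumes t: "t \<in> {T..<0}"
    and L0: "L 0 = \<beta>" and L: "\<And>t. t \<in> {T..0} \<Longrightarrow> (L has_real_derivative 10 * (L t)\<^sup>2 - b * L t) (at t)"
    and c: "0 < c" "\<And>t. t \<in> {T..0} \<Longrightarrow> c \<le> L t" and cb: "24 / 5 * c ^ 3 + b \<le> 11 * c"
  shows "L t < H t"
proof -
  have "0 < H t - L t"
  proof (rule barrier_past[where f = "\<lambda>t. H t - L t" and T = T])
    show "((\<lambda>t. H t - L t) has_real_derivative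
       (H t)\<^sup>2 * planar_N (H t) (p t) / planar_D (p t) - (10 * (L t)\<^sup>2 - b * L t)) (at t)"
      if "t \<in> {T..0}" for t
      using that by (intro DERIV_diff L H_deriv)
    show "(H t)\<^sup>2 * planar_N (H t) (p t) / planar_D (p t) - (10 * (L t)\<^sup>2 - b * L t) < 0"
      if t: "t \<in> {T..0}" "H t - L t = 0" for t
    proof -
      have x: "c \<le> H t" "0 < H t" "(H t)\<^sup>2 \<le> 1 / 2" using c(2)[OF t(1)] t(2) H_pos[OF t(1)] H_less(2)[OF t(1)] by auto
      have cc: "c * c \<le> H t * H t" "H t * c \<le> H t * H t" using x c(1) by (auto intro: mult_mono)
      \<comment> \<open>The second factor of H^3 - c^3 is at most 3 H^2 \<le> 3/2. Thus 24/5 H^3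
        grows from c with slope at most 36/5, less than the slope 11 on the other side, and it
        suffices to compare both sides at c.\<close>
      have "(H t - c) * (H t * H t + H t * c + c * c) \<le> (H t - c) * (3 / 2)"
      proof (rule mult_left_mono)
        show "H t * H t + H t * c + c * c \<le> 3 / 2" using x(3) cc unfolding power2_eq_square by linarith
      qed (use x in simp)
      moreover have "(H t - c) * (H t * H t + H t * c + c * c) = H t ^ 3 - c ^ 3"
        by (simp add: power3_eq_cube algebra_simps)
      ultimately have "H t ^ 3 \<le> c ^ 3 + (H t - c) * (3 / 2)" by linarith
      hence "24 / 5 * H t ^ 3 + b \<le> 11 * H t" using cb x(1) by argo
      moreover have "(H t)\<^sup>2 * planar_N (H t) (p t) / planar_D (p t) < (H t)\<^sup>2 * (24 * (H t)\<^sup>2 / 5 - 1)"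
        unfolding times_divide_eq_right[symmetric] using rate_upper[OF t(1)] x by (intro mult_strict_left_mono) auto
      moreover have "(H t)\<^sup>2 * (24 * (H t)\<^sup>2 / 5 - 1) - (10 * (H t)\<^sup>2 - b * H t) = H t * (24 / 5 * H t ^ 3 + b - 11 * H t)"
        by (simp add: power2_eq_square power3_eq_cube algebra_simps)
      moreover have "H t * (24 / 5 * H t ^ 3 + b - 11 * H t) \<le> 0"
        using calculation(1) x by (intro mult_nonneg_nonpos) auto
      ultimately show ?thesis using t(2) by auto
    qed
  qed (use t in \<open>auto simp: L0 H_0\<close>)
  thus ?thesis by simp
qed

end

text \<open>The logistic equation has the equilibrium 227 \<beta> / 225, slightly above \<beta>.
  Backwards in time this branch rises towards it, so its least value for t \<le> 0 is the initial
  one.\<close>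

lemma frakL_small:
  assumes "0 < \<beta>" "\<beta> \<le> sqrt (5 / 27)"
  shows "frakL \<beta> 0 = \<beta>"
    and "(frakL \<beta> has_real_derivative 10 * (frakL \<beta> t)\<^sup>2 - 454 / 45 * \<beta> * frakL \<beta> t) (at t)"
    and "t < 0 \<Longrightarrow> \<beta> < frakL \<beta> t"
proof -
  have eq: "frakL \<beta> = (\<lambda>t. 227 * \<beta> / (2 * exp (454 * \<beta> * t / 45) + 225))"
    using assms by (simp add: frakL_def fun_eq_iff)
  show "frakL \<beta> 0 = \<beta>" by (simp add: eq)
  define E where "E = exp (454 * \<beta> * t / 45)"
  have E: "0 < E" by (simp add: E_def)
  have "((\<lambda>t. exp (454 * \<beta> * t / 45)) has_real_derivative E * (454 * \<beta> / 45)) (at t)"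
    unfolding E_def by (auto intro!: derivative_eq_intros)
  from DERIV_add[OF DERIV_cmult[OF this] DERIV_const]
  have D: "((\<lambda>t. 2 * exp (454 * \<beta> * t / 45) + 225) has_real_derivative 2 * (E * (454 * \<beta> / 45)) + 0) (at t)" .
  have "((\<lambda>t. 227 * \<beta> / (2 * exp (454 * \<beta> * t / 45) + 225)) has_real_derivative
     (0 * (2 * E + 225) - 227 * \<beta> * (2 * (E * (454 * \<beta> / 45)) + 0)) / ((2 * E + 225) * (2 * E + 225))) (at t)"
    using DERIV_divide[OF DERIV_const[of "227 * \<beta>"] D] E unfolding E_def[symmetric] by simp
  moreover have "(0 * (2 * E + 225) - 227 * \<beta> * (2 * (E * (454 * \<beta> / 45)) + 0)) / ((2 * E + 225) * (2 * E + 225))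
     = 10 * (227 * \<beta> / (2 * E + 225))\<^sup>2 - 454 / 45 * \<beta> * (227 * \<beta> / (2 * E + 225))"
    using E by (simp add: divide_simps power2_eq_square) (simp add: algebra_simps)
  ultimately show "(frakL \<beta> has_real_derivative 10 * (frakL \<beta> t)\<^sup>2 - 454 / 45 * \<beta> * frakL \<beta> t) (at t)"
    by (simp add: eq E_def)
  assume "t < 0"
  hence "E < 1" using assms by (simp add: E_def mult_pos_neg)
  hence "\<beta> * (2 * E + 225) < \<beta> * 227" using assms by (intro mult_strict_left_mono) auto
  hence "\<beta> < 227 * \<beta> / (2 * E + 225)" using E by (simp add: less_divide_eq mult.commute)
  thus "\<beta> < frakL \<beta> t" by (simp add: eq E_def)
qed

text \<open>The denominator vanishes at a positive time, so this branch is a barrier only for t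
  \<le> 0. It starts above the equilibrium 2/5 because 4/25 < 5/27.\<close>

lemma frakL_large_denominator:
  assumes "sqrt (5 / 27) < \<beta>"
  shows "2 / 5 < \<beta>" "t \<le> 0 \<Longrightarrow> 0 < 5 * \<beta> - (5 * \<beta> - 2) * exp (4 * t)"
proof -
  have "sqrt ((2 / 5)\<^sup>2) < sqrt (5 / 27)" by (rule real_sqrt_less_mono) (simp add: power2_eq_square)
  thus b: "2 / 5 < \<beta>" using assms by simp
  assume "t \<le> 0"
  hence "(5 * \<beta> - 2) * exp (4 * t) \<le> (5 * \<beta> - 2) * 1" using b by (intro mult_left_mono) auto
  thus "0 < 5 * \<beta> - (5 * \<beta> - 2) * exp (4 * t)" by simp
qed

lemma frakL_large:
  assumes "sqrt (5 / 27) < \<beta>"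
  shows "frakL \<beta> 0 = \<beta>"
    and "t \<le> 0 \<Longrightarrow> (frakL \<beta> has_real_derivative 10 * (frakL \<beta> t)\<^sup>2 - 4 * frakL \<beta> t) (at t)"
    and "t \<le> 0 \<Longrightarrow> 2 / 5 < frakL \<beta> t"
proof -
  have eq: "frakL \<beta> = (\<lambda>t. 2 * \<beta> / (5 * \<beta> - (5 * \<beta> - 2) * exp (4 * t)))"
    using assms by (simp add: frakL_def fun_eq_iff)
  show "frakL \<beta> 0 = \<beta>" by (simp add: eq)
  assume t: "t \<le> 0"
  define E where "E = exp (4 * t)"
  define C where "C = 5 * \<beta> - 2"
  note pos = frakL_large_denominator(2)[OF assms t, folded E_def C_def]
  have "((\<lambda>t. exp (4 * t)) has_real_derivative E * 4) (at t)"
    unfolding E_def by (auto intro!: derivative_eq_intros)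
  from DERIV_diff[OF DERIV_const DERIV_cmult[OF this]]
  have D: "((\<lambda>t. 5 * \<beta> - C * exp (4 * t)) has_real_derivative 0 - C * (E * 4)) (at t)" .
  have "((\<lambda>t. 2 * \<beta> / (5 * \<beta> - C * exp (4 * t))) has_real_derivative
     (0 * (5 * \<beta> - C * E) - 2 * \<beta> * (0 - C * (E * 4))) / ((5 * \<beta> - C * E) * (5 * \<beta> - C * E))) (at t)"
    using DERIV_divide[OF DERIV_const[of "2 * \<beta>"] D] pos unfolding E_def[symmetric] by simp
  moreover have "(0 * (5 * \<beta> - C * E) - 2 * \<beta> * (0 - C * (E * 4))) / ((5 * \<beta> - C * E) * (5 * \<beta> - C * E))
     = 10 * (2 * \<beta> / (5 * \<beta> - C * E))\<^sup>2 - 4 * (2 * \<beta> / (5 * \<beta> - C * E))"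
    using pos by (simp add: divide_simps power2_eq_square) (simp add: algebra_simps)
  ultimately show "(frakL \<beta> has_real_derivative 10 * (frakL \<beta> t)\<^sup>2 - 4 * frakL \<beta> t) (at t)"
    by (simp add: eq E_def C_def)
  have "0 < C * E" using frakL_large_denominator(1)[OF assms] by (simp add: C_def E_def)
  hence "2 / 5 * (5 * \<beta> - C * E) < 2 * \<beta>" by (simp add: algebra_simps)
  hence "2 / 5 < 2 * \<beta> / (5 * \<beta> - C * E)" using pos by (simp only: less_divide_eq if_True)
  thus "2 / 5 < frakL \<beta> t" by (simp add: eq E_def C_def)
qed

context planar_past
begin

lemma H_lower: assumes t: "t \<in> {T..<0}" shows "frakL \<beta> t < H t"
proof (cases "\<beta> \<le> sqrt (5 / 27)")
  case True
  have "\<beta>\<^sup>2 \<le> (sqrt (5 / 27))\<^sup>2" using True \<beta> by (intro power_mono) auto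
  hence b2: "\<beta>\<^sup>2 \<le> 5 / 27" by simp
  show ?thesis
  proof (rule H_lower_logistic[where L = "frakL \<beta>", OF t frakL_small(1,2)[OF \<beta>(1) True] \<beta>(1)])
    \<comment> \<open>At the threshold \<beta>^2 = 5/27 the bracket on the left is 494/45, barely
      below 11 = 495/45.\<close>
    have "\<beta> * (24 / 5 * \<beta>\<^sup>2 + 454 / 45) \<le> \<beta> * 11"
      using b2 \<beta> by (intro mult_left_mono) auto
    thus "24 / 5 * \<beta> ^ 3 + 454 / 45 * \<beta> \<le> 11 * \<beta>"
      by (simp add: power2_eq_square power3_eq_cube algebra_simps)
    show "\<beta> \<le> frakL \<beta> s" if "s \<in> {T..0}" for s
      using frakL_small(1)[OF \<beta>(1) True] frakL_small(3)[OF \<beta>(1) True, of s] that by (cases "s = 0") auto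
  qed
next
  case False
  hence l: "sqrt (5 / 27) < \<beta>" by simp
  show ?thesis
  proof (rule H_lower_logistic[where L = "frakL \<beta>" and b = 4 and c = "2 / 5", OF t frakL_large(1)[OF l]])
    show "(frakL \<beta> has_real_derivative 10 * (frakL \<beta> s)\<^sup>2 - 4 * frakL \<beta> s) (at s)" if "s \<in> {T..0}" for s
      using frakL_large(2)[OF l, of s] that by auto
    \<comment> \<open>For b = 4 the equilibrium of the logistic equation is 2/5, and this branch
      descends to it in the past without reaching it.\<close>
    show "2 / 5 \<le> frakL \<beta> s" if "s \<in> {T..0}" for s
      using frakL_large(3)[OF l, of s] that by auto
  qed (simp_all add: power3_eq_cube)
qed

lemma H_ge:
  assumes "t \<in> {T..0}"
  shows "\<beta> \<le> sqrt (5 / 27) \<Longrightarrow> \<beta> \<le> H t" and "sqrt (5 / 27) < \<beta> \<Longrightarrow> 2 / 5 \<le> H t"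
proof -
  show "\<beta> \<le> sqrt (5 / 27) \<Longrightarrow> \<beta> \<le> H t"
    using frakL_small(3)[of \<beta> t] H_lower[of t] assms \<beta> by (cases "t = 0") (auto simp: H_0)
  show "sqrt (5 / 27) < \<beta> \<Longrightarrow> 2 / 5 \<le> H t"
    using frakL_large(3)[of \<beta> t] frakL_large_denominator(1)[of \<beta>] H_lower[of t] assms by (cases "t = 0") (auto simp: H_0)
qed

lemma psi_lower_frakW: assumes t: "t \<in> {T..<0}" shows "frakW \<beta> t < H t / p t"
proof (cases "\<beta> \<le> sqrt (5 / 27)")
  case True
  have "\<beta>\<^sup>2 \<le> (sqrt (5 / 27))\<^sup>2" using True \<beta> by (intro power_mono) auto
  hence "\<beta> * (6 * \<beta>\<^sup>2) \<le> \<beta> * (3 / 2)" using \<beta> by (intro mult_left_mono) auto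
  hence "6 * \<beta> ^ 3 \<le> 3 / 2 * \<beta>" by (simp add: power2_eq_square power3_eq_cube)
  hence "6 * \<beta> ^ 3 \<le> 3 / 2 * H s" if "s \<in> {T..0}" for s
    using H_ge(1)[OF that True] by linarith
  from psi_lower[OF t this] show ?thesis using True by (simp add: frakW_def)
next
  case False
  hence l: "sqrt (5 / 27) < \<beta>" by simp
  \<comment> \<open>48/125 is 6 (2/5)^3: the rate 6 \<beta>^3 of the other branch with \<beta>
    replaced by the lower bound 2/5 of H.\<close>
  have "48 / 125 \<le> 3 / 2 * H s" if "s \<in> {T..0}" for s
    using H_ge(2)[OF that l] by linarith
  from psi_lower[OF t this] have "sqrt 3 * \<beta> * exp (- (48 / 125) * t) < H t / p t" by simp
  moreover have "2 * sqrt 3 / 5 * exp (- (48 / 125) * t) < sqrt 3 * \<beta> * exp (- (48 / 125) * t)"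
    using frakL_large_denominator(1)[OF l] by (intro mult_strict_right_mono) auto
  ultimately show ?thesis unfolding frakW_def using False by (simp only: if_False)
qed

end

section \<open>Uniqueness and the clamped vector field\<close>

lemma ode_unique:
  fixes x y :: "real \<Rightarrow> 'a::real_inner" and f :: "'a \<Rightarrow> 'a"
  assumes lip: "\<And>u v. dist (f u) (f v) \<le> L * dist u v"
    and x: "\<And>t. (x has_vector_derivative f (x t)) (at t)" and y: "\<And>t. (y has_vector_derivative f (y t)) (at t)"
    and init: "x 0 = y 0"
  shows "x t = y t"
proof -
  \<comment> \<open>Gronwall's argument for the squared distance: since its derivative is bounded by
    2 L n in modulus, the weight exp (- 2 L t) makes it nonincreasing in the future, and exp (2 L t)
    nondecreasing in the past.\<close>
  define n where "n = (\<lambda>t. (x t - y t) \<bullet> (x t - y t))"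
  define n' where "n' = (\<lambda>t. 2 * ((x t - y t) \<bullet> (f (x t) - f (y t))))"
  have n: "(n has_real_derivative n' t) (at t)" for t
  proof -
    have d: "((\<lambda>t. x t - y t) has_derivative (\<lambda>h. h *\<^sub>R (f (x t) - f (y t)))) (at t)"
      using has_vector_derivative_diff[OF x y, of t] by (simp add: has_vector_derivative_def)
    show ?thesis
      unfolding n_def has_field_derivative_def
      by (rule has_derivative_eq_rhs[OF has_derivative_inner[OF d d]]) (auto simp: n'_def inner_commute)
  qed
  have n': "\<bar>n' t\<bar> \<le> 2 * L * n t" for t
  proof -
    have "\<bar>n' t\<bar> \<le> 2 * (norm (x t - y t) * norm (f (x t) - f (y t)))"
      unfolding n'_def using Cauchy_Schwarz_ineq2[of "x t - y t" "f (x t) - f (y t)"] by simp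
    also have "\<dots> \<le> 2 * (norm (x t - y t) * (L * norm (x t - y t)))"
      using lip[of "x t" "y t"] by (intro mult_left_mono) (auto simp: dist_norm)
    also have "\<dots> = 2 * L * n t" by (simp add: n_def power2_norm_eq_inner[symmetric] power2_eq_square)
    finally show ?thesis .
  qed
  have e: "((\<lambda>t. exp (k * t)) has_real_derivative exp (k * t) * k) (at t)" for k t :: real
    by (auto intro!: derivative_eq_intros)
  have ne: "((\<lambda>t. n t * exp (k * t)) has_real_derivative (n' s + k * n s) * exp (k * s)) (at s)" for k s
    by (rule DERIV_cong[OF DERIV_mult[OF n e]]) (simp add: algebra_simps)
  have n0: "n 0 = 0" by (simp add: n_def init)
  have "n t \<le> 0"
  proof (cases "0 \<le> t")
    case True
    have "n t * exp (- (2 * L) * t) \<le> n 0 * exp (- (2 * L) * 0)"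
    proof (rule DERIV_nonpos_imp_nonincreasing[OF True])
      fix s :: real
      have "(n' s + - (2 * L) * n s) * exp (- (2 * L) * s) \<le> 0"
        using n'[of s] by (intro mult_nonpos_nonneg) auto
      thus "\<exists>z. ((\<lambda>t. n t * exp (- (2 * L) * t)) has_real_derivative z) (at s) \<and> z \<le> 0"
        using ne by blast
    qed
    thus ?thesis by (simp add: n0 mult_le_0_iff)
  next
    case False
    hence "t \<le> 0" by simp
    have "n t * exp (2 * L * t) \<le> n 0 * exp (2 * L * 0)"
    proof (rule DERIV_nonneg_imp_nondecreasing[OF \<open>t \<le> 0\<close>])
      fix s :: real
      have "0 \<le> (n' s + 2 * L * n s) * exp (2 * L * s)"
        using n'[of s] by (intro mult_nonneg_nonneg) auto
      thus "\<exists>z. ((\<lambda>t. n t * exp (2 * L * t)) has_real_derivative z) (at s) \<and> 0 \<le> z"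
        using ne by blast
    qed
    thus ?thesis by (simp add: n0 mult_le_0_iff)
  qed
  hence "(x t - y t) \<bullet> (x t - y t) = 0" unfolding n_def by (rule antisym) simp
  thus ?thesis by simp
qed

text \<open>Boundedness is included so that products and quotients of such functions are again
  Lipschitz, and the rational vector field can be treated structurally.\<close>

definition bounded_lipschitz :: "('a::metric_space \<Rightarrow> real) \<Rightarrow> bool" where
  "bounded_lipschitz f \<longleftrightarrow> (\<exists>B L. \<forall>x y. \<bar>f x\<bar> \<le> B \<and> \<bar>f x - f y\<bar> \<le> L * dist x y)"

lemma bounded_lipschitzI:
  "(\<And>x. \<bar>f x\<bar> \<le> B) \<Longrightarrow> (\<And>x y. \<bar>f x - f y\<bar> \<le> L * dist x y) \<Longrightarrow> bounded_lipschitz f"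
  unfolding bounded_lipschitz_def by blast

lemma bounded_lipschitzE:
  assumes "bounded_lipschitz f"
  obtains B L where "0 \<le> B" "0 \<le> L" "\<And>x. \<bar>f x\<bar> \<le> B" "\<And>x y. \<bar>f x - f y\<bar> \<le> L * dist x y"
proof -
  obtain B L where *: "\<And>x. \<bar>f x\<bar> \<le> B" "\<And>x y. \<bar>f x - f y\<bar> \<le> L * dist x y"
    using assms unfolding bounded_lipschitz_def by blast
  have "\<bar>f x - f y\<bar> \<le> \<bar>L\<bar> * dist x y" for x y
    using *(2)[of x y] by (meson abs_ge_self mult_right_mono order_trans zero_le_dist)
  moreover have "0 \<le> B" using *(1)[of undefined] by linarith
  ultimately show thesis using that[of B "\<bar>L\<bar>"] *(1) by auto
qed

lemma bounded_lipschitz_const: "bounded_lipschitz (\<lambda>x. c)"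
  by (rule bounded_lipschitzI[of _ "\<bar>c\<bar>" 0]) auto

lemma bounded_lipschitz_add:
  assumes "bounded_lipschitz f" "bounded_lipschitz g"
  shows "bounded_lipschitz (\<lambda>x. f x + g x)"
proof -
  obtain B L where f: "0 \<le> B" "0 \<le> L" "\<And>x. \<bar>f x\<bar> \<le> B" "\<And>x y. \<bar>f x - f y\<bar> \<le> L * dist x y"
    using bounded_lipschitzE[OF assms(1)] by blast
  obtain C M where g: "0 \<le> C" "0 \<le> M" "\<And>x. \<bar>g x\<bar> \<le> C" "\<And>x y. \<bar>g x - g y\<bar> \<le> M * dist x y"
    using bounded_lipschitzE[OF assms(2)] by blast
  show ?thesis
  proof (rule bounded_lipschitzI)
    show "\<bar>f x + g x\<bar> \<le> B + C" for x using f(3)[of x] g(3)[of x] by linarith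
    show "\<bar>f x + g x - (f y + g y)\<bar> \<le> (L + M) * dist x y" for x y
      using f(4)[of x y] g(4)[of x y] by (simp add: algebra_simps)
  qed
qed

lemma bounded_lipschitz_mult:
  assumes "bounded_lipschitz f" "bounded_lipschitz g"
  shows "bounded_lipschitz (\<lambda>x. f x * g x)"
proof -
  obtain B L where f: "0 \<le> B" "0 \<le> L" "\<And>x. \<bar>f x\<bar> \<le> B" "\<And>x y. \<bar>f x - f y\<bar> \<le> L * dist x y"
    using bounded_lipschitzE[OF assms(1)] by blast
  obtain C M where g: "0 \<le> C" "0 \<le> M" "\<And>x. \<bar>g x\<bar> \<le> C" "\<And>x y. \<bar>g x - g y\<bar> \<le> M * dist x y"
    using bounded_lipschitzE[OF assms(2)] by blast
  show ?thesis
  proof (rule bounded_lipschitzI)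
    show "\<bar>f x * g x\<bar> \<le> B * C" for x
      unfolding abs_mult by (rule mult_mono) (use f g in auto)
    show "\<bar>f x * g x - f y * g y\<bar> \<le> (B * M + L * C) * dist x y" for x y
    proof -
      have "\<bar>f x * g x - f y * g y\<bar> = \<bar>f x * (g x - g y) + (f x - f y) * g y\<bar>" by (simp add: algebra_simps)
      also have "\<dots> \<le> \<bar>f x\<bar> * \<bar>g x - g y\<bar> + \<bar>f x - f y\<bar> * \<bar>g y\<bar>"
        unfolding abs_mult[symmetric] by (rule abs_triangle_ineq)
      also have "\<dots> \<le> B * (M * dist x y) + (L * dist x y) * C"
        by (intro add_mono mult_mono) (use f g in auto)
      finally show ?thesis by (simp add: algebra_simps)
    qed
  qed
qed

lemma bounded_lipschitz_power: "bounded_lipschitz f \<Longrightarrow> bounded_lipschitz (\<lambda>x. f x ^ n)"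
  by (induction n) (auto intro: bounded_lipschitz_const bounded_lipschitz_mult)

lemma bounded_lipschitz_diff:
  assumes "bounded_lipschitz f" "bounded_lipschitz g"
  shows "bounded_lipschitz (\<lambda>x. f x - g x)"
  using bounded_lipschitz_add[OF assms(1) bounded_lipschitz_mult[OF bounded_lipschitz_const[of "-1"] assms(2)]]
  by simp

lemma bounded_lipschitz_divide:
  assumes "bounded_lipschitz f" "bounded_lipschitz g" and c: "0 < c" "\<And>x. c \<le> g x"
  shows "bounded_lipschitz (\<lambda>x. f x / g x)"
proof -
  obtain C M where g: "0 \<le> C" "0 \<le> M" "\<And>x. \<bar>g x\<bar> \<le> C" "\<And>x y. \<bar>g x - g y\<bar> \<le> M * dist x y"
    using bounded_lipschitzE[OF assms(2)] by blast
  have pos: "0 < g x" for x using c order_less_le_trans by blast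
  have "bounded_lipschitz (\<lambda>x. 1 / g x)"
  proof (rule bounded_lipschitzI)
    show "\<bar>1 / g x\<bar> \<le> 1 / c" for x using c pos[of x] by (simp add: frac_le)
    show "\<bar>1 / g x - 1 / g y\<bar> \<le> M / (c * c) * dist x y" for x y
    proof -
      have "\<bar>1 / g x - 1 / g y\<bar> = \<bar>g x - g y\<bar> / (g x * g y)"
        using pos[of x] pos[of y] by (simp add: divide_simps abs_mult abs_minus_commute)
      also have "\<dots> \<le> (M * dist x y) / (c * c)"
        by (intro frac_le mult_mono) (use c pos[of x] pos[of y] g in \<open>auto intro: less_imp_le\<close>)
      finally show ?thesis by simp
    qed
  qed
  from bounded_lipschitz_mult[OF assms(1) this] show ?thesis by simp
qed

definition unit_clamp :: "real \<Rightarrow> real" where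
  "unit_clamp x = max 0 (min 1 x)"

lemma unit_clamp_id: "0 < x \<Longrightarrow> x < 1 \<Longrightarrow> unit_clamp x = x"
  by (simp add: unit_clamp_def)

lemma bounded_lipschitz_clamp:
  fixes f :: "'a::metric_space \<Rightarrow> real"
  assumes "\<And>x y. \<bar>f x - f y\<bar> \<le> dist x y"
  shows "bounded_lipschitz (\<lambda>x. unit_clamp (f x))"
proof (rule bounded_lipschitzI)
  show "\<bar>unit_clamp (f x)\<bar> \<le> 1" for x by (simp add: unit_clamp_def)
  show "\<bar>unit_clamp (f x) - unit_clamp (f y)\<bar> \<le> 1 * dist x y" for x y
    using assms[of x y] by (auto simp: unit_clamp_def max_def min_def)
qed

definition planar_field :: "real \<times> real \<Rightarrow> real \<times> real" where
  "planar_field z = (let H = unit_clamp (fst z); p = unit_clamp (snd z) in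
     (H\<^sup>2 * planar_N H p / planar_D p, 2 * H * p * planar_M H p / planar_D p))"

text \<open>The only denominators are values of \<open>planar_D\<close>, at least 4 everywhere, so
  clamping both arguments controls the whole field.\<close>

lemma planar_field_lipschitz: obtains L where "\<And>x y. dist (planar_field x) (planar_field y) \<le> L * dist x y"
proof -
  have 1: "bounded_lipschitz (\<lambda>z :: real \<times> real. unit_clamp (fst z))"
    by (rule bounded_lipschitz_clamp) (metis dist_fst_le dist_real_def)
  have 2: "bounded_lipschitz (\<lambda>z :: real \<times> real. unit_clamp (snd z))"
    by (rule bounded_lipschitz_clamp) (metis dist_snd_le dist_real_def)
  note I = bounded_lipschitz_add bounded_lipschitz_diff bounded_lipschitz_mult bounded_lipschitz_power
    bounded_lipschitz_const 1 2
  have D: "bounded_lipschitz (\<lambda>z :: real \<times> real. planar_D (unit_clamp (snd z)))"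
    unfolding planar_D_def by (intro I)
  have "bounded_lipschitz (\<lambda>z. fst (planar_field z))"
    unfolding planar_field_def Let_def fst_conv
    by (rule bounded_lipschitz_divide[OF _ D, of _ 4]) (auto simp: planar_N_def planar_D_ge intro!: I)
  moreover have "bounded_lipschitz (\<lambda>z. snd (planar_field z))"
    unfolding planar_field_def Let_def snd_conv
    by (rule bounded_lipschitz_divide[OF _ D, of _ 4]) (auto simp: planar_M_def planar_D_ge intro!: I)
  ultimately obtain L M where
    LM: "\<And>x y. \<bar>fst (planar_field x) - fst (planar_field y)\<bar> \<le> L * dist x y"
      "\<And>x y. \<bar>snd (planar_field x) - snd (planar_field y)\<bar> \<le> M * dist x y"
    using bounded_lipschitzE by metis
  have "dist (planar_field x) (planar_field y) \<le> (L + M) * dist x y" for x y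
  proof -
    have "dist (planar_field x) (planar_field y)
      \<le> dist (fst (planar_field x)) (fst (planar_field y)) + dist (snd (planar_field x)) (snd (planar_field y))"
      by (simp add: dist_prod_def sqrt_sum_squares_le_sum)
    thus ?thesis using LM(1)[of x y] LM(2)[of x y] by (simp add: dist_real_def algebra_simps)
  qed
  thus thesis by (rule that)
qed

lemma planar_field_eq:
  assumes "0 < H" "H < 1" "0 < p" "p < 1"
  shows "planar_field (H, p) = (H\<^sup>2 * planar_N H p / planar_D p, 2 * H * p * planar_M H p / planar_D p)"
  using assms by (simp add: planar_field_def unit_clamp_id)

section \<open>Curvature and field equations of FLRW pairs\<close>

lemma index_cases: fixes i :: 4 shows "i = 0 \<or> i = 1 \<or> i = 2 \<or> i = 3"
  using exhaust_4[of i] by auto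

text \<open>The library expansion runs over 1, 2, 3, 4; in this index type 4 is 0, the time
  coordinate.\<close>

lemma sum_index: "(\<Sum>i\<in>(UNIV::4 set). f i) = f 0 + f 1 + f 2 + f (3::4)"
proof -
  have "(4::4) = 0" by simp
  thus ?thesis unfolding sum_4 by (simp only: add_ac)
qed

lemma prod_index: "(\<Prod>i\<in>(UNIV::4 set). f i) = f 0 * f 1 * f 2 * f (3::4)"
proof -
  have "(4::4) = 0" by simp
  moreover have "(\<Prod>i\<in>(UNIV::4 set). f i) = f 4 * (f 1 * (f 2 * f 3))"
    unfolding UNIV_4 by (simp add: mult_ac)
  ultimately show ?thesis by (simp only: mult_ac)
qed

lemma partial_eqI:
  "((\<lambda>h. u (x + h *\<^sub>R axis i 1)) has_real_derivative D) (at 0) \<Longrightarrow> partial i u x = D"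
  unfolding partial_def by (rule DERIV_imp_deriv)

lemma open_spherical_chart: "open spherical_chart"
  unfolding spherical_chart_def
  by (intro open_Collect_conj open_Collect_less continuous_intros)

text \<open>Closed forms of the Christoffel symbols hold only on the chart, yet they have to be
  differentiated again. Openness turns agreement on the chart into agreement along a short
  coordinate line.\<close>

lemma partial_cong:
  assumes "open S" "x \<in> S" "\<And>y. y \<in> S \<Longrightarrow> u y = v y"
  shows "partial i u x = partial i v x"
proof -
  have "((\<lambda>h. x + h *\<^sub>R axis i 1) \<longlongrightarrow> x + 0 *\<^sub>R axis i 1) (nhds (0::real))"
    by (intro tendsto_intros filterlim_ident)
  hence "\<forall>\<^sub>F h in nhds (0::real). x + h *\<^sub>R axis i 1 \<in> S"
    using assms(1,2) by (intro topological_tendstoD[where l = x]) auto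
  hence "\<forall>\<^sub>F h in nhds (0::real). u (x + h *\<^sub>R axis i 1) = v (x + h *\<^sub>R axis i 1)"
    by (rule eventually_mono) (simp add: assms(3))
  thus ?thesis unfolding partial_def by (rule deriv_cong_ev) simp
qed

lemma matrix_inv_diagonal:
  fixes A :: "real ^ 'n ^ 'n"
  assumes off: "\<And>i j. i \<noteq> j \<Longrightarrow> A $ i $ j = 0" and nz: "\<And>i. A $ i $ i \<noteq> 0"
  shows "matrix_inv A $ i $ j = (if i = j then 1 / A $ i $ i else 0)"
proof -
  define B :: "real ^ 'n ^ 'n" where "B = (\<chi> i j. if i = j then 1 / A $ i $ i else 0)"
  have AB: "A ** B = mat 1"
    unfolding vec_eq_iff
  proof (intro allI)
    fix i j
    have "(A ** B) $ i $ j = (\<Sum>k\<in>UNIV. if k = j then A $ i $ j / A $ j $ j else 0)"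
      unfolding matrix_matrix_mult_def B_def by (simp add: if_distrib cong: if_cong)
    also have "\<dots> = A $ i $ j / A $ j $ j" by simp
    also have "\<dots> = (mat 1 :: real ^ 'n ^ 'n) $ i $ j" using off nz by (auto simp: mat_def)
    finally show "(A ** B) $ i $ j = (mat 1 :: real ^ 'n ^ 'n) $ i $ j" .
  qed
  hence BA: "B ** A = mat 1" using matrix_left_right_inverse by blast
  \<comment> \<open>\<open>matrix_inv\<close> is a choice among two-sided inverses, so a witness
    comes first and uniqueness then identifies it.\<close>
  have "A ** matrix_inv A = mat 1 \<and> matrix_inv A ** A = mat 1"
    unfolding matrix_inv_def by (rule someI[of _ B]) (simp add: AB BA)
  hence "matrix_inv A = B" by (metis BA matrix_mul_assoc matrix_mul_lid matrix_mul_rid)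
  thus ?thesis by (simp add: B_def)
qed

section \<open>Metric components and Christoffel symbols\<close>

definition flrw_christoffel :: "(real \<Rightarrow> real) \<Rightarrow> 4 \<Rightarrow> 4 \<Rightarrow> 4 \<Rightarrow> event \<Rightarrow> real" where
  "flrw_christoffel a k i j x =
    (if k = 0 then
       (if i \<noteq> j \<or> i = 0 then 0
        else if i = 1 then a (x $ 0) * deriv a (x $ 0)
        else if i = 2 then a (x $ 0) * deriv a (x $ 0) * (x $ 1)\<^sup>2
        else a (x $ 0) * deriv a (x $ 0) * (x $ 1)\<^sup>2 * (sin (x $ 2))\<^sup>2)
     else if i = 0 \<and> j = k \<or> j = 0 \<and> i = k then deriv a (x $ 0) / a (x $ 0)
     else if k = 1 then
       (if i \<noteq> j \<or> i \<in> {0, 1} then 0 else if i = 2 then - (x $ 1) else - (x $ 1) * (sin (x $ 2))\<^sup>2)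
     else if i = 1 \<and> j = k \<or> j = 1 \<and> i = k then 1 / x $ 1
     else if k = 2 then (if i = 3 \<and> j = 3 then - (sin (x $ 2) * cos (x $ 2)) else 0)
     else if i = 2 \<and> j = 3 \<or> j = 2 \<and> i = 3 then cos (x $ 2) / sin (x $ 2)
     else 0)"

definition flrw_diag :: "(real \<Rightarrow> real) \<Rightarrow> event \<Rightarrow> 4 \<Rightarrow> real" where
  "flrw_diag a x i = (if i = 0 then - 1
     else if i = 1 then (a (x $ 0))\<^sup>2
     else if i = 2 then (a (x $ 0))\<^sup>2 * (x $ 1)\<^sup>2
     else (a (x $ 0))\<^sup>2 * (x $ 1)\<^sup>2 * (sin (x $ 2))\<^sup>2)"

lemma flrw_metric_nth: "flrw_metric a x $ i $ j = (if i = j then flrw_diag a x i else 0)"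
  by (simp add: flrw_metric_def flrw_diag_def)

lemma chart_pos: "x \<in> spherical_chart \<Longrightarrow> 0 < x $ 1 \<and> 0 < sin (x $ 2)"
  by (simp add: spherical_chart_def sin_gt_zero)

lemma flrw_diag_nonzero: "(\<And>t. 0 < a t) \<Longrightarrow> x \<in> spherical_chart \<Longrightarrow> flrw_diag a x i \<noteq> 0"
  using chart_pos[of x] by (auto simp: flrw_diag_def less_imp_neq[symmetric])

lemma ginv_flrw:
  assumes "\<And>t. 0 < a t" "x \<in> spherical_chart"
  shows "ginv (flrw_metric a) i j x = (if i = j then 1 / flrw_diag a x i else 0)"
  using flrw_diag_nonzero[OF assms] by (subst matrix_inv_diagonal) (auto simp: flrw_metric_nth)

definition flrw_diag_partial :: "(real \<Rightarrow> real) \<Rightarrow> event \<Rightarrow> 4 \<Rightarrow> 4 \<Rightarrow> real" where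
  "flrw_diag_partial a x m i =
    (if i = 0 then 0
     else if m = 0 then 2 * deriv a (x $ 0) / a (x $ 0) * flrw_diag a x i
     else if m = 1 \<and> i \<noteq> 1 then 2 * (a (x $ 0))\<^sup>2 * (x $ 1) * (if i = 2 then 1 else (sin (x $ 2))\<^sup>2)
     else if m = 2 \<and> i = 3 then 2 * (a (x $ 0))\<^sup>2 * (x $ 1)\<^sup>2 * sin (x $ 2) * cos (x $ 2)
     else 0)"

lemma partial_flrw_metric:
  assumes pos: "\<And>t. 0 < a t" and diff: "\<And>t. (a has_real_derivative deriv a t) (at t)"
  shows "partial m (\<lambda>y. flrw_metric a y $ i $ j) x = (if i = j then flrw_diag_partial a x m i else 0)"
proof -
  have *: "((\<lambda>h. a (x $ 0 + h)) has_real_derivative deriv a (x $ 0)) (at 0)"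
    using DERIV_shift[of a "deriv a (x $ 0)" 0 "x $ 0"] diff by (simp add: add.commute)
  have off: "partial m (\<lambda>y. flrw_metric a y $ i $ j) x = 0" if "i \<noteq> j"
    using that by (intro partial_eqI) (simp add: flrw_metric_nth)
  \<comment> \<open>One product rule for all entries and directions: the slopes \<alpha>, \<beta>,
    \<gamma> are 1 for the direction of differentiation and 0 otherwise, and y = 1, z = pi / 2
    remove a factor that an entry does not have.\<close>
  have gen: "((\<lambda>h. (a (x $ 0 + \<alpha> * h))\<^sup>2 * (y + \<beta> * h)\<^sup>2 * (sin (z + \<gamma> * h))\<^sup>2) has_real_derivative
     2 * \<alpha> * a (x $ 0) * deriv a (x $ 0) * y\<^sup>2 * (sin z)\<^sup>2 + 2 * \<beta> * (a (x $ 0))\<^sup>2 * y * (sin z)\<^sup>2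
     + 2 * \<gamma> * (a (x $ 0))\<^sup>2 * y\<^sup>2 * sin z * cos z) (at 0)" for \<alpha> \<beta> \<gamma> y z :: real
  proof -
    have 1: "((\<lambda>h. a (x $ 0 + \<alpha> * h)) has_real_derivative deriv a (x $ 0) * \<alpha>) (at 0)"
      by (rule DERIV_chain2[where f=a]) (use diff in \<open>auto intro!: derivative_eq_intros\<close>)
    have 2: "((\<lambda>h. y + \<beta> * h) has_real_derivative \<beta>) (at 0)"
      by (auto intro!: derivative_eq_intros)
    have 3: "((\<lambda>h. sin (z + \<gamma> * h)) has_real_derivative cos z * \<gamma>) (at 0)"
      by (auto intro!: derivative_eq_intros)
    show ?thesis
      by (rule DERIV_cong[OF DERIV_mult[OF DERIV_mult[OF DERIV_power[OF 1, of 2] DERIV_power[OF 2, of 2]]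
             DERIV_power[OF 3, of 2]]]) (simp add: power2_eq_square algebra_simps)
  qed
  have "((\<lambda>h. flrw_diag a (x + h *\<^sub>R axis m 1) i) has_real_derivative flrw_diag_partial a x m i) (at 0)"
    using index_cases[of i]
  proof (elim disjE)
    assume "i = 0" thus ?thesis by (simp add: flrw_diag_def flrw_diag_partial_def)
  next
    assume i: "i = 1"
    show ?thesis
      using gen[of "if m = 0 then 1 else 0" 1 0 "pi / 2" 0] pos[of "x $ 0"]
      by (cases "m = 0") (simp_all add: i flrw_diag_def flrw_diag_partial_def axis_def power2_eq_square mult_ac)
  next
    assume i: "i = 2"
    show ?thesis
      using gen[of "if m = 0 then 1 else 0" "x $ 1" "if m = 1 then 1 else 0" "pi / 2" 0] pos[of "x $ 0"]
         index_cases[of m]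
      by (elim disjE) (simp_all add: i flrw_diag_def flrw_diag_partial_def axis_def power2_eq_square mult_ac)
  next
    assume i: "i = 3"
    show ?thesis
      using gen[of "if m = 0 then 1 else 0" "x $ 1" "if m = 1 then 1 else 0" "x $ 2" "if m = 2 then 1 else 0"]
        pos[of "x $ 0"] index_cases[of m]
      by (elim disjE) (simp_all add: i flrw_diag_def flrw_diag_partial_def axis_def power2_eq_square mult_ac)
  qed
  hence "partial m (\<lambda>y. flrw_metric a y $ i $ i) x = flrw_diag_partial a x m i"
    unfolding flrw_metric_nth by (intro partial_eqI) simp
  thus ?thesis using off by auto
qed

lemma christoffel_flrw:
  assumes pos: "\<And>t. 0 < a t" and diff: "\<And>t. (a has_real_derivative deriv a t) (at t)"
    and x: "x \<in> spherical_chart"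
  shows "christoffel (flrw_metric a) k i j x = flrw_christoffel a k i j x"
proof -
  let ?P = "flrw_diag_partial a x"
  \<comment> \<open>For a diagonal metric only the term l = k of the contraction survives.\<close>
  have red: "christoffel (flrw_metric a) k i j x =
    1 / 2 * ((if j = k then ?P i k else 0) + (if i = k then ?P j k else 0)
              - (if i = j then ?P k i else 0)) / flrw_diag a x k"
    unfolding christoffel_def ginv_flrw[OF pos x] partial_flrw_metric[OF pos diff]
    by (simp add: if_distrib[of "\<lambda>z. z * _"] cong: if_cong)
  note nz = less_imp_neq[OF pos, symmetric] chart_pos[OF x, THEN conjunct1, THEN less_imp_neq, symmetric]
     chart_pos[OF x, THEN conjunct2, THEN less_imp_neq, symmetric]
  show ?thesis
  using index_cases[of k] unfolding red
  proof (elim disjE)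
    assume k: "k = 0"
    show "1 / 2 * ((if j = k then ?P i k else 0) + (if i = k then ?P j k else 0)
              - (if i = j then ?P k i else 0)) / flrw_diag a x k = flrw_christoffel a k i j x"
      using index_cases[of i] index_cases[of j] by (elim disjE; simp add: k flrw_diag_partial_def flrw_diag_def flrw_christoffel_def nz;
       simp add: nz power2_eq_square)
  next
    assume k: "k = 1"
    show "1 / 2 * ((if j = k then ?P i k else 0) + (if i = k then ?P j k else 0)
              - (if i = j then ?P k i else 0)) / flrw_diag a x k = flrw_christoffel a k i j x"
      using index_cases[of i] index_cases[of j] by (elim disjE; simp add: k flrw_diag_partial_def flrw_diag_def flrw_christoffel_def nz;
       simp add: nz power2_eq_square)
  next
    assume k: "k = 2"
    show "1 / 2 * ((if j = k then ?P i k else 0) + (if i = k then ?P j k else 0)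
              - (if i = j then ?P k i else 0)) / flrw_diag a x k = flrw_christoffel a k i j x"
      using index_cases[of i] index_cases[of j] by (elim disjE; simp add: k flrw_diag_partial_def flrw_diag_def flrw_christoffel_def nz;
       simp add: nz power2_eq_square)
  next
    assume k: "k = 3"
    show "1 / 2 * ((if j = k then ?P i k else 0) + (if i = k then ?P j k else 0)
              - (if i = j then ?P k i else 0)) / flrw_diag a x k = flrw_christoffel a k i j x"
      using index_cases[of i] index_cases[of j] by (elim disjE; simp add: k flrw_diag_partial_def flrw_diag_def flrw_christoffel_def nz;
       simp add: nz power2_eq_square)
  qed
qed

text \<open>Every nonzero Christoffel symbol, and also the volume density, is a product of functions
  of t, r and \<theta> alone, so this rule covers all derivatives needed below.\<close>

lemma partial_separable:
  assumes "(f has_real_derivative f') (at (x $ 0))" "(g has_real_derivative g') (at (x $ 1))"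
    "(k has_real_derivative k') (at (x $ 2))"
  shows "partial m (\<lambda>y. f (y $ 0) * g (y $ 1) * k (y $ 2)) x =
    (if m = 0 then f' * g (x $ 1) * k (x $ 2) else if m = 1 then f (x $ 0) * g' * k (x $ 2)
     else if m = 2 then f (x $ 0) * g (x $ 1) * k' else 0)"
proof -
  have sh: "((\<lambda>h. u (z + \<alpha> * h)) has_real_derivative u' * \<alpha>) (at 0)"
    if "(u has_real_derivative u') (at z)" for u u' z \<alpha>
    by (rule DERIV_chain2[where f=u]) (use that in \<open>auto intro!: derivative_eq_intros\<close>)
  have gen: "((\<lambda>h. f (x $ 0 + \<alpha> * h) * g (x $ 1 + \<beta> * h) * k (x $ 2 + \<gamma> * h)) has_real_derivative
     \<alpha> * (f' * g (x $ 1) * k (x $ 2)) + \<beta> * (f (x $ 0) * g' * k (x $ 2)) + \<gamma> * (f (x $ 0) * g (x $ 1) * k')) (at 0)"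
    for \<alpha> \<beta> \<gamma>
    by (rule DERIV_cong[OF DERIV_mult[OF DERIV_mult[OF sh[OF assms(1)] sh[OF assms(2)]] sh[OF assms(3)]]])
      (simp add: algebra_simps)
  show ?thesis
    by (rule partial_eqI)
      (use gen[of "if m = 0 then 1 else 0" "if m = 1 then 1 else 0" "if m = 2 then 1 else 0"] index_cases[of m] in
        \<open>elim disjE; simp add: axis_def\<close>)
qed

lemma partial_const: "partial m (\<lambda>y. c) x = 0"
  by (rule partial_eqI) simp

lemma partial_profile:
  assumes "(f has_real_derivative f') (at (x $ 0))"
  shows "partial m (\<lambda>y. f (y $ 0)) x = (if m = 0 then f' else 0)"
  using partial_separable[where f=f and f'=f' and x=x and g="\<lambda>_. 1" and g'=0 and k="\<lambda>_. 1" and k'=0 and m=m] assms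
  by simp

lemma partial_scalar:
  assumes "\<And>t. (u has_real_derivative u1 t) (at t)"
  shows "partial m (\<lambda>y. u (y $ 0)) = (\<lambda>y. if m = 0 then u1 (y $ 0) else 0)"
  by (rule ext) (rule partial_profile[OF assms])

text \<open>The sectional curvature of the coordinate plane with indices \<open>r\<close> and \<open>s\<close>.\<close>

definition flrw_curv :: "(real \<Rightarrow> real) \<Rightarrow> event \<Rightarrow> 4 \<Rightarrow> 4 \<Rightarrow> real" where
  "flrw_curv a x r s = (if r = 0 \<or> s = 0 then deriv (deriv a) (x $ 0) / a (x $ 0)
      else (deriv a (x $ 0) / a (x $ 0))\<^sup>2)"

section \<open>The Riemann tensor\<close>

context
  fixes a :: "real \<Rightarrow> real" and x :: event
  assumes pos: "\<And>t. 0 < a t" and diff: "\<And>t. (a has_real_derivative deriv a t) (at t)"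
    and diff2: "\<And>t. (deriv a has_real_derivative deriv (deriv a) t) (at t)"
    and x: "x \<in> spherical_chart"
begin

lemma nonzero: "a t \<noteq> 0" "x $ 1 \<noteq> 0" "sin (x $ 2) \<noteq> 0"
  using pos[of t] chart_pos[OF x] by auto

lemma partial_christoffel_entries:
  shows "partial m (\<lambda>y. a (y $ 0) * deriv a (y $ 0)) x =
      (if m = 0 then (deriv a (x $ 0))\<^sup>2 + a (x $ 0) * deriv (deriv a) (x $ 0) else 0)"
    and "partial m (\<lambda>y. a (y $ 0) * deriv a (y $ 0) * (y $ 1)\<^sup>2) x =
      (if m = 0 then ((deriv a (x $ 0))\<^sup>2 + a (x $ 0) * deriv (deriv a) (x $ 0)) * (x $ 1)\<^sup>2
       else if m = 1 then a (x $ 0) * deriv a (x $ 0) * 2 * x $ 1 else 0)"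
    and "partial m (\<lambda>y. a (y $ 0) * deriv a (y $ 0) * (y $ 1)\<^sup>2 * (sin (y $ 2))\<^sup>2) x =
      (if m = 0 then ((deriv a (x $ 0))\<^sup>2 + a (x $ 0) * deriv (deriv a) (x $ 0)) * (x $ 1)\<^sup>2 * (sin (x $ 2))\<^sup>2
       else if m = 1 then a (x $ 0) * deriv a (x $ 0) * 2 * x $ 1 * (sin (x $ 2))\<^sup>2
       else if m = 2 then a (x $ 0) * deriv a (x $ 0) * (x $ 1)\<^sup>2 * 2 * sin (x $ 2) * cos (x $ 2) else 0)"
    and "partial m (\<lambda>y. deriv a (y $ 0) / a (y $ 0)) x =
      (if m = 0 then deriv (deriv a) (x $ 0) / a (x $ 0) - (deriv a (x $ 0) / a (x $ 0))\<^sup>2 else 0)"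
    and "partial m (\<lambda>y. - (y $ 1)) x = (if m = 1 then - 1 else 0)"
    and "partial m (\<lambda>y. - (y $ 1 * (sin (y $ 2))\<^sup>2)) x =
      (if m = 1 then - (sin (x $ 2))\<^sup>2 else if m = 2 then - (x $ 1) * 2 * sin (x $ 2) * cos (x $ 2) else 0)"
    and "partial m (\<lambda>y. 1 / y $ 1) x = (if m = 1 then - 1 / (x $ 1)\<^sup>2 else 0)"
    and "partial m (\<lambda>y. - (sin (y $ 2) * cos (y $ 2))) x =
      (if m = 2 then (sin (x $ 2))\<^sup>2 - (cos (x $ 2))\<^sup>2 else 0)"
    and "partial m (\<lambda>y. cos (y $ 2) / sin (y $ 2)) x = (if m = 2 then - 1 / (sin (x $ 2))\<^sup>2 else 0)"
proof -
  have sq: "((\<lambda>r. r\<^sup>2) has_real_derivative 2 * r) (at r)" for r :: real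
    by (auto intro!: derivative_eq_intros)
  have sn: "((\<lambda>r. (sin r)\<^sup>2) has_real_derivative 2 * sin r * cos r) (at r)" for r :: real
    by (auto intro!: derivative_eq_intros)
  have ng: "((\<lambda>r. - r) has_real_derivative - 1) (at r)" for r :: real
    by (auto intro!: derivative_eq_intros)
  have one: "((\<lambda>r. 1) has_real_derivative 0) (at r)" for r :: real
    by simp
  have aa: "((\<lambda>t. a t * deriv a t) has_real_derivative (deriv a t)\<^sup>2 + a t * deriv (deriv a) t) (at t)" for t
    by (rule DERIV_cong[OF DERIV_mult[OF diff diff2]]) (simp add: power2_eq_square mult_ac)
  have h: "((\<lambda>t. deriv a t / a t) has_real_derivative deriv (deriv a) t / a t - (deriv a t / a t)\<^sup>2) (at t)" for t
    by (rule DERIV_cong[OF DERIV_divide[OF diff2 diff]])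
      (use pos[of t] in \<open>auto simp: field_simps power2_eq_square\<close>)
  have inv: "((\<lambda>r. 1 / r) has_real_derivative - 1 / r\<^sup>2) (at r)" if "r \<noteq> 0" for r :: real
    using that by (auto intro!: derivative_eq_intros simp: power2_eq_square)
  have sc: "((\<lambda>r. - (sin r * cos r)) has_real_derivative (sin r)\<^sup>2 - (cos r)\<^sup>2) (at r)" for r :: real
    by (auto intro!: derivative_eq_intros simp: power2_eq_square)
  have ct: "((\<lambda>r. cos r / sin r) has_real_derivative - 1 / (sin r)\<^sup>2) (at r)" if "sin r \<noteq> 0" for r :: real
    by (rule DERIV_cong[OF DERIV_divide[OF DERIV_cos DERIV_sin that]])
     (use that sin_cos_squared_add[of r] in \<open>simp add: power2_eq_square divide_simps; algebra\<close>)
  note R = partial_separable[of _ _ x _ _ _ _ m]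
  show "partial m (\<lambda>y. a (y $ 0) * deriv a (y $ 0)) x =
      (if m = 0 then (deriv a (x $ 0))\<^sup>2 + a (x $ 0) * deriv (deriv a) (x $ 0) else 0)"
    using R[OF aa one one] by simp
  show "partial m (\<lambda>y. a (y $ 0) * deriv a (y $ 0) * (y $ 1)\<^sup>2) x =
      (if m = 0 then ((deriv a (x $ 0))\<^sup>2 + a (x $ 0) * deriv (deriv a) (x $ 0)) * (x $ 1)\<^sup>2
       else if m = 1 then a (x $ 0) * deriv a (x $ 0) * 2 * x $ 1 else 0)"
    using R[OF aa sq one] by simp
  show "partial m (\<lambda>y. a (y $ 0) * deriv a (y $ 0) * (y $ 1)\<^sup>2 * (sin (y $ 2))\<^sup>2) x =
      (if m = 0 then ((deriv a (x $ 0))\<^sup>2 + a (x $ 0) * deriv (deriv a) (x $ 0)) * (x $ 1)\<^sup>2 * (sin (x $ 2))\<^sup>2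
       else if m = 1 then a (x $ 0) * deriv a (x $ 0) * 2 * x $ 1 * (sin (x $ 2))\<^sup>2
       else if m = 2 then a (x $ 0) * deriv a (x $ 0) * (x $ 1)\<^sup>2 * 2 * sin (x $ 2) * cos (x $ 2) else 0)"
    using R[OF aa sq sn] by simp
  show "partial m (\<lambda>y. deriv a (y $ 0) / a (y $ 0)) x =
      (if m = 0 then deriv (deriv a) (x $ 0) / a (x $ 0) - (deriv a (x $ 0) / a (x $ 0))\<^sup>2 else 0)"
    using R[OF h one one] by simp
  show "partial m (\<lambda>y. - (y $ 1)) x = (if m = 1 then - 1 else 0)"
    using R[OF one ng one] by simp
  show "partial m (\<lambda>y. - (y $ 1 * (sin (y $ 2))\<^sup>2)) x =
      (if m = 1 then - (sin (x $ 2))\<^sup>2 else if m = 2 then - (x $ 1) * 2 * sin (x $ 2) * cos (x $ 2) else 0)"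
    using R[OF one ng sn] by simp
  show "partial m (\<lambda>y. 1 / y $ 1) x = (if m = 1 then - 1 / (x $ 1)\<^sup>2 else 0)"
    using R[OF one inv[OF nonzero(2)] one] by simp
  show "partial m (\<lambda>y. - (sin (y $ 2) * cos (y $ 2))) x =
      (if m = 2 then (sin (x $ 2))\<^sup>2 - (cos (x $ 2))\<^sup>2 else 0)"
    using R[OF one one sc] by simp
  show "partial m (\<lambda>y. cos (y $ 2) / sin (y $ 2)) x = (if m = 2 then - 1 / (sin (x $ 2))\<^sup>2 else 0)"
    using R[OF one one ct[OF nonzero(3)]] by simp
qed

lemma partial_christoffel:
  "partial m (christoffel (flrw_metric a) k i j) x = partial m (flrw_christoffel a k i j) x"
  by (rule partial_cong[OF open_spherical_chart x]) (rule christoffel_flrw[OF pos diff])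

lemma riemann_antisym: "riemann g r s m n y = - riemann g r s n m y"
  by (simp add: riemann_def)

text \<open>Each coordinate plane carries its sectional curvature and no other components occur.
  Antisymmetry in the last two indices leaves six pairs; the remaining cases are computed, with
  \<open>cc\<close> eliminating the squared cosine.\<close>

lemma riemann_flrw_aux:
  assumes "(m, n) \<in> {(0,1), (0,2), (0,3), (1,2), (1,3), (2,3)}"
  shows "riemann (flrw_metric a) r s m n x = flrw_curv a x r s *
    ((if r = m \<and> s = n then flrw_diag a x s else 0) - (if r = n \<and> s = m then flrw_diag a x s else 0))"
proof -
  have cc: "cos (x $ 2) * cos (x $ 2) = 1 - sin (x $ 2) * sin (x $ 2)"
    using sin_cos_squared_add[of "x $ 2"] by (simp add: power2_eq_square)
  show ?thesis
  using assms index_cases[of r] index_cases[of s]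
  unfolding riemann_def partial_christoffel christoffel_flrw[OF pos diff x] sum_index
    apply (simp only: insert_iff empty_iff prod.inject simp_thms)
    by (elim disjE conjE; hypsubst; simp add: flrw_christoffel_def[abs_def] partial_christoffel_entries partial_const
        flrw_curv_def flrw_diag_def nonzero; (simp add: field_simps power2_eq_square cc nonzero)?)
qed

lemma riemann_flrw:
  "riemann (flrw_metric a) r s m n x = flrw_curv a x r s *
    ((if r = m \<and> s = n then flrw_diag a x s else 0) - (if r = n \<and> s = m then flrw_diag a x s else 0))"
proof -
  have "(m, n) \<in> {(0,1), (0,2), (0,3), (1,2), (1,3), (2,3)} \<or> (n, m) \<in> {(0,1), (0,2), (0,3), (1,2), (1,3), (2,3)} \<or> m = n"
    using index_cases[of m] index_cases[of n] by (elim disjE) simp_all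
  then show ?thesis
  proof (elim disjE)
    assume "m = n" thus ?thesis using riemann_antisym[of "flrw_metric a" r s m m x] by simp
  next
    assume "(m, n) \<in> {(0,1), (0,2), (0,3), (1,2), (1,3), (2,3)}" thus ?thesis by (rule riemann_flrw_aux)
  next
    assume "(n, m) \<in> {(0,1), (0,2), (0,3), (1,2), (1,3), (2,3)}"
    from riemann_flrw_aux[OF this, of r s] show ?thesis
      unfolding riemann_antisym[of "flrw_metric a" r s m n x] by (simp only: minus_mult_right minus_diff_eq)
  qed
qed

end

section \<open>Ricci, Gauss-Bonnet and coupling tensors\<close>

definition flrw_ricci :: "(real \<Rightarrow> real) \<Rightarrow> event \<Rightarrow> 4 \<Rightarrow> real" where
  "flrw_ricci a x m = (if m = 0 then 3 * (deriv (deriv a) (x $ 0) / a (x $ 0))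
     else deriv (deriv a) (x $ 0) / a (x $ 0) + 2 * (deriv a (x $ 0) / a (x $ 0))\<^sup>2)"

text \<open>Here and in \<open>flrw_ricci\<close> the values are mixed components: with
  \<open>flrw_diag\<close> factored out, raising an index is cancellation and traces are plain
  sums.\<close>

definition flrw_hessian :: "(real \<Rightarrow> real) \<Rightarrow> real \<Rightarrow> real \<Rightarrow> event \<Rightarrow> 4 \<Rightarrow> real" where
  "flrw_hessian a u1 u2 x m = (if m = 0 then - u2 else - (deriv a (x $ 0) / a (x $ 0)) * u1)"

context
  fixes a :: "real \<Rightarrow> real" and x :: event
  assumes pos: "\<And>t. 0 < a t" and diff: "\<And>t. (a has_real_derivative deriv a t) (at t)"
    and diff2: "\<And>t. (deriv a has_real_derivative deriv (deriv a) t) (at t)"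
    and x: "x \<in> spherical_chart"
begin

lemmas riemann_components = riemann_flrw[OF pos diff diff2 x]
lemmas ginv_components = ginv_flrw[of a x, OF pos x]
lemmas diag_nonzero = flrw_diag_nonzero[of a x, OF pos x]

lemma ricci_flrw: "ricci (flrw_metric a) m n x = (if m = n then flrw_diag a x m * flrw_ricci a x m else 0)"
  using index_cases[of m] index_cases[of n] unfolding ricci_def riemann_components sum_index
  by (elim disjE; simp add: flrw_curv_def flrw_ricci_def algebra_simps)

lemma ricci_up_flrw: "ricci_up (flrw_metric a) m n x = (if m = n then flrw_ricci a x m / flrw_diag a x m else 0)"
  unfolding ricci_up_def ginv_components ricci_flrw
  by (simp add: if_distrib[of "\<lambda>z. z * _"] if_distrib[of "\<lambda>z. _ * z"] diag_nonzero cong: if_cong)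

lemma scalar_curvature_flrw:
  "scalar_curvature (flrw_metric a) x
     = 6 * (deriv (deriv a) (x $ 0) / a (x $ 0) + (deriv a (x $ 0) / a (x $ 0))\<^sup>2)"
  unfolding scalar_curvature_def ginv_components ricci_flrw sum_index
  using diag_nonzero by (simp add: flrw_ricci_def)

lemma einstein_flrw: "einstein (flrw_metric a) m n x = (if m = n then flrw_diag a x m *
    (flrw_ricci a x m - 3 * (deriv (deriv a) (x $ 0) / a (x $ 0) + (deriv a (x $ 0) / a (x $ 0))\<^sup>2)) else 0)"
  unfolding einstein_def ricci_flrw scalar_curvature_flrw flrw_metric_nth by (simp add: algebra_simps)

lemma riemann_low_flrw:
  "riemann_low (flrw_metric a) r s m n x = flrw_diag a x r * riemann (flrw_metric a) r s m n x"
  unfolding riemann_low_def flrw_metric_nth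
  by (simp add: if_distrib[of "\<lambda>z. z * _"] cong: if_cong)

lemma sum_ginv: "(\<Sum>i\<in>UNIV. ginv (flrw_metric a) j i x * f i) = f j / flrw_diag a x j"
  unfolding ginv_components by (simp add: if_distrib[of "\<lambda>z. z * _"] cong: if_cong)

lemma riemann_up_flrw:
  "riemann_up (flrw_metric a) r s m n x = flrw_diag a x r * riemann (flrw_metric a) r s m n x
     / (flrw_diag a x r * flrw_diag a x s * flrw_diag a x m * flrw_diag a x n)"
  unfolding riemann_up_def riemann_low_flrw mult.assoc sum_distrib_left[symmetric] sum_ginv
  using diag_nonzero by (simp add: divide_simps)

lemma gauss_bonnet_flrw:
  "gauss_bonnet (flrw_metric a) x
     = 24 * (deriv a (x $ 0) / a (x $ 0))\<^sup>2 * (deriv (deriv a) (x $ 0) / a (x $ 0))"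
proof -
  \<comment> \<open>For r and s distinct only the pairs (r, s) and (s, r) contribute, each with the
    squared sectional curvature.\<close>
  have R: "(\<Sum>m\<in>UNIV. \<Sum>n\<in>UNIV. riemann_low (flrw_metric a) r s m n x * riemann_up (flrw_metric a) r s m n x)
     = (if r = s then 0 else 2 * (flrw_curv a x r s)\<^sup>2)" for r s
    using index_cases[of r] index_cases[of s] unfolding riemann_up_flrw riemann_low_flrw riemann_components sum_index
    by (elim disjE; simp add: diag_nonzero power2_eq_square)
  show ?thesis
    unfolding gauss_bonnet_def scalar_curvature_flrw ricci_up_flrw ricci_flrw R
    unfolding sum_index
    by (simp add: flrw_curv_def flrw_ricci_def diag_nonzero) (simp add: power2_eq_square power4_eq_xxxx algebra_simps)
qed

context
  fixes u u1 u2 :: "real \<Rightarrow> real"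
  assumes u: "\<And>t. (u has_real_derivative u1 t) (at t)" and u1: "\<And>t. (u1 has_real_derivative u2 t) (at t)"
begin

lemma partial_partial_scalar:
  "partial m (partial n (\<lambda>y. u (y $ 0))) x = (if m = 0 \<and> n = 0 then u2 (x $ 0) else 0)"
  unfolding partial_scalar[OF u] by (cases "n = 0") (simp_all add: partial_profile[OF u1] partial_const)

lemma hessian_flrw: "hessian (flrw_metric a) (\<lambda>y. u (y $ 0)) m n x =
   (if m = n then flrw_diag a x m * flrw_hessian a (u1 (x $ 0)) (u2 (x $ 0)) x m else 0)"
proof -
  have "(\<Sum>l\<in>UNIV. christoffel (flrw_metric a) l m n x * partial l (\<lambda>y. u (y $ 0)) x)
    = flrw_christoffel a 0 m n x * u1 (x $ 0)"
    unfolding partial_scalar[OF u] christoffel_flrw[OF pos diff x] sum_index by simp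
  thus ?thesis
    using index_cases[of m] index_cases[of n] pos[of "x $ 0"] unfolding hessian_def partial_partial_scalar
    by (elim disjE; simp add: flrw_christoffel_def flrw_hessian_def flrw_diag_def power2_eq_square)
qed

lemma hessian_mixed_flrw: "hessian_mixed (flrw_metric a) (\<lambda>y. u (y $ 0)) m n x =
   (if m = n then flrw_hessian a (u1 (x $ 0)) (u2 (x $ 0)) x m else 0)"
  unfolding hessian_mixed_def sum_ginv hessian_flrw using diag_nonzero by simp

text \<open>The time-time component contains neither \<kappa> nor \<open>u2\<close>; as they cancel
  in the Einstein tensor too, that field equation is a constraint.\<close>

lemma gb_tensor_flrw:
  defines "H \<equiv> deriv a (x $ 0) / a (x $ 0)" and "\<kappa> \<equiv> deriv (deriv a) (x $ 0) / a (x $ 0)"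
  shows "gb_tensor (flrw_metric a) (\<lambda>y. u (y $ 0)) m n x = (if m \<noteq> n then 0 else flrw_diag a x m *
     (if m = 0 then 12 * H ^ 3 * u1 (x $ 0) else 4 * H\<^sup>2 * u2 (x $ 0) + 8 * \<kappa> * H * u1 (x $ 0)))"
proof -
  have 1: "(\<Sum>a'\<in>UNIV. ricci (flrw_metric a) a' m x * hessian_mixed (flrw_metric a) (\<lambda>y. u (y $ 0)) a' n x
        + ricci (flrw_metric a) a' n x * hessian_mixed (flrw_metric a) (\<lambda>y. u (y $ 0)) a' m x)
     = (if m = n then 2 * flrw_diag a x m * flrw_ricci a x m * flrw_hessian a (u1 (x $ 0)) (u2 (x $ 0)) x m else 0)"
    using index_cases[of m] index_cases[of n] unfolding ricci_flrw hessian_mixed_flrw sum_index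
    by (elim disjE) simp_all
  have 2: "(\<Sum>b\<in>UNIV. \<Sum>c\<in>UNIV. ricci_up (flrw_metric a) b c x * flrw_metric a x $ m $ n *
        hessian (flrw_metric a) (\<lambda>y. u (y $ 0)) b c x)
     = (if m = n then flrw_diag a x m * (\<Sum>b\<in>UNIV. flrw_ricci a x b * flrw_hessian a (u1 (x $ 0)) (u2 (x $ 0)) x b) else 0)"
  proof -
    have "(\<Sum>c\<in>UNIV. ricci_up (flrw_metric a) b c x * flrw_metric a x $ m $ n *
        hessian (flrw_metric a) (\<lambda>y. u (y $ 0)) b c x) = (if m = n then flrw_diag a x m * (flrw_ricci a x b *
        flrw_hessian a (u1 (x $ 0)) (u2 (x $ 0)) x b) else 0)" for b
      using index_cases[of b] unfolding ricci_up_flrw hessian_flrw flrw_metric_nth sum_index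
      by (elim disjE) (simp_all add: diag_nonzero)
    thus ?thesis by (simp add: sum_distrib_left)
  qed
  \<comment> \<open>The diagonal Hessian forces c = b, and planes with b = m do not exist, so the
    value that \<open>flrw_curv\<close> happens to have there is subtracted.\<close>
  have 3: "(\<Sum>c\<in>UNIV. \<Sum>b\<in>UNIV. riemann (flrw_metric a) b m c n x * hessian_mixed (flrw_metric a) (\<lambda>y. u (y $ 0)) c b x)
     = (if m = n then flrw_diag a x m * ((\<Sum>b\<in>UNIV. flrw_curv a x b m * flrw_hessian a (u1 (x $ 0)) (u2 (x $ 0)) x b)
         - flrw_curv a x m m * flrw_hessian a (u1 (x $ 0)) (u2 (x $ 0)) x m) else 0)"
    using index_cases[of m] index_cases[of n] unfolding riemann_components hessian_mixed_flrw sum_index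
    by (elim disjE; simp add: algebra_simps)
  show ?thesis
  proof (cases "m = n")
    case True
    have nn: "n = n \<longleftrightarrow> True" by simp
    show ?thesis
      using index_cases[of n]
      unfolding gb_tensor_def unfolding 1 2 3 unfolding scalar_curvature_flrw einstein_flrw hessian_flrw hessian_mixed_flrw True
        nn if_True
      unfolding sum_index flrw_ricci_def flrw_hessian_def flrw_curv_def H_def[symmetric] \<kappa>_def[symmetric]
      by (elim disjE; simp; simp add: power2_eq_square power3_eq_cube algebra_simps)
  next
    case False
    thus ?thesis
      unfolding gb_tensor_def unfolding 1 2 3 unfolding scalar_curvature_flrw einstein_flrw hessian_flrw hessian_mixed_flrw by simp
  qed
qed
end

end

section \<open>The field equations as ordinary differential equations\<close>

context
  fixes a \<phi> :: "real \<Rightarrow> real" and x :: event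
  assumes pos: "\<And>t. 0 < a t" and diff: "\<And>t. (a has_real_derivative deriv a t) (at t)"
    and diff2: "\<And>t. (deriv a has_real_derivative deriv (deriv a) t) (at t)"
    and phi: "\<And>t. (\<phi> has_real_derivative deriv \<phi> t) (at t)"
    and phi2: "\<And>t. (deriv \<phi> has_real_derivative deriv (deriv \<phi>) t) (at t)"
    and x: "x \<in> spherical_chart"
begin

lemma grad_up_flrw:
  "y \<in> spherical_chart \<Longrightarrow> grad_up (flrw_metric a) (flrw_scalar \<phi>) m y = (if m = 0 then - deriv \<phi> (y $ 0) else 0)"
  unfolding grad_up_def flrw_scalar_def partial_scalar[OF phi] ginv_flrw[of a, OF pos]
  by (simp add: sum_index flrw_diag_def)

text \<open>Since \<kappa> = a''/a = H' + H^2, the combination 2 \<kappa> + H^2 is 2 H' + 3 H^2. The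
  three spatial equations coincide, which leaves one besides the constraint.\<close>

lemma metric_equation_flrw:
  defines "H \<equiv> deriv a (x $ 0) / a (x $ 0)" and "\<kappa> \<equiv> deriv (deriv a) (x $ 0) / a (x $ 0)"
    and "\<psi> \<equiv> deriv \<phi> (x $ 0)"
  shows "metric_equation (flrw_metric a) (flrw_scalar \<phi>) x \<longleftrightarrow>
    3 * H\<^sup>2 = \<psi>\<^sup>2 + 12 * H ^ 3 * \<phi> (x $ 0) * \<psi> \<and>
    2 * \<kappa> + H\<^sup>2 = - \<psi>\<^sup>2 + 8 * \<kappa> * H * \<phi> (x $ 0) * \<psi> + 4 * H\<^sup>2 * (\<psi>\<^sup>2 + \<phi> (x $ 0) * deriv (deriv \<phi>) (x $ 0))"
proof -
  let ?d = "flrw_diag a x"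
  have c1: "((\<lambda>t. coupling (\<phi> t)) has_real_derivative \<phi> t * deriv \<phi> t) (at t)" for t
    unfolding coupling_def by (auto intro!: derivative_eq_intros phi)
  have c2: "((\<lambda>t. \<phi> t * deriv \<phi> t) has_real_derivative (deriv \<phi> t)\<^sup>2 + \<phi> t * deriv (deriv \<phi>) t) (at t)" for t
    by (rule DERIV_cong[OF DERIV_mult[OF phi phi2]]) (simp add: power2_eq_square)
  have gs: "grad_sq (flrw_metric a) (flrw_scalar \<phi>) x = - \<psi>\<^sup>2"
    unfolding grad_sq_def grad_up_flrw[OF x] unfolding flrw_scalar_def partial_scalar[OF phi]
    by (simp add: sum_index \<psi>_def power2_eq_square)
  have "metric_equation (flrw_metric a) (flrw_scalar \<phi>) x \<longleftrightarrow>
    (\<forall>m. einstein (flrw_metric a) m m x + gb_tensor (flrw_metric a) (\<lambda>y. coupling (\<phi> (y $ 0))) m m x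
      = (if m = 0 then 2 * \<psi>\<^sup>2 else 0) + \<psi>\<^sup>2 * ?d m)"
    unfolding metric_equation_def gs
    unfolding flrw_scalar_def partial_scalar[OF phi] flrw_metric_nth
      einstein_flrw[OF pos diff diff2 x] gb_tensor_flrw[OF pos diff diff2 x c1 c2] \<psi>_def[symmetric]
    by (auto simp: power2_eq_square)
  also have "\<dots> \<longleftrightarrow> (\<forall>m::4. if m = 0 then 3 * H\<^sup>2 = \<psi>\<^sup>2 + 12 * H ^ 3 * \<phi> (x $ 0) * \<psi> else
     - 2 * \<kappa> - H\<^sup>2 + 4 * H\<^sup>2 * (\<psi>\<^sup>2 + \<phi> (x $ 0) * deriv (deriv \<phi>) (x $ 0))
      + 8 * \<kappa> * H * (\<phi> (x $ 0) * \<psi>) = \<psi>\<^sup>2)"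
  proof (rule all_cong1)
    fix m
    show "(einstein (flrw_metric a) m m x + gb_tensor (flrw_metric a) (\<lambda>y. coupling (\<phi> (y $ 0))) m m x
      = (if m = 0 then 2 * \<psi>\<^sup>2 else 0) + \<psi>\<^sup>2 * ?d m) =
      (if m = 0 then 3 * H\<^sup>2 = \<psi>\<^sup>2 + 12 * H ^ 3 * \<phi> (x $ 0) * \<psi> else
     - 2 * \<kappa> - H\<^sup>2 + 4 * H\<^sup>2 * (\<psi>\<^sup>2 + \<phi> (x $ 0) * deriv (deriv \<phi>) (x $ 0))
      + 8 * \<kappa> * H * (\<phi> (x $ 0) * \<psi>) = \<psi>\<^sup>2)"
    proof (cases "m = 0")
      case True
      show ?thesis
        unfolding einstein_flrw[OF pos diff diff2 x] gb_tensor_flrw[OF pos diff diff2 x c1 c2]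
          flrw_ricci_def H_def[symmetric] \<kappa>_def[symmetric] \<psi>_def[symmetric]
        by (simp add: True flrw_diag_def) (auto simp: algebra_simps)
    next
      \<comment> \<open>All spatial equations are the same equation times the nonzero entry of the
        metric.\<close>
      case False
      have "?thesis \<longleftrightarrow> (?d m * (- 2 * \<kappa> - H\<^sup>2 + 4 * H\<^sup>2 * (\<psi>\<^sup>2 + \<phi> (x $ 0) * deriv (deriv \<phi>) (x $ 0))
            + 8 * \<kappa> * H * (\<phi> (x $ 0) * \<psi>)) = ?d m * \<psi>\<^sup>2 \<longleftrightarrow>
         - 2 * \<kappa> - H\<^sup>2 + 4 * H\<^sup>2 * (\<psi>\<^sup>2 + \<phi> (x $ 0) * deriv (deriv \<phi>) (x $ 0))
            + 8 * \<kappa> * H * (\<phi> (x $ 0) * \<psi>) = \<psi>\<^sup>2)"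
        unfolding einstein_flrw[OF pos diff diff2 x] gb_tensor_flrw[OF pos diff diff2 x c1 c2]
          flrw_ricci_def H_def[symmetric] \<kappa>_def[symmetric] \<psi>_def[symmetric]
        using False by (simp add: algebra_simps)
      thus ?thesis using flrw_diag_nonzero[of a x m, OF pos x] by simp
    qed
  qed
  also have "\<dots> \<longleftrightarrow> 3 * H\<^sup>2 = \<psi>\<^sup>2 + 12 * H ^ 3 * \<phi> (x $ 0) * \<psi> \<and>
    - 2 * \<kappa> - H\<^sup>2 + 4 * H\<^sup>2 * (\<psi>\<^sup>2 + \<phi> (x $ 0) * deriv (deriv \<phi>) (x $ 0))
      + 8 * \<kappa> * H * (\<phi> (x $ 0) * \<psi>) = \<psi>\<^sup>2"
  proof -
    have "(1::4) \<noteq> 0" by simp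
    thus ?thesis by metis
  qed
  finally show ?thesis by (simp add: algebra_simps) linarith
qed

lemma scalar_equation_flrw:
  defines "H \<equiv> deriv a (x $ 0) / a (x $ 0)" and "\<kappa> \<equiv> deriv (deriv a) (x $ 0) / a (x $ 0)"
    and "\<psi> \<equiv> deriv \<phi> (x $ 0)"
  shows "scalar_equation (flrw_metric a) (flrw_scalar \<phi>) x \<longleftrightarrow>
    deriv (deriv \<phi>) (x $ 0) + 3 * \<psi> * H + 6 * \<phi> (x $ 0) * \<kappa> * H\<^sup>2 = 0"
proof -
  have sq: "sqrt (- det (flrw_metric a y)) = a (y $ 0) ^ 3 * (y $ 1)\<^sup>2 * sin (y $ 2)"
    if y: "y \<in> spherical_chart" for y
  proof -
    have "- det (flrw_metric a y) = (a (y $ 0) ^ 3 * (y $ 1)\<^sup>2 * sin (y $ 2))\<^sup>2"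
      unfolding det_diagonal[of "flrw_metric a y", unfolded flrw_metric_nth, simplified] prod_index
      by (simp add: flrw_diag_def power2_eq_square power3_eq_cube)
    thus ?thesis using pos[of "y $ 0"] chart_pos[OF y] by simp
  qed
  have "partial m (\<lambda>y. sqrt (- det (flrw_metric a y)) * grad_up (flrw_metric a) (flrw_scalar \<phi>) m y) x
    = (if m = 0 then - (a (x $ 0) ^ 3 * (x $ 1)\<^sup>2 * sin (x $ 2)) * (deriv (deriv \<phi>) (x $ 0) + 3 * \<psi> * H) else 0)" for m
  proof -
    have sq': "((\<lambda>r. r\<^sup>2) has_real_derivative 2 * r) (at r)" for r :: real
      by (auto intro!: derivative_eq_intros)
    have ap: "((\<lambda>t. a t ^ 3 * - deriv \<phi> t) has_real_derivative
       - (a t ^ 3 * (deriv (deriv \<phi>) t + 3 * deriv \<phi> t * (deriv a t / a t)))) (at t)" for t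
      by (rule DERIV_cong[OF DERIV_mult[OF DERIV_power[OF diff, of 3] DERIV_minus[OF phi2]]])
        (use pos[of t] in \<open>auto simp: field_simps power2_eq_square power3_eq_cube\<close>)
    have "partial m (\<lambda>y. sqrt (- det (flrw_metric a y)) * grad_up (flrw_metric a) (flrw_scalar \<phi>) m y) x
      = partial m (\<lambda>y. if m = 0 then a (y $ 0) ^ 3 * - deriv \<phi> (y $ 0) * (y $ 1)\<^sup>2 * sin (y $ 2) else 0) x"
      by (rule partial_cong[OF open_spherical_chart x]) (simp add: sq grad_up_flrw)
    also have "\<dots> = (if m = 0 then - (a (x $ 0) ^ 3 * (x $ 1)\<^sup>2 * sin (x $ 2)) * (deriv (deriv \<phi>) (x $ 0) + 3 * \<psi> * H) else 0)"
      using partial_separable[where m=m, OF ap sq' DERIV_sin, of x] unfolding H_def \<psi>_def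
      by (cases "m = 0") (simp_all add: partial_const)
    finally show ?thesis .
  qed
  hence "scalar_equation (flrw_metric a) (flrw_scalar \<phi>) x \<longleftrightarrow>
     - (deriv (deriv \<phi>) (x $ 0) + 3 * \<psi> * H) - 6 * \<phi> (x $ 0) * H\<^sup>2 * \<kappa> = 0"
    using pos[of "x $ 0"] chart_pos[OF x]
    unfolding scalar_equation_def gauss_bonnet_flrw[OF pos diff diff2 x] sq[OF x]
      H_def[symmetric] \<kappa>_def[symmetric]
    by (simp add: flrw_scalar_def mult_ac)
  thus ?thesis by (simp add: algebra_simps) linarith
qed

end

lemma lorentzian_flrw:
  assumes pos: "\<And>t. 0 < a t" and x: "x \<in> spherical_chart"
  shows "lorentzian (flrw_metric a x)"
proof -
  define P :: "real ^ 4 ^ 4" where "P = (\<chi> i j. if i = j then 1 / sqrt \<bar>flrw_diag a x i\<bar> else 0)"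
  have "det P \<noteq> 0"
    using flrw_diag_nonzero[of a x, OF pos x] by (subst det_diagonal) (auto simp: P_def)
  moreover have "transpose P ** flrw_metric a x ** P = (\<chi> i j. if i = j then (if i = 0 then - 1 else 1) else 0)"
  proof -
    have "(transpose P ** flrw_metric a x ** P) $ i $ j = (if i = j then flrw_diag a x i / \<bar>flrw_diag a x i\<bar> else 0)" for i j
      unfolding matrix_matrix_mult_def transpose_def P_def
      by (simp add: flrw_metric_nth if_distrib[of "\<lambda>z. z * _"] if_distrib[of "\<lambda>z. _ * z"] cong: if_cong)
    moreover have "flrw_diag a x i / \<bar>flrw_diag a x i\<bar> = (if i = 0 then - 1 else 1)" for i
      using pos[of "x $ 0"] chart_pos[OF x] by (simp add: flrw_diag_def)
    ultimately show ?thesis unfolding vec_eq_iff by simp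
  qed
  ultimately show ?thesis unfolding lorentzian_def
    by (auto simp: invertible_det_nz transpose_def vec_eq_iff flrw_metric_nth intro!: exI[of _ P])
qed

lemma C2_realD:
  assumes "C2_real u"
  shows "(u has_real_derivative deriv u t) (at t)" "(deriv u has_real_derivative deriv (deriv u) t) (at t)"
proof -
  from assms have "u differentiable (at t)"
    unfolding C2_real_def differentiable_on_def by auto
  thus "(u has_real_derivative deriv u t) (at t)"
    by (simp add: DERIV_deriv_iff_real_differentiable)
  from assms have "deriv u differentiable (at t)"
    unfolding C2_real_def by (auto simp: C1_differentiable_on_eq)
  thus "(deriv u has_real_derivative deriv (deriv u) t) (at t)"
    by (simp add: DERIV_deriv_iff_real_differentiable)
qed

lemma C2_realI:
  assumes "\<And>t. (u has_real_derivative u1 t) (at t)" "\<And>t. (u1 has_real_derivative u2 t) (at t)"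
    "continuous_on UNIV u2"
  shows "C2_real u" "deriv u = u1" "deriv (deriv u) = u2"
proof -
  show 1: "deriv u = u1" using assms(1) DERIV_imp_deriv by blast
  show "deriv (deriv u) = u2" unfolding 1 using assms(2) DERIV_imp_deriv by blast
  show "C2_real u"
    unfolding C2_real_def 1 C1_differentiable_on_def differentiable_on_def
    using assms by (auto simp: has_real_derivative_iff_has_vector_derivative intro: differentiableI_vector)
qed

lemma esgb_flrw_solution_iff:
  "esgb_flrw_solution a \<phi> \<longleftrightarrow> (\<forall>t. 0 < a t) \<and> C2_real a \<and> C2_real \<phi> \<and>
    (\<forall>t. let H = deriv a t / a t; \<kappa> = deriv (deriv a) t / a t; \<psi> = deriv \<phi> t; \<psi>' = deriv (deriv \<phi>) t in
      3 * H\<^sup>2 = \<psi>\<^sup>2 + 12 * H ^ 3 * \<phi> t * \<psi> \<and>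
      2 * \<kappa> + H\<^sup>2 = - \<psi>\<^sup>2 + 8 * \<kappa> * H * \<phi> t * \<psi> + 4 * H\<^sup>2 * (\<psi>\<^sup>2 + \<phi> t * \<psi>') \<and>
      \<psi>' + 3 * \<psi> * H + 6 * \<phi> t * \<kappa> * H\<^sup>2 = 0)" (is "_ \<longleftrightarrow> _ \<and> _ \<and> _ \<and> (\<forall>t. ?E t)")
proof (cases "(\<forall>t. 0 < a t) \<and> C2_real a \<and> C2_real \<phi>")
  case True
  hence pos: "0 < a t" for t by simp
  note D = C2_realD[of a] C2_realD[of \<phi>]
  have "esgb_solution_on spherical_chart (flrw_metric a) (flrw_scalar \<phi>) \<longleftrightarrow> (\<forall>x\<in>spherical_chart. ?E (x $ 0))"
    unfolding esgb_solution_on_def Let_def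
    using True pos
    by (intro ball_cong refl)
      (simp add: lorentzian_flrw metric_equation_flrw scalar_equation_flrw D)
  also have "\<dots> \<longleftrightarrow> (\<forall>t. ?E t)"
  proof (intro iffI allI ballI)
    fix t assume *: "\<forall>x\<in>spherical_chart. ?E (x $ 0)"
    \<comment> \<open>The equations depend on the time coordinate only, so one chart point per time
      suffices; all other coordinates equal to 1 is admissible as 1 < pi.\<close>
    have "(\<chi> i. if i = 0 then t else 1) \<in> spherical_chart"
      using pi_gt3 by (simp add: spherical_chart_def)
    from bspec[OF * this] show "?E t" by simp
  qed simp
  finally show ?thesis using True by (simp add: esgb_flrw_solution_def)
qed (auto simp: esgb_flrw_solution_def)

section \<open>Reduction of the initial value problem to the planar system\<close>

lemma left_limit_ge:
  fixes f :: "real \<Rightarrow> real"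
  assumes "isCont f T" "a < T" "\<And>t. t \<in> {a<..<T} \<Longrightarrow> c \<le> f t"
  shows "c \<le> f T"
proof (rule tendsto_lowerbound)
  show "(f \<longlongrightarrow> f T) (at_left T)" using assms(1) by (simp add: isCont_def filterlim_at_split)
  show "\<forall>\<^sub>F t in at_left T. c \<le> f t"
    by (rule eventually_mono[OF eventually_at_left_real[OF assms(2)]]) (rule assms(3))
qed simp

lemma right_limit_ge:
  fixes f :: "real \<Rightarrow> real"
  assumes "isCont f T" "T < a" "\<And>t. t \<in> {T<..<a} \<Longrightarrow> c \<le> f t"
  shows "c \<le> f T"
proof (rule tendsto_lowerbound)
  show "(f \<longlongrightarrow> f T) (at_right T)" using assms(1) by (simp add: isCont_def filterlim_at_split)
  show "\<forall>\<^sub>F t in at_right T. c \<le> f t"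
    by (rule eventually_mono[OF eventually_at_right_real[OF assms(2)]]) (rule assms(3))
qed simp

lemma left_limit_le:
  fixes f :: "real \<Rightarrow> real"
  assumes "isCont f T" "a < T" "\<And>t. t \<in> {a<..<T} \<Longrightarrow> f t \<le> c"
  shows "f T \<le> c"
  using left_limit_ge[where f = "\<lambda>t. - f t" and T = T and a = a and c = "- c"] assms by (auto intro: continuous_minus)

lemma right_limit_le:
  fixes f :: "real \<Rightarrow> real"
  assumes "isCont f T" "T < a" "\<And>t. t \<in> {T<..<a} \<Longrightarrow> f t \<le> c"
  shows "f T \<le> c"
  using right_limit_ge[where f = "\<lambda>t. - f t" and T = T and a = a and c = "- c"] assms by (auto intro: continuous_minus)

lemma planar_subset: "planar H p S \<Longrightarrow> S' \<subseteq> S \<Longrightarrow> planar H p S'"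
  unfolding planar_def by blast

lemma (in planar_future) H_less_init: "t \<in> {0<..T} \<Longrightarrow> H t < \<beta>"
proof -
  assume t: "t \<in> {0<..T}"
  have "1 / (t + 1 / \<beta>) \<le> 1 / (1 / \<beta>)"
    using t \<beta> by (intro divide_left_mono) (auto intro!: divide_pos_pos add_pos_pos)
  thus ?thesis using H_bounds(2)[OF t] by simp
qed

text \<open>A bound free of T, so that it survives the limit in the continuation arguments.\<close>

lemma (in planar_past) H_lower_uniform: "t \<in> {T..0} \<Longrightarrow> min \<beta> (2 / 5) \<le> H t"
  using H_ge[of t] by (cases "\<beta> \<le> sqrt (5 / 27)") auto

text \<open>The constraint in the variable \<open>p = H / \<psi>\<close> reads \<open>12 p H\<^sup>2 \<phi> = 3 p\<^sup>2 - 1\<close>, after which the other two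
  equations are linear in \<open>\<kappa>\<close> and \<open>\<psi>'\<close>.\<close>

lemma reduction:
  fixes H \<psi> \<phi> \<kappa> \<psi>' :: real
  assumes H: "0 < H" and \<psi>: "0 < \<psi>"
    and E1: "3 * H\<^sup>2 = \<psi>\<^sup>2 + 12 * H ^ 3 * \<phi> * \<psi>"
    and E2: "2 * \<kappa> + H\<^sup>2 = - \<psi>\<^sup>2 + 8 * \<kappa> * H * \<phi> * \<psi> + 4 * H\<^sup>2 * (\<psi>\<^sup>2 + \<phi> * \<psi>')"
    and E3: "\<psi>' + 3 * \<psi> * H + 6 * \<phi> * \<kappa> * H\<^sup>2 = 0"
  defines "p \<equiv> H / \<psi>"
  shows "\<phi> = (3 * p\<^sup>2 - 1) / (12 * p * H\<^sup>2)"
    and "\<kappa> - H\<^sup>2 = H\<^sup>2 * planar_N H p / planar_D p"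
    and "((\<kappa> - H\<^sup>2) * \<psi> - H * \<psi>') / (\<psi> * \<psi>) = 2 * H * p * planar_M H p / planar_D p"
proof -
  have p: "0 < p" "\<psi> = H / p" using H \<psi> by (auto simp: p_def)
  have p\<psi>: "p * \<psi> = H" using \<psi> by (simp add: p_def)
  \<comment> \<open>The constraint makes w a function of p alone, which separates H from \<phi> in
    the other two equations.\<close>
  define w where "w = H\<^sup>2 * \<phi>"
  have w: "12 * w * p = 3 * p\<^sup>2 - 1"
  proof -
    have "H\<^sup>2 * (12 * w * p) = H\<^sup>2 * (3 * p\<^sup>2 - 1)"
      using E1 p(1) H unfolding p(2) w_def
      by (simp add: field_simps power2_eq_square power3_eq_cube)
    thus ?thesis using H by simp
  qed
  thus "\<phi> = (3 * p\<^sup>2 - 1) / (12 * p * H\<^sup>2)"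
    using p(1) H by (simp add: w_def field_simps)
  have \<psi>': "p * \<psi>' = - 3 * H\<^sup>2 - 6 * w * \<kappa> * p"
  proof -
    have "p * (\<psi>' + 3 * \<psi> * H + 6 * \<phi> * \<kappa> * H\<^sup>2) = 0" unfolding E3 by simp
    hence "p * \<psi>' + 3 * (p * \<psi>) * H + 6 * w * \<kappa> * p = 0" by (simp add: w_def algebra_simps)
    thus ?thesis unfolding p\<psi> by (simp add: power2_eq_square algebra_simps)
  qed
  have e2: "p\<^sup>2 * (2 * \<kappa> + H\<^sup>2) = - H\<^sup>2 + 8 * \<kappa> * w * p + 4 * H ^ 4 + 4 * w * p * (p * \<psi>')"
  proof -
    have "p\<^sup>2 * (2 * \<kappa> + H\<^sup>2) = - (p * \<psi>)\<^sup>2 + 8 * \<kappa> * H * \<phi> * (p * \<psi>) * p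
        + 4 * H\<^sup>2 * (p * \<psi>)\<^sup>2 + 4 * w * p * (p * \<psi>')"
      unfolding E2 by (simp add: w_def power2_eq_square algebra_simps)
    thus ?thesis unfolding p\<psi> by (simp add: w_def power2_eq_square power4_eq_xxxx algebra_simps)
  qed
  \<comment> \<open>Inserting p \<psi>' leaves one linear equation for \<kappa>, with coefficient
    \<open>planar_D p / 6\<close>.\<close>
  have \<kappa>: "\<kappa> * planar_D p = 24 * H\<^sup>2 * (H\<^sup>2 - p\<^sup>2)"
    using e2 w unfolding \<psi>' planar_D_def by algebra
  have ND: "planar_N H p + planar_D p = 24 * (H\<^sup>2 - p\<^sup>2)"
    by (simp add: planar_N_def planar_D_def)
  have "(\<kappa> - H\<^sup>2) * planar_D p = H\<^sup>2 * planar_N H p"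
    using \<kappa> ND by algebra
  thus "\<kappa> - H\<^sup>2 = H\<^sup>2 * planar_N H p / planar_D p"
    using planar_D_pos[of p] by (simp add: eq_divide_eq)
  have "p * ((\<kappa> - H\<^sup>2) - p * \<psi>') * planar_D p = H * (2 * H * p * planar_M H p)"
    using \<kappa> w unfolding \<psi>' planar_D_def planar_M_def by algebra
  hence "p * ((\<kappa> - H\<^sup>2) - p * \<psi>') / H = 2 * H * p * planar_M H p / planar_D p"
    using planar_D_pos[of p] H by (simp add: frac_eq_eq mult_ac)
  moreover have "((\<kappa> - H\<^sup>2) * \<psi> - H * \<psi>') / (\<psi> * \<psi>) = p * ((\<kappa> - H\<^sup>2) - p * \<psi>') / H"
    using p H unfolding p(2) by (simp add: field_simps power2_eq_square)
  ultimately show "((\<kappa> - H\<^sup>2) * \<psi> - H * \<psi>') / (\<psi> * \<psi>) = 2 * H * p * planar_M H p / planar_D p"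
    by simp
qed

text \<open>Multiplying the three equations by p^2, p^2 \<open>planar_D\<close> and p
  \<open>planar_D\<close> clears the denominators; what remains are polynomial identities modulo 12
  w p = 3 p^2 - 1.\<close>

lemma reduction_converse:
  fixes H p :: real
  assumes H: "0 < H" and p: "0 < p"
  defines "\<psi> \<equiv> H / p" and "\<phi> \<equiv> (3 * p\<^sup>2 - 1) / (12 * p * H\<^sup>2)"
    and "\<kappa> \<equiv> H\<^sup>2 * planar_N H p / planar_D p + H\<^sup>2"
    and "\<psi>' \<equiv> H / p * (H * ((planar_N H p - 2 * planar_M H p) / planar_D p))"
  shows "3 * H\<^sup>2 = \<psi>\<^sup>2 + 12 * H ^ 3 * \<phi> * \<psi>"
    and "2 * \<kappa> + H\<^sup>2 = - \<psi>\<^sup>2 + 8 * \<kappa> * H * \<phi> * \<psi> + 4 * H\<^sup>2 * (\<psi>\<^sup>2 + \<phi> * \<psi>')"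
    and "\<psi>' + 3 * \<psi> * H + 6 * \<phi> * \<kappa> * H\<^sup>2 = 0"
proof -
  define w where "w = (3 * p\<^sup>2 - 1) / (12 * p)"
  have w: "12 * w * p = 3 * p\<^sup>2 - 1" using p by (simp add: w_def)
  have \<phi>: "\<phi> * H\<^sup>2 = w" using H p by (simp add: w_def \<phi>_def)
  have ND: "planar_N H p + planar_D p = 24 * (H\<^sup>2 - p\<^sup>2)"
    by (simp add: planar_N_def planar_D_def)
  have D: "planar_D p \<noteq> 0" using planar_D_pos[of p] by simp
  have \<kappa>: "\<kappa> * planar_D p = 24 * H\<^sup>2 * (H\<^sup>2 - p\<^sup>2)"
  proof -
    have "\<kappa> * planar_D p = H\<^sup>2 * (planar_N H p + planar_D p)"
      using D by (simp add: \<kappa>_def algebra_simps)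
    thus ?thesis using ND by simp
  qed
  have p\<psi>: "p * \<psi> = H" using p by (simp add: \<psi>_def)
  have \<psi>': "p * \<psi>' * planar_D p = H\<^sup>2 * (planar_N H p - 2 * planar_M H p)"
    using p D by (simp add: \<psi>'_def power2_eq_square)
  have "p\<^sup>2 * (\<psi>\<^sup>2 + 12 * H ^ 3 * \<phi> * \<psi>) = (p * \<psi>)\<^sup>2 + 12 * (\<phi> * H\<^sup>2) * p * H * (p * \<psi>)"
    by (simp add: power2_eq_square power3_eq_cube algebra_simps)
  also have "\<dots> = p\<^sup>2 * (3 * H\<^sup>2)"
    unfolding p\<psi> \<phi> w by (simp add: power2_eq_square algebra_simps)
  finally have "p\<^sup>2 * (3 * H\<^sup>2) = p\<^sup>2 * (\<psi>\<^sup>2 + 12 * H ^ 3 * \<phi> * \<psi>)" ..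
  thus "3 * H\<^sup>2 = \<psi>\<^sup>2 + 12 * H ^ 3 * \<phi> * \<psi>" using p by simp
  have "planar_D p * (p * (\<psi>' + 3 * \<psi> * H + 6 * \<phi> * \<kappa> * H\<^sup>2))
     = p * \<psi>' * planar_D p + 3 * (p * \<psi>) * H * planar_D p + 6 * (\<phi> * H\<^sup>2) * p * (\<kappa> * planar_D p)"
    by (simp add: algebra_simps)
  also have "\<dots> = 0"
    unfolding \<psi>' \<phi> \<kappa> p\<psi> using w unfolding planar_D_def planar_N_def planar_M_def by algebra
  finally show E3: "\<psi>' + 3 * \<psi> * H + 6 * \<phi> * \<kappa> * H\<^sup>2 = 0" using p D by simp
  have "planar_D p * (p\<^sup>2 * (2 * \<kappa> + H\<^sup>2 - (- \<psi>\<^sup>2 + 8 * \<kappa> * H * \<phi> * \<psi> + 4 * H\<^sup>2 * (\<psi>\<^sup>2 + \<phi> * \<psi>'))))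
     = 2 * p\<^sup>2 * (\<kappa> * planar_D p) + H\<^sup>2 * p\<^sup>2 * planar_D p + (p * \<psi>)\<^sup>2 * planar_D p
       - 8 * (\<kappa> * planar_D p) * (H * \<phi>) * p * (p * \<psi>) - 4 * H\<^sup>2 * (p * \<psi>)\<^sup>2 * planar_D p
       - 4 * (\<phi> * H\<^sup>2) * p * (p * \<psi>' * planar_D p)"
    by (simp add: power2_eq_square algebra_simps)
  also have "\<dots> = 0"
  proof -
    have "8 * (\<kappa> * planar_D p) * (H * \<phi>) * p * H = 8 * (\<kappa> * planar_D p) * w * p"
      unfolding \<phi>[symmetric] by (simp add: power2_eq_square)
    thus ?thesis
      unfolding \<psi>' \<kappa> p\<psi> \<phi> using w unfolding planar_D_def planar_N_def planar_M_def by algebra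
  qed
  finally show "2 * \<kappa> + H\<^sup>2 = - \<psi>\<^sup>2 + 8 * \<kappa> * H * \<phi> * \<psi> + 4 * H\<^sup>2 * (\<psi>\<^sup>2 + \<phi> * \<psi>')"
    using p D by simp
qed

lemma (in planar_future) box:
  assumes "t \<in> {0..T}" shows "H t < 1" "p t < 1"
proof -
  have "\<beta>\<^sup>2 < 1\<^sup>2" using \<beta> by simp
  hence b1: "\<beta> < 1" by (rule power2_less_imp_less) simp
  have "(1 / sqrt 3 :: real)\<^sup>2 < 1\<^sup>2" by (simp add: power_divide)
  hence s1: "1 / sqrt 3 < (1 :: real)" by (rule power2_less_imp_less) simp
  show "H t < 1"
    using H_less_init[of t] assms b1 by (cases "t = 0") (auto simp: H_0)
  show "p t < 1"
  proof (cases "t = 0")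
    case False
    hence "(p t)\<^sup>2 + 2 * (H t)\<^sup>2 < 1 / 3 + 2 * \<beta>\<^sup>2" using p_sq_upper[of t] assms by auto
    hence "(p t)\<^sup>2 < 1" using \<beta>(2) zero_le_power2[of "H t"] by linarith
    hence "(p t)\<^sup>2 < 1\<^sup>2" by simp
    thus ?thesis by (rule power2_less_imp_less) simp
  qed (use s1 in \<open>simp add: p_0\<close>)
qed

lemma (in planar_past) p_less_1: "t \<in> {T..0} \<Longrightarrow> p t < 1"
proof -
  assume "t \<in> {T..0}"
  hence "(p t)\<^sup>2 < 1\<^sup>2" using p_sq_le(1)[of t] by simp
  thus ?thesis by (rule power2_less_imp_less) simp
qed

text \<open>The bound has to depend on T: \<psi> = H / p grows without limit into the past while H
  stays bounded, so p tends to 0. For continuation to a finite time this is enough.\<close>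

lemma (in planar_past) p_lower_uniform:
  assumes t: "t \<in> {T..<0}"
  shows "min \<beta> (2 / 5) / (sqrt 3 * exp (- 12 * T)) \<le> p t"
proof -
  have tT: "t \<in> {T..0}" using t by auto
  have "sqrt 3 * exp (- 12 * t) \<le> sqrt 3 * exp (- 12 * T)" using t by simp
  hence "H t / p t \<le> sqrt 3 * exp (- 12 * T)" using psi_upper[OF t] by linarith
  hence "H t \<le> p t * (sqrt 3 * exp (- 12 * T))" using p_pos[OF tT] by (simp add: field_simps)
  hence "min \<beta> (2 / 5) \<le> p t * (sqrt 3 * exp (- 12 * T))" using H_lower_uniform[OF tT] by linarith
  thus ?thesis by (simp add: pos_divide_le_eq)
qed

section \<open>Global existence and uniqueness for the planar system\<close>

lemma planar_exists:
  assumes \<beta>: "0 < \<beta>" "3 * \<beta>\<^sup>2 < 1"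
  obtains H p where "planar H p UNIV" "H 0 = \<beta>" "p 0 = 1 / sqrt 3"
proof -
  obtain L where "\<And>x y. dist (planar_field x) (planar_field y) \<le> L * dist x y"
    using planar_field_lipschitz by blast
  then obtain z where z: "z 0 = (\<beta>, 1 / sqrt 3)" "\<And>t. (z has_vector_derivative planar_field (z t)) (at t)"
    using global_ode_solution[of planar_field L "(\<beta>, 1 / sqrt 3)"] by blast
  define H p where "H = (\<lambda>t. fst (z t))" and "p = (\<lambda>t. snd (z t))"
  have z': "z t = (H t, p t)" for t by (simp add: H_def p_def)
  have dH: "(H has_real_derivative fst (planar_field (H t, p t))) (at t)" for t
    using bounded_linear.has_vector_derivative[OF bounded_linear_fst z(2)[of t]]
    by (simp add: H_def p_def has_real_derivative_iff_has_vector_derivative)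
  have dp: "(p has_real_derivative snd (planar_field (H t, p t))) (at t)" for t
    using bounded_linear.has_vector_derivative[OF bounded_linear_snd z(2)[of t]]
    by (simp add: H_def p_def has_real_derivative_iff_has_vector_derivative)
  have cont: "isCont H t" "isCont p t" for t
    using dH dp DERIV_isCont by blast+
  have init: "H 0 = \<beta>" "p 0 = 1 / sqrt 3" using z(1) by (auto simp: H_def p_def)
  \<comment> \<open>While P holds the clamp is inactive and the clamped trajectory solves the true
    system. At the end of such an interval the estimates survive only as weak inequalities, so each
    is taken with a margin inside the open square.\<close>
  define P where "P = (\<lambda>t. 0 < H t \<and> H t < 1 \<and> 0 < p t \<and> p t < 1)"
  have planar: "planar H p S" if "\<And>t. t \<in> S \<Longrightarrow> P t" for S
    using that dH dp unfolding planar_def P_def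
    by (metis fst_conv planar_field_eq snd_conv)
  have op: "open {t. P t}"
    unfolding P_def using cont
    by (intro open_Collect_conj open_Collect_less continuous_on_const) (auto simp: continuous_on_eq_continuous_at)
  have b1: "\<beta> < 1"
  proof -
    have "\<beta>\<^sup>2 < 1\<^sup>2" using \<beta> by simp
    thus ?thesis by (rule power2_less_imp_less) simp
  qed
  have s1: "1 / sqrt 3 < (1 :: real)" by simp
  have P0: "P 0" using b1 s1 \<beta> by (simp add: P_def init)
  have fut: "P t" if "0 \<le> t" for t
  proof (rule bootstrap_future[OF P0 op _ that])
    fix T :: real assume T: "0 < T" and PT: "\<And>t. t \<in> {0..<T} \<Longrightarrow> P t"
    \<comment> \<open>P at T itself is not known yet, so the estimates are applied on {0..t} for
      every t < T.\<close>
    have F: "planar_future H p t \<beta>" if "t \<in> {0<..<T}" for t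
    proof -
      have "planar H p {0..t}" by (rule planar) (use PT that in auto)
      thus ?thesis by (simp add: planar_future_def planar_future_axioms_def \<beta> init)
    qed
    have "1 / (5 * T + 1 / \<beta>) \<le> H t" if t: "t \<in> {0<..<T}" for t
    proof -
      have "1 / (5 * T + 1 / \<beta>) \<le> 1 / (5 * t + 1 / \<beta>)"
        using t \<beta> by (intro divide_left_mono) (auto intro!: mult_pos_pos add_pos_pos)
      thus ?thesis using planar_future.H_bounds(1)[OF F[OF t], of t] t by simp
    qed
    hence "1 / (5 * T + 1 / \<beta>) \<le> H T" by (rule left_limit_ge[OF cont(1) T])
    moreover have "0 < 1 / (5 * T + 1 / \<beta>)" using T \<beta> by (simp add: add_pos_pos)
    moreover have "H T \<le> \<beta>"
      by (rule left_limit_le[OF cont(1) T]) (use planar_future.H_less_init[OF F] in fastforce)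
    moreover have "1 / sqrt 3 \<le> p T"
    proof (rule left_limit_ge[OF cont(2) T])
      fix t assume t: "t \<in> {0<..<T}"
      have "1 < 3 * (p t)\<^sup>2" using planar_future.p_sq_gt[OF F[OF t], of t] t by simp
      hence "(1 / sqrt 3)\<^sup>2 \<le> (p t)\<^sup>2" by (simp add: power_divide)
      thus "1 / sqrt 3 \<le> p t" using PT[of t] t by (auto simp: P_def intro: power2_le_imp_le)
    qed
    moreover have "(p T)\<^sup>2 \<le> 1 / 3 + 2 * \<beta>\<^sup>2"
    proof (rule left_limit_le[OF _ T])
      show "isCont (\<lambda>t. (p t)\<^sup>2) T" using cont(2) by (intro continuous_intros)
      fix t assume t: "t \<in> {0<..<T}"
      have "(p t)\<^sup>2 + 2 * (H t)\<^sup>2 < 1 / 3 + 2 * \<beta>\<^sup>2" using planar_future.p_sq_upper[OF F[OF t], of t] t by simp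
      thus "(p t)\<^sup>2 \<le> 1 / 3 + 2 * \<beta>\<^sup>2" using zero_le_power2[of "H t"] by linarith
    qed
    hence "(p T)\<^sup>2 < 1\<^sup>2" using \<beta> by simp
    hence "p T < 1" by (rule power2_less_imp_less) simp
    moreover have "0 < 1 / sqrt (3 :: real)" by simp
    ultimately show "P T" unfolding P_def using b1 by linarith
  qed
  have past: "P t" if "t \<le> 0" for t
  proof (rule bootstrap_past[OF P0 op _ that])
    fix T :: real assume T: "T < 0" and PT: "\<And>t. t \<in> {T<..0} \<Longrightarrow> P t"
    have F: "planar_past H p t \<beta>" if "t \<in> {T<..<0}" for t
    proof -
      have "planar H p {t..0}" by (rule planar) (use PT that in auto)
      thus ?thesis by (simp add: planar_past_def planar_past_axioms_def \<beta> init)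
    qed
    have "min \<beta> (2 / 5) \<le> H T"
      by (rule right_limit_ge[OF cont(1) T]) (use planar_past.H_lower_uniform[OF F] in auto)
    moreover have "H T \<le> 1 / sqrt 2"
      by (rule right_limit_le[OF cont(1) T]) (use planar_past.H_less(1)[OF F] in fastforce)
    moreover have "min \<beta> (2 / 5) / (sqrt 3 * exp (- 12 * T)) \<le> p T"
    proof (rule right_limit_ge[OF cont(2) T])
      fix t assume t: "t \<in> {T<..<0}"
      have "min \<beta> (2 / 5) / (sqrt 3 * exp (- 12 * T)) \<le> min \<beta> (2 / 5) / (sqrt 3 * exp (- 12 * t))"
        using t \<beta> by (intro divide_left_mono) auto
      thus "min \<beta> (2 / 5) / (sqrt 3 * exp (- 12 * T)) \<le> p t"
        using planar_past.p_lower_uniform[OF F[OF t], of t] t by auto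
    qed
    moreover have "0 < min \<beta> (2 / 5) / (sqrt 3 * exp (- 12 * T))" using \<beta> by simp
    moreover have "(p T)\<^sup>2 \<le> 1 / 3"
    proof (rule right_limit_le[OF _ T])
      show "isCont (\<lambda>t. (p t)\<^sup>2) T" using cont(2) by (intro continuous_intros)
      fix t assume t: "t \<in> {T<..<0}"
      show "(p t)\<^sup>2 \<le> 1 / 3" using planar_past.p_sq_le(1)[OF F[OF t], of t] t by simp
    qed
    hence "(p T)\<^sup>2 < 1\<^sup>2" by simp
    hence "p T < 1" by (rule power2_less_imp_less) simp
    moreover have "1 / sqrt 2 < (1 :: real)" "0 < min \<beta> (2 / 5)" using \<beta> by auto
    ultimately show "P T" unfolding P_def by linarith
  qed
  have "planar H p UNIV" by (rule planar) (use fut past in \<open>metis linear\<close>)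
  thus thesis using init that by blast
qed

text \<open>Any positive solution on the whole line stays in the unit square by the same estimates,
  hence also solves the clamped, globally Lipschitz equation.\<close>

lemma planar_unique:
  assumes \<beta>: "0 < \<beta>" "3 * \<beta>\<^sup>2 < 1"
    and 1: "planar H p UNIV" "H 0 = \<beta>" "p 0 = 1 / sqrt 3"
    and 2: "planar H' p' UNIV" "H' 0 = \<beta>" "p' 0 = 1 / sqrt 3"
  shows "H t = H' t" "p t = p' t"
proof -
  obtain L where L: "\<And>x y. dist (planar_field x) (planar_field y) \<le> L * dist x y"
    using planar_field_lipschitz by blast
  have box: "((\<lambda>t. (h t, q t)) has_vector_derivative planar_field (h t, q t)) (at t)"
    if hq: "planar h q UNIV" "h 0 = \<beta>" "q 0 = 1 / sqrt 3" for h q and t :: real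
  proof -
    interpret P: planar h q UNIV by fact
    have "0 < h t" "0 < q t" using P.H_pos P.p_pos by auto
    moreover have "h t < 1 \<and> q t < 1"
    proof (cases "0 \<le> t")
      case True
      interpret planar_future h q t \<beta>
        by (simp add: planar_future_def planar_future_axioms_def \<beta> hq planar_subset[OF hq(1)])
      show ?thesis using box[of t] True by simp
    next
      case False
      interpret planar_past h q t \<beta>
        by (simp add: planar_past_def planar_past_axioms_def \<beta> hq planar_subset[OF hq(1)])
      show ?thesis using H_less(3)[of t] p_less_1[of t] False by simp
    qed
    ultimately show ?thesis
      using P.H_deriv[of t] P.p_deriv[of t]
      by (auto simp: planar_field_eq has_real_derivative_iff_has_vector_derivative intro!: has_vector_derivative_Pair)
  qed
  have "(H t, p t) = (H' t, p' t)"
    by (rule ode_unique[OF L box[OF 1] box[OF 2]]) (simp add: 1 2)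
  thus "H t = H' t" "p t = p' t" by auto
qed

section \<open>From the field equations to the planar system and back\<close>

lemma ivp_planar:
  assumes \<beta>: "0 < \<beta>" "3 * \<beta>\<^sup>2 < 1" and ivp: "esgb_flrw_ivp a0 \<beta> 0 a \<phi>"
  defines "p \<equiv> \<lambda>t. hubble a t / deriv \<phi> t"
  shows "planar (hubble a) p UNIV" "hubble a 0 = \<beta>" "p 0 = 1 / sqrt 3"
    and "0 < deriv \<phi> t" "\<phi> t = (3 * (p t)\<^sup>2 - 1) / (12 * p t * (hubble a t)\<^sup>2)"
proof -
  define H where "H = hubble a"
  define \<psi> where "\<psi> = deriv \<phi>"
  define \<kappa> where "\<kappa> = (\<lambda>t. deriv (deriv a) t / a t)"
  have pos: "0 < a t" for t
    using ivp by (simp add: esgb_flrw_ivp_def esgb_flrw_solution_iff)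
  have C2: "C2_real a" "C2_real \<phi>"
    using ivp by (simp_all add: esgb_flrw_ivp_def esgb_flrw_solution_iff)
  have E: "3 * (H t)\<^sup>2 = (\<psi> t)\<^sup>2 + 12 * H t ^ 3 * \<phi> t * \<psi> t"
      "2 * \<kappa> t + (H t)\<^sup>2 = - (\<psi> t)\<^sup>2 + 8 * \<kappa> t * H t * \<phi> t * \<psi> t
         + 4 * (H t)\<^sup>2 * ((\<psi> t)\<^sup>2 + \<phi> t * deriv \<psi> t)"
      "deriv \<psi> t + 3 * \<psi> t * H t + 6 * \<phi> t * \<kappa> t * (H t)\<^sup>2 = 0" for t
  proof -
    have "\<forall>t. let H = deriv a t / a t; \<kappa> = deriv (deriv a) t / a t; \<psi> = deriv \<phi> t; \<psi>' = deriv (deriv \<phi>) t in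
      3 * H\<^sup>2 = \<psi>\<^sup>2 + 12 * H ^ 3 * \<phi> t * \<psi> \<and>
      2 * \<kappa> + H\<^sup>2 = - \<psi>\<^sup>2 + 8 * \<kappa> * H * \<phi> t * \<psi> + 4 * H\<^sup>2 * (\<psi>\<^sup>2 + \<phi> t * \<psi>') \<and>
      \<psi>' + 3 * \<psi> * H + 6 * \<phi> t * \<kappa> * H\<^sup>2 = 0"
      using ivp unfolding esgb_flrw_ivp_def esgb_flrw_solution_iff by blast
    from spec[OF this, of t]
    show "3 * (H t)\<^sup>2 = (\<psi> t)\<^sup>2 + 12 * H t ^ 3 * \<phi> t * \<psi> t"
      "2 * \<kappa> t + (H t)\<^sup>2 = - (\<psi> t)\<^sup>2 + 8 * \<kappa> t * H t * \<phi> t * \<psi> t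
         + 4 * (H t)\<^sup>2 * ((\<psi> t)\<^sup>2 + \<phi> t * deriv \<psi> t)"
      "deriv \<psi> t + 3 * \<psi> t * H t + 6 * \<phi> t * \<kappa> t * (H t)\<^sup>2 = 0"
      unfolding Let_def H_def \<psi>_def \<kappa>_def hubble_def by blast+
  qed
  have dH: "(H has_real_derivative \<kappa> t - (H t)\<^sup>2) (at t)" for t
    unfolding H_def hubble_def[abs_def] \<kappa>_def
    by (rule DERIV_cong[OF DERIV_divide[OF C2_realD(2)[OF C2(1)] C2_realD(1)[OF C2(1)]]])
      (use pos[of t] in \<open>simp_all add: diff_divide_distrib power2_eq_square\<close>)
  have d\<psi>: "(\<psi> has_real_derivative deriv \<psi> t) (at t)" for t
    unfolding \<psi>_def by (rule C2_realD(2)[OF C2(2)])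
  have cont: "isCont H t" "isCont \<psi> t" for t
    using dH d\<psi> DERIV_isCont by blast+
  have H0: "H 0 = \<beta>" and \<phi>0: "\<phi> 0 = 0" and \<psi>0: "0 < \<psi> 0"
    using ivp by (simp_all add: esgb_flrw_ivp_def H_def \<psi>_def)
  \<comment> \<open>At time 0 the constraint loses its mixed term; the sign condition selects the
    root.\<close>
  have "(\<psi> 0)\<^sup>2 = (sqrt 3 * \<beta>)\<^sup>2" using E(1)[of 0] by (simp add: H0 \<phi>0 power_mult_distrib)
  hence \<psi>0': "\<psi> 0 = sqrt 3 * \<beta>" using \<psi>0 \<beta> by (simp add: power2_eq_iff_nonneg)
  have p0: "p 0 = 1 / sqrt 3" unfolding p_def H_def[symmetric] \<psi>_def[symmetric] using \<beta> by (simp add: H0 \<psi>0')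
  \<comment> \<open>Positivity is given only at time 0. As long as it lasts the reduction applies
    and keeps H away from 0; the constraint then prevents \<psi> from vanishing.\<close>
  define P where "P = (\<lambda>t. 0 < H t \<and> 0 < \<psi> t)"
  have planar: "planar H p S" if P: "\<And>t. t \<in> S \<Longrightarrow> P t" for S
  proof
    fix t assume "t \<in> S"
    hence t: "0 < H t" "0 < \<psi> t" using P by (auto simp: P_def)
    note R = reduction[OF t E]
    show "0 < H t" by fact
    show "0 < p t" using t by (simp add: p_def H_def \<psi>_def)
    show "(H has_real_derivative (H t)\<^sup>2 * planar_N (H t) (p t) / planar_D (p t)) (at t)"
      using dH[of t] R(2) by (simp add: p_def H_def \<psi>_def)
    show "(p has_real_derivative 2 * H t * p t * planar_M (H t) (p t) / planar_D (p t)) (at t)"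
      using DERIV_divide[OF dH d\<psi>, of t] R(3) t by (simp add: p_def H_def \<psi>_def)
  qed
  have op: "open {t. P t}"
    unfolding P_def using cont
    by (intro open_Collect_conj open_Collect_less continuous_on_const) (auto simp: continuous_on_eq_continuous_at)
  have P0: "P 0" using \<beta> \<psi>0 by (simp add: P_def H0)
  \<comment> \<open>With \<psi> = 0 the constraint would read 3 H^2 = 0.\<close>
  have psi_pos: "0 < \<psi> T" if "0 < H T" "0 \<le> \<psi> T" for T
    using E(1)[of T] that by (cases "\<psi> T = 0") auto
  have fut: "P t" if "0 \<le> t" for t
  proof (rule bootstrap_future[OF P0 op _ that])
    fix T :: real assume T: "0 < T" and PT: "\<And>t. t \<in> {0..<T} \<Longrightarrow> P t"
    have "1 / (5 * T + 1 / \<beta>) \<le> H t" if t: "t \<in> {0<..<T}" for t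
    proof -
      have "planar H p {0..t}" by (rule planar) (use PT t in auto)
      then interpret planar_future H p t \<beta>
        by (simp add: planar_future_def planar_future_axioms_def \<beta> H0 p0)
      have "1 / (5 * T + 1 / \<beta>) \<le> 1 / (5 * t + 1 / \<beta>)"
        using t \<beta> by (intro divide_left_mono) (auto intro!: mult_pos_pos add_pos_pos)
      thus ?thesis using H_bounds(1)[of t] t by simp
    qed
    hence "1 / (5 * T + 1 / \<beta>) \<le> H T" by (rule left_limit_ge[OF cont(1) T])
    moreover have "0 < 1 / (5 * T + 1 / \<beta>)" using T \<beta> by (simp add: add_pos_pos)
    ultimately have "0 < H T" by linarith
    moreover have "0 \<le> \<psi> T"
      by (rule left_limit_ge[OF cont(2) T]) (use PT in \<open>auto simp: P_def less_imp_le\<close>)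
    ultimately show "P T" using psi_pos by (simp add: P_def)
  qed
  have past: "P t" if "t \<le> 0" for t
  proof (rule bootstrap_past[OF P0 op _ that])
    fix T :: real assume T: "T < 0" and PT: "\<And>t. t \<in> {T<..0} \<Longrightarrow> P t"
    have "min \<beta> (2 / 5) \<le> H t" if t: "t \<in> {T<..<0}" for t
    proof -
      have "planar H p {t..0}" by (rule planar) (use PT t in auto)
      then interpret planar_past H p t \<beta>
        by (simp add: planar_past_def planar_past_axioms_def \<beta> H0 p0)
      show ?thesis using H_lower_uniform[of t] t by simp
    qed
    hence "min \<beta> (2 / 5) \<le> H T" by (rule right_limit_ge[OF cont(1) T])
    hence "0 < H T" using \<beta> by linarith
    moreover have "0 \<le> \<psi> T"
      by (rule right_limit_ge[OF cont(2) T]) (use PT in \<open>auto simp: P_def less_imp_le\<close>)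
    ultimately show "P T" using psi_pos by (simp add: P_def)
  qed
  have P: "P t" for t using fut past by (metis linear)
  show "planar (hubble a) p UNIV" unfolding H_def[symmetric] by (rule planar) (rule P)
  show "hubble a 0 = \<beta>" "p 0 = 1 / sqrt 3" using H0 p0 by (simp_all add: H_def)
  have t: "0 < H t" "0 < \<psi> t" using P[of t] by (auto simp: P_def)
  show "0 < deriv \<phi> t" using t by (simp add: \<psi>_def)
  show "\<phi> t = (3 * (p t)\<^sup>2 - 1) / (12 * p t * (hubble a t)\<^sup>2)"
    using reduction(1)[OF t E] by (simp add: p_def H_def \<psi>_def)
qed

text \<open>In the construction \<phi> is defined algebraically by the constraint, so it has to be
  verified that its derivative is \<psi> = H / p. This is the compatibility of the constraint with
  the evolution equations.\<close>

lemma planar_phi_deriv: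
  assumes "planar H p UNIV"
  shows "((\<lambda>t. (3 * (p t)\<^sup>2 - 1) / (12 * p t * (H t)\<^sup>2)) has_real_derivative H t / p t) (at t)"
proof -
  interpret planar H p UNIV by fact
  define h q where "h = H t" and "q = p t"
  have pos: "0 < h" "0 < q" using H_pos p_pos by (auto simp: h_def q_def)
  have D: "0 < planar_D q" by (rule planar_D_pos)
  define dh dq where "dh = h\<^sup>2 * planar_N h q / planar_D q" and "dq = 2 * h * q * planar_M h q / planar_D q"
  have d: "(H has_real_derivative dh) (at t)" "(p has_real_derivative dq) (at t)"
    using H_deriv[of t] p_deriv[of t] by (auto simp: dh_def dq_def h_def q_def)
  have num: "((\<lambda>t. 3 * (p t)\<^sup>2 - 1) has_real_derivative 6 * q * dq) (at t)"
    by (rule DERIV_cong[OF DERIV_diff[OF DERIV_cmult[OF DERIV_power[OF d(2), of 2]] DERIV_const]]) (simp add: q_def)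
  have den: "((\<lambda>t. 12 * p t * (H t)\<^sup>2) has_real_derivative 12 * dq * h\<^sup>2 + 24 * q * h * dh) (at t)"
    by (rule DERIV_cong[OF DERIV_mult[OF DERIV_cmult[OF d(2)] DERIV_power[OF d(1), of 2]]]) (simp add: q_def h_def)
  have "((\<lambda>t. (3 * (p t)\<^sup>2 - 1) / (12 * p t * (H t)\<^sup>2)) has_real_derivative
     (6 * q * dq * (12 * q * h\<^sup>2) - (3 * q\<^sup>2 - 1) * (12 * dq * h\<^sup>2 + 24 * q * h * dh))
       / ((12 * q * h\<^sup>2) * (12 * q * h\<^sup>2))) (at t)"
    using DERIV_divide[OF num den] pos by (simp add: h_def q_def)
  moreover have "(6 * q * dq * (12 * q * h\<^sup>2) - (3 * q\<^sup>2 - 1) * (12 * dq * h\<^sup>2 + 24 * q * h * dh))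
       / ((12 * q * h\<^sup>2) * (12 * q * h\<^sup>2)) = h / q"
  proof -
    have "planar_D q * (6 * q * dq * (12 * q * h\<^sup>2) - (3 * q\<^sup>2 - 1) * (12 * dq * h\<^sup>2 + 24 * q * h * dh))
      = 6 * q * (dq * planar_D q) * (12 * q * h\<^sup>2)
        - (3 * q\<^sup>2 - 1) * (12 * (dq * planar_D q) * h\<^sup>2 + 24 * q * h * (dh * planar_D q))"
      by (simp add: algebra_simps)
    also have "dq * planar_D q = 2 * h * q * planar_M h q" using D by (simp add: dq_def)
    also have "dh * planar_D q = h\<^sup>2 * planar_N h q" using D by (simp add: dh_def)
    also have "6 * q * (2 * h * q * planar_M h q) * (12 * q * h\<^sup>2)
        - (3 * q\<^sup>2 - 1) * (12 * (2 * h * q * planar_M h q) * h\<^sup>2 + 24 * q * h * (h\<^sup>2 * planar_N h q))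
      = planar_D q * (144 * q * h ^ 5)"
      unfolding planar_D_def planar_N_def planar_M_def by algebra
    finally have "6 * q * dq * (12 * q * h\<^sup>2) - (3 * q\<^sup>2 - 1) * (12 * dq * h\<^sup>2 + 24 * q * h * dh) = 144 * q * h ^ 5"
      using D by simp
    thus ?thesis using pos by (simp add: divide_simps) (simp add: eval_nat_numeral)
  qed
  ultimately show ?thesis by (simp add: h_def q_def)
qed

lemma ivp_exists:
  assumes \<beta>: "0 < \<beta>" "3 * \<beta>\<^sup>2 < 1" and a0: "0 < a0"
  obtains a \<phi> where "esgb_flrw_ivp a0 \<beta> 0 a \<phi>"
proof -
  obtain H p where Hp: "planar H p UNIV" "H 0 = \<beta>" "p 0 = 1 / sqrt 3"
    using planar_exists[OF \<beta>] by blast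
  interpret planar H p UNIV by fact
  have pos: "0 < H t" "0 < p t" for t using H_pos p_pos by auto
  have cH: "continuous_on UNIV H" and cp: "continuous_on UNIV p"
    using H_deriv p_deriv by (meson UNIV_I continuous_at_imp_continuous_on DERIV_isCont)+
  obtain G where G: "G 0 = 0" "\<And>t. (G has_vector_derivative H t) (at t)"
    using global_antiderivative[OF cH] by blast
  define dH where "dH = (\<lambda>t. (H t)\<^sup>2 * planar_N (H t) (p t) / planar_D (p t))"
  define d\<psi> where "d\<psi> = (\<lambda>t. H t / p t * (H t * ((planar_N (H t) (p t) - 2 * planar_M (H t) (p t)) / planar_D (p t))))"
  define a where "a = (\<lambda>t. a0 * exp (G t))"
  define \<phi> where "\<phi> = (\<lambda>t. (3 * (p t)\<^sup>2 - 1) / (12 * p t * (H t)\<^sup>2))"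
  have a_pos: "0 < a t" for t using a0 by (simp add: a_def)
  have da: "(a has_real_derivative H t * a t) (at t)" for t
    unfolding a_def using G(2)[of t]
    by (auto intro!: derivative_eq_intros simp: has_real_derivative_iff_has_vector_derivative[symmetric])
  have dda: "((\<lambda>t. H t * a t) has_real_derivative (dH t + (H t)\<^sup>2) * a t) (at t)" for t
    by (rule DERIV_cong[OF DERIV_mult[OF H_deriv da]]) (simp_all add: dH_def power2_eq_square algebra_simps)
  have nz: "planar_D x \<noteq> 0" for x using planar_D_pos[of x] by simp
  have ca: "continuous_on UNIV a"
    using da by (meson continuous_at_imp_continuous_on DERIV_isCont)
  have cdH: "continuous_on UNIV dH"
    unfolding dH_def planar_N_def planar_D_def
    by (intro continuous_intros cH cp ballI nz[unfolded planar_D_def])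
  have pnz: "p t \<noteq> 0" for t using pos(2)[of t] by simp
  have cd\<psi>: "continuous_on UNIV d\<psi>"
    unfolding d\<psi>_def planar_N_def planar_D_def planar_M_def
    by (intro continuous_intros cH cp ballI nz[unfolded planar_D_def] pnz)
  have "continuous_on UNIV (\<lambda>t. (dH t + (H t)\<^sup>2) * a t)"
    by (intro continuous_intros cH cdH ca)
  note A = C2_realI[OF da dda this]
  note F = C2_realI[OF planar_phi_deriv[OF Hp(1)] psi_deriv[OF UNIV_I] cd\<psi>[unfolded d\<psi>_def], folded \<phi>_def d\<psi>_def]
  have hub: "deriv a t / a t = H t" for t using a_pos[of t] by (simp add: A(2))
  have kap: "deriv (deriv a) t / a t = dH t + (H t)\<^sup>2" for t using a_pos[of t] by (simp add: A(3))
  have "3 * (H t)\<^sup>2 = (H t / p t)\<^sup>2 + 12 * H t ^ 3 * \<phi> t * (H t / p t) \<and>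
      2 * (dH t + (H t)\<^sup>2) + (H t)\<^sup>2 = - (H t / p t)\<^sup>2 + 8 * (dH t + (H t)\<^sup>2) * H t * \<phi> t * (H t / p t)
        + 4 * (H t)\<^sup>2 * ((H t / p t)\<^sup>2 + \<phi> t * d\<psi> t) \<and>
      d\<psi> t + 3 * (H t / p t) * H t + 6 * \<phi> t * (dH t + (H t)\<^sup>2) * (H t)\<^sup>2 = 0" for t
    using reduction_converse[OF pos(1)[of t] pos(2)[of t]] unfolding \<phi>_def d\<psi>_def dH_def by blast
  hence "esgb_flrw_solution a \<phi>"
    unfolding esgb_flrw_solution_iff Let_def hub kap F(3) unfolding F(2)
    using a_pos A(1) F(1) by blast
  moreover have "a 0 = a0" "\<phi> 0 = 0" by (simp_all add: a_def \<phi>_def G(1) Hp power_divide)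
  moreover have "hubble a 0 = \<beta>" using hub[of 0] by (simp add: hubble_def Hp)
  moreover have "0 < deriv \<phi> 0" unfolding F(2) using pos[of 0] by simp
  ultimately have "esgb_flrw_ivp a0 \<beta> 0 a \<phi>" by (simp add: esgb_flrw_ivp_def)
  thus thesis by (rule that)
qed

text \<open>\<phi> is an algebraic function of H and p, and a is determined by its logarithmic
  derivative H and its value at 0.\<close>

lemma ivp_unique:
  assumes \<beta>: "0 < \<beta>" "3 * \<beta>\<^sup>2 < 1"
    and 1: "esgb_flrw_ivp a0 \<beta> 0 a \<phi>" and 2: "esgb_flrw_ivp a0 \<beta> 0 a' \<phi>'"
  shows "a = a'" "\<phi> = \<phi>'"
proof -
  note P1 = ivp_planar[OF \<beta> 1] and P2 = ivp_planar[OF \<beta> 2]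
  note eq = planar_unique[OF \<beta> P1(1-3) P2(1-3)]
  show "\<phi> = \<phi>'"
  proof
    fix t show "\<phi> t = \<phi>' t" unfolding P1(5)[of t] P2(5)[of t] eq(2) by (simp only: eq(1))
  qed
  have pos: "0 < a t" "0 < a' t" for t
    using 1 2 by (simp_all add: esgb_flrw_ivp_def esgb_flrw_solution_def)
  have C2: "C2_real a" "C2_real a'" using 1 2 by (simp_all add: esgb_flrw_ivp_def esgb_flrw_solution_def)
  have "((\<lambda>t. a t / a' t) has_real_derivative 0) (at t)" for t
  proof (rule DERIV_cong[OF DERIV_divide[OF C2_realD(1)[OF C2(1)] C2_realD(1)[OF C2(2)]]])
    have "deriv a t / a t = deriv a' t / a' t" using eq(1)[of t] by (simp add: hubble_def)
    hence "deriv a t * a' t = a t * deriv a' t" using pos[of t] by (simp add: field_simps)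
    thus "(deriv a t * a' t - a t * deriv a' t) / (a' t * a' t) = 0" by simp
    show "a' t \<noteq> 0" using pos(2)[of t] by simp
  qed
  hence q: "a t / a' t = a 0 / a' 0" for t
    by (intro DERIV_isconst_all) auto
  show "a = a'"
  proof
    fix t
    have "a 0 = a' 0" using 1 2 by (simp add: esgb_flrw_ivp_def)
    hence "a t / a' t = 1" using q[of t] pos[of 0] by simp
    thus "a t = a' t" using pos(2)[of t] by simp
  qed
qed

section \<open>Estimates for the solution\<close>

locale ivp =
  fixes a0 \<beta> :: real and a \<phi> :: "real \<Rightarrow> real"
  assumes \<beta>: "0 < \<beta>" "3 * \<beta>\<^sup>2 < 1" and ivp: "esgb_flrw_ivp a0 \<beta> 0 a \<phi>"
begin

abbreviation "H \<equiv> hubble a"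

definition p :: "real \<Rightarrow> real" where "p = (\<lambda>t. hubble a t / deriv \<phi> t)"

lemma planar: "planar H p UNIV" and H_init: "H 0 = \<beta>" and p_init: "p 0 = 1 / sqrt 3"
  and psi_pos: "0 < deriv \<phi> t" and phi_eq: "\<phi> t = (3 * (p t)\<^sup>2 - 1) / (12 * p t * (H t)\<^sup>2)"
  unfolding p_def by (fact ivp_planar[OF \<beta> ivp])+

lemma H_pos: "0 < H t" and p_pos: "0 < p t"
  using planar unfolding planar_def by blast+

lemma psi_eq: "deriv \<phi> t = H t / p t"
  using H_pos[of t] by (simp add: p_def)

lemma a_pos: "0 < a t" and a_init: "a 0 = a0" and phi_init: "\<phi> 0 = 0"
  using ivp by (simp_all add: esgb_flrw_ivp_def esgb_flrw_solution_def)

lemma phi_deriv: "(\<phi> has_real_derivative deriv \<phi> t) (at t)"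
  using ivp by (intro C2_realD) (simp add: esgb_flrw_ivp_def esgb_flrw_solution_def)

lemma ln_a_deriv: "((\<lambda>t. ln (a t)) has_real_derivative H t) (at t)"
proof -
  have "(a has_real_derivative deriv a t) (at t)"
    using ivp by (intro C2_realD) (simp add: esgb_flrw_ivp_def esgb_flrw_solution_def)
  from DERIV_chain2[OF DERIV_ln_divide[OF a_pos] this] show ?thesis by (simp add: hubble_def)
qed

lemma future: "planar_future H p t \<beta>"
  by (simp add: planar_future_def planar_future_axioms_def \<beta> H_init p_init planar_subset[OF planar])

lemma past: "planar_past H p t \<beta>"
  by (simp add: planar_past_def planar_past_axioms_def \<beta> H_init p_init planar_subset[OF planar])

section \<open>Bounds for positive times\<close>

lemma future_H: "0 < t \<Longrightarrow> 1 / (5 * t + 1 / \<beta>) < H t" "0 < t \<Longrightarrow> H t < 1 / (t + 1 / \<beta>)"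
  using planar_future.H_bounds[OF future, of t t] by auto

lemma future_p: "0 < t \<Longrightarrow> 1 < 3 * (p t)\<^sup>2"
  using planar_future.p_sq_gt[OF future, of t t] by auto

lemma future_sqrt_p: "0 < t \<Longrightarrow> 1 < sqrt 3 * p t"
proof -
  assume "0 < t"
  hence "1\<^sup>2 < (sqrt 3 * p t)\<^sup>2" using future_p[of t] unfolding power_mult_distrib by simp
  thus ?thesis using p_pos[of t] by (intro power2_less_imp_less[of 1 "sqrt 3 * p t"]) auto
qed

lemma future_psi_less: assumes "0 < t" shows "deriv \<phi> t < sqrt 3 * H t"
proof -
  have "H t * 1 < H t * (sqrt 3 * p t)" using H_pos future_sqrt_p[OF assms] by (intro mult_strict_left_mono) auto
  hence "H t < (sqrt 3 * H t) * p t" by (simp only: mult_ac mult_1_left)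
  hence "H t / p t < sqrt 3 * H t" using p_pos[of t] by (simp only: pos_divide_less_eq)
  thus ?thesis using psi_eq[of t] by simp
qed

lemma future_psi_upper: "0 < t \<Longrightarrow> deriv \<phi> t < sqrt 3 / (t + 1 / \<beta>)"
proof -
  assume t: "0 < t"
  have "sqrt 3 * H t < sqrt 3 * (1 / (t + 1 / \<beta>))"
    using future_H(2)[OF t] by (intro mult_strict_left_mono) auto
  thus ?thesis using future_psi_less[OF t] by simp
qed

lemma ln_pos_arg: "0 \<le> t \<Longrightarrow> 0 < k \<Longrightarrow> 0 < k * \<beta> * t + 1"
  using \<beta> by (intro add_nonneg_pos mult_nonneg_nonneg) auto

text \<open>For k = 1 and k = 5 the derivative is written so as to match the two bounds on
  H.\<close>

lemma ln_deriv: "0 \<le> t \<Longrightarrow> 0 < k \<Longrightarrow>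
  ((\<lambda>t. ln (k * \<beta> * t + 1)) has_real_derivative k * (1 / (k * t + 1 / \<beta>))) (at t)"
proof -
  assume t: "0 \<le> t" "0 < k"
  have "((\<lambda>t. k * \<beta> * t + 1) has_real_derivative k * \<beta>) (at t)" by (auto intro!: derivative_eq_intros)
  from DERIV_chain2[OF DERIV_ln_divide[OF ln_pos_arg[OF t]] this]
  show ?thesis by (rule DERIV_cong) (use \<beta> in \<open>simp add: field_simps\<close>)
qed

lemma future_psi_lower:
  assumes t: "0 < t"
  shows "1 / sqrt (1 + 12 * \<beta>\<^sup>2 * ln (\<beta> * t + 1)) * (sqrt 3 / (5 * t + 1 / \<beta>)) < deriv \<phi> t"
proof -
  define X where "X = 1 + 12 * \<beta>\<^sup>2 * ln (\<beta> * t + 1)"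
  have "3 * (p t)\<^sup>2 < X"
    using planar_future.p_sq_upper_ln[OF future, of t t] t by (simp add: X_def)
  hence "sqrt (3 * (p t)\<^sup>2) < sqrt X" by (rule real_sqrt_less_mono)
  hence s: "sqrt 3 * p t < sqrt X" using p_pos[of t] by (simp add: real_sqrt_mult)
  have p3: "0 < sqrt 3 * p t" using p_pos[of t] by simp
  have d: "0 < 5 * t + 1 / \<beta>" using t \<beta> by (simp add: add_pos_pos)
  have "1 / sqrt X * (sqrt 3 / (5 * t + 1 / \<beta>)) < 1 / (sqrt 3 * p t) * (sqrt 3 / (5 * t + 1 / \<beta>))"
  proof (rule mult_strict_right_mono)
    have "0 < sqrt X" using s p3 by linarith
    thus "1 / sqrt X < 1 / (sqrt 3 * p t)"
      using s p3 by (intro divide_strict_left_mono mult_pos_pos[of "sqrt X" "sqrt 3 * p t"]) linarith+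
  qed (use d in simp)
  also have "\<dots> = (1 / (5 * t + 1 / \<beta>)) / p t" by simp
  also have "\<dots> < H t / p t"
    using future_H(1)[OF t] p_pos[of t] by (rule divide_strict_right_mono)
  finally show ?thesis unfolding X_def psi_eq[symmetric] .
qed

lemma future_phi_pos: "0 < t \<Longrightarrow> 0 < \<phi> t"
  unfolding phi_eq[of t] using future_p[of t] H_pos[of t] p_pos[of t] by simp

lemma future_phi_upper: assumes t: "0 < t" shows "\<phi> t < sqrt 3 * ln (\<beta> * t + 1)"
proof -
  have "sqrt 3 * ln (1 * \<beta> * 0 + 1) - \<phi> 0 < sqrt 3 * ln (1 * \<beta> * t + 1) - \<phi> t"
  proof (rule strictly_increasing[where f = "\<lambda>t. sqrt 3 * ln (1 * \<beta> * t + 1) - \<phi> t",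
        OF t DERIV_diff[OF DERIV_cmult[OF ln_deriv] phi_deriv]])
    show "0 < sqrt 3 * (1 * (1 / (1 * s + 1 / \<beta>))) - deriv \<phi> s" if "s \<in> {0<..<t}" for s
      using future_psi_upper[of s] that by simp
  qed auto
  thus ?thesis by (simp add: phi_init)
qed

text \<open>The constraint divided by H. Its bracket is bounded by 12 \<beta>^2 \<phi> + sqrt 3 in
  the future, which makes the right side an exact derivative.\<close>

lemma constraint: "3 * H t = (12 * (H t)\<^sup>2 * \<phi> t + 1 / p t) * deriv \<phi> t"
proof -
  have "12 * (H t)\<^sup>2 * \<phi> t = (3 * (p t)\<^sup>2 - 1) / p t"
    unfolding phi_eq[of t] using H_pos[of t] p_pos[of t] by (simp del: divide_divide_eq_left divide_divide_eq_right)
  hence "12 * (H t)\<^sup>2 * \<phi> t + 1 / p t = 3 * p t"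
    using p_pos[of t] by (simp add: field_simps power2_eq_square)
  moreover have "H t = p t * deriv \<phi> t" using psi_eq[of t] p_pos[of t] by simp
  ultimately show ?thesis by simp
qed

lemma future_phi_lower:
  assumes t: "0 < t"
  shows "(- 1 + sqrt (1 + 24 * \<beta>\<^sup>2 / 5 * ln (1 + 5 * \<beta> * t))) / (4 * sqrt 3 * \<beta>\<^sup>2) < \<phi> t"
proof -
  \<comment> \<open>An antiderivative of (12 \<beta>^2 \<phi> + sqrt 3) \<psi>, which exceeds 3 H
    and hence 3 / (5 t + 1 / \<beta>).\<close>
  define g where "g = (\<lambda>t. 6 * \<beta>\<^sup>2 * (\<phi> t)\<^sup>2 + sqrt 3 * \<phi> t)"
  have g: "(g has_real_derivative (12 * \<beta>\<^sup>2 * \<phi> s + sqrt 3) * deriv \<phi> s) (at s)" for s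
    unfolding g_def
    by (rule DERIV_cong[OF DERIV_add[OF DERIV_cmult[OF DERIV_power[OF phi_deriv, of 2]] DERIV_cmult[OF phi_deriv]]])
      (simp add: algebra_simps)
  have "g 0 - 3 / 5 * ln (5 * \<beta> * 0 + 1) < g t - 3 / 5 * ln (5 * \<beta> * t + 1)"
  proof (rule strictly_increasing[where f = "\<lambda>t. g t - 3 / 5 * ln (5 * \<beta> * t + 1)",
        OF t DERIV_diff[OF g DERIV_cmult[OF ln_deriv]]])
    fix s assume s: "s \<in> {0<..<t}"
    have "1 / p s < sqrt 3"
      using future_sqrt_p[of s] s p_pos[of s] by (simp add: divide_less_eq)
    moreover have "12 * (H s)\<^sup>2 * \<phi> s \<le> 12 * \<beta>\<^sup>2 * \<phi> s"
      using planar_future.H_less_init[OF future, of s s] future_phi_pos[of s] s H_pos[of s]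
      by (intro mult_right_mono mult_left_mono power_mono) auto
    ultimately have "(12 * (H s)\<^sup>2 * \<phi> s + 1 / p s) * deriv \<phi> s < (12 * \<beta>\<^sup>2 * \<phi> s + sqrt 3) * deriv \<phi> s"
      using psi_pos[of s] by (intro mult_strict_right_mono) auto
    hence "3 * H s < (12 * \<beta>\<^sup>2 * \<phi> s + sqrt 3) * deriv \<phi> s" using constraint[of s] by simp
    thus "0 < (12 * \<beta>\<^sup>2 * \<phi> s + sqrt 3) * deriv \<phi> s - 3 / 5 * (5 * (1 / (5 * s + 1 / \<beta>)))"
      using future_H(1)[of s] s by simp
  qed auto
  hence "3 / 5 * ln (5 * \<beta> * t + 1) < g t" by (simp add: g_def phi_init)
  hence "8 * \<beta>\<^sup>2 * (3 / 5 * ln (5 * \<beta> * t + 1)) < 8 * \<beta>\<^sup>2 * g t" using \<beta> by (intro mult_strict_left_mono) auto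
  \<comment> \<open>Completing the square solves the quadratic inequality for \<phi>; this is the
    origin of the square root in the bound.\<close>
  moreover have "8 * \<beta>\<^sup>2 * g t + 1 = (4 * sqrt 3 * \<beta>\<^sup>2 * \<phi> t + 1)\<^sup>2"
  proof -
    have "(4 * sqrt 3 * \<beta>\<^sup>2 * \<phi> t + 1)\<^sup>2 = 16 * (sqrt 3)\<^sup>2 * \<beta>\<^sup>2 * \<beta>\<^sup>2 * (\<phi> t)\<^sup>2 + 8 * sqrt 3 * \<beta>\<^sup>2 * \<phi> t + 1"
      by algebra
    thus ?thesis by (simp add: g_def algebra_simps)
  qed
  ultimately have "1 + 24 * \<beta>\<^sup>2 / 5 * ln (1 + 5 * \<beta> * t) < (4 * sqrt 3 * \<beta>\<^sup>2 * \<phi> t + 1)\<^sup>2"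
  proof -
    assume *: "8 * \<beta>\<^sup>2 * (3 / 5 * ln (5 * \<beta> * t + 1)) < 8 * \<beta>\<^sup>2 * g t"
      "8 * \<beta>\<^sup>2 * g t + 1 = (4 * sqrt 3 * \<beta>\<^sup>2 * \<phi> t + 1)\<^sup>2"
    have "8 * \<beta>\<^sup>2 * (3 / 5 * ln (5 * \<beta> * t + 1)) = 24 * \<beta>\<^sup>2 / 5 * ln (1 + 5 * \<beta> * t)"
      by (simp add: add.commute)
    thus ?thesis unfolding *(2)[symmetric] using *(1) by linarith
  qed
  hence "sqrt (1 + 24 * \<beta>\<^sup>2 / 5 * ln (1 + 5 * \<beta> * t)) < sqrt ((4 * sqrt 3 * \<beta>\<^sup>2 * \<phi> t + 1)\<^sup>2)"
    by (rule real_sqrt_less_mono)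
  also have "\<dots> = 4 * sqrt 3 * \<beta>\<^sup>2 * \<phi> t + 1"
    using future_phi_pos[OF t] \<beta> by simp
  finally have "- 1 + sqrt (1 + 24 * \<beta>\<^sup>2 / 5 * ln (1 + 5 * \<beta> * t)) < \<phi> t * (4 * sqrt 3 * \<beta>\<^sup>2)"
    by (simp add: mult_ac)
  moreover have "0 < 4 * sqrt 3 * \<beta>\<^sup>2" using \<beta> by simp
  ultimately show ?thesis by (simp only: pos_divide_less_eq)
qed

lemma a_less_iff: "0 < c \<Longrightarrow> ln (a t) - ln (a 0) < ln c \<longleftrightarrow> a t < a0 * c" "0 < c \<Longrightarrow> ln c < ln (a t) - ln (a 0) \<longleftrightarrow> a0 * c < a t"
proof -
  assume c: "0 < c"
  have a0: "0 < a0" using a_pos[of 0] a_init by simp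
  have "ln (a0 * c) = ln a0 + ln c" using a0 c by (simp add: ln_mult)
  thus "ln (a t) - ln (a 0) < ln c \<longleftrightarrow> a t < a0 * c" "ln c < ln (a t) - ln (a 0) \<longleftrightarrow> a0 * c < a t"
    using ln_less_cancel_iff[OF a_pos[of t] mult_pos_pos[OF a0 c]] ln_less_cancel_iff[OF mult_pos_pos[OF a0 c] a_pos[of t]]
    by (auto simp: a_init)
qed

lemma future_a:
  assumes t: "0 < t"
  shows "a0 * (5 * \<beta> * t + 1) powr (1 / 5) < a t" "a t < a0 * (\<beta> * t + 1)"
proof -
  have "ln (1 * \<beta> * 0 + 1) - ln (a 0) < ln (1 * \<beta> * t + 1) - ln (a t)"
  proof (rule strictly_increasing[where f = "\<lambda>t. ln (1 * \<beta> * t + 1) - ln (a t)", OF t DERIV_diff[OF ln_deriv ln_a_deriv]])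
    show "0 < 1 * (1 / (1 * s + 1 / \<beta>)) - H s" if "s \<in> {0<..<t}" for s
      using future_H(2)[of s] that by simp
  qed auto
  hence "ln (a t) - ln (a 0) < ln (\<beta> * t + 1)" by simp
  thus "a t < a0 * (\<beta> * t + 1)" using a_less_iff(1) ln_pos_arg[of t 1] t by simp
  have "ln (a 0) - 1 / 5 * ln (5 * \<beta> * 0 + 1) < ln (a t) - 1 / 5 * ln (5 * \<beta> * t + 1)"
  proof (rule strictly_increasing[where f = "\<lambda>t. ln (a t) - 1 / 5 * ln (5 * \<beta> * t + 1)",
        OF t DERIV_diff[OF ln_a_deriv DERIV_cmult[OF ln_deriv]]])
    show "0 < H s - 1 / 5 * (5 * (1 / (5 * s + 1 / \<beta>)))" if "s \<in> {0<..<t}" for s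
      using future_H(1)[of s] that by simp
  qed auto
  hence "ln ((5 * \<beta> * t + 1) powr (1 / 5)) < ln (a t) - ln (a 0)" by (simp add: ln_powr)
  moreover have "0 < (5 * \<beta> * t + 1) powr (1 / 5)" using ln_pos_arg[of t 5] t by simp
  ultimately show "a0 * (5 * \<beta> * t + 1) powr (1 / 5) < a t" using a_less_iff(2) by blast
qed

section \<open>Bounds for negative times\<close>

lemma past_psi: assumes "t < 0" shows "frakW \<beta> t < deriv \<phi> t" "deriv \<phi> t < sqrt 3 * exp (- 12 * t)"
  unfolding psi_eq[of t]
  using planar_past.psi_lower_frakW[OF past, of t t] planar_past.psi_upper[OF past, of t t] assms by auto

lemma past_H:
  assumes "t < 0"
  shows "frakL \<beta> t < H t"
    and "H t < (2 * \<beta> + sqrt 2 - (sqrt 2 - 2 * \<beta>) * exp (3 * sqrt 2 * t)) /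
               (sqrt 2 * (2 * \<beta> + sqrt 2 + (sqrt 2 - 2 * \<beta>) * exp (3 * sqrt 2 * t)))"
  using planar_past.H_lower[OF past, of t t] planar_past.H_upper[OF past, of t t] assms
    planar_past.hubble_barrier_def[OF past[of t], of t]
  by auto

lemma past_frakL: "t < 0 \<Longrightarrow> if \<beta> \<le> sqrt (5 / 27) then frakL \<beta> t > \<beta> else frakL \<beta> t > 2 / 5"
  using frakL_small(3)[OF \<beta>(1), of t] frakL_large(3)[of \<beta> t] by auto

lemma frakH_deriv: "(frakH \<beta> has_real_derivative frakW \<beta> t) (at t)"
proof (cases "\<beta> \<le> sqrt (5 / 27)")
  case True
  have e: "((\<lambda>t. exp (- 6 * \<beta> ^ 3 * t)) has_real_derivative exp (- 6 * \<beta> ^ 3 * t) * (- 6 * \<beta> ^ 3)) (at t)"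
    by (rule DERIV_fun_exp) (auto intro!: derivative_eq_intros)
  have "((\<lambda>t. sqrt 3 / (6 * \<beta>\<^sup>2) * (1 - exp (- 6 * \<beta> ^ 3 * t))) has_real_derivative
      sqrt 3 * \<beta> * exp (- 6 * \<beta> ^ 3 * t)) (at t)"
    by (rule DERIV_cong[OF DERIV_cmult[OF DERIV_diff[OF DERIV_const e]]])
      (use \<beta> in \<open>simp add: power2_eq_square power3_eq_cube\<close>)
  thus ?thesis using True by (simp add: frakH_def[abs_def] frakW_def)
next
  case False
  have e: "((\<lambda>t. exp (- (48 / 125) * t)) has_real_derivative exp (- (48 / 125) * t) * - (48 / 125)) (at t)"
    by (rule DERIV_fun_exp) (auto intro!: derivative_eq_intros)
  have "((\<lambda>t. 25 * sqrt 3 / 24 * (1 - exp (- (48 / 125) * t))) has_real_derivative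
      2 * sqrt 3 / 5 * exp (- (48 / 125) * t)) (at t)"
    by (rule DERIV_cong[OF DERIV_cmult[OF DERIV_diff[OF DERIV_const e]]]) simp
  thus ?thesis using False by (simp add: frakH_def[abs_def] frakW_def)
qed

lemma past_phi:
  assumes t: "t < 0"
  shows "sqrt 3 / 12 * (1 - exp (- 12 * t)) < \<phi> t" "\<phi> t < frakH \<beta> t"
proof -
  have e: "((\<lambda>t. exp (- 12 * t)) has_real_derivative exp (- 12 * s) * - 12) (at s)" for s :: real
    by (rule DERIV_fun_exp) (auto intro!: derivative_eq_intros)
  have c: "((\<lambda>t. sqrt 3 / 12 * (1 - exp (- 12 * t))) has_real_derivative sqrt 3 * exp (- 12 * s)) (at s)" for s :: real
    by (rule DERIV_cong[OF DERIV_cmult[OF DERIV_diff[OF DERIV_const e]]]) simp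
  have "sqrt 3 / 12 * (1 - exp (- 12 * t)) - \<phi> t < sqrt 3 / 12 * (1 - exp (- 12 * 0)) - \<phi> 0"
  proof (rule strictly_increasing[where f = "\<lambda>t. sqrt 3 / 12 * (1 - exp (- 12 * t)) - \<phi> t",
        OF t DERIV_diff[OF c phi_deriv]])
    show "0 < sqrt 3 * exp (- 12 * s) - deriv \<phi> s" if "s \<in> {t<..<0}" for s
      using past_psi(2)[of s] that by simp
  qed
  thus "sqrt 3 / 12 * (1 - exp (- 12 * t)) < \<phi> t" by (simp add: phi_init)
  have "\<phi> t - frakH \<beta> t < \<phi> 0 - frakH \<beta> 0"
  proof (rule strictly_increasing[where f = "\<lambda>t. \<phi> t - frakH \<beta> t", OF t DERIV_diff[OF phi_deriv frakH_deriv]])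
    show "0 < deriv \<phi> s - frakW \<beta> s" if "s \<in> {t<..<0}" for s
      using past_psi(1)[of s] that by simp
  qed
  moreover have "frakH \<beta> 0 = 0" by (simp add: frakH_def)
  ultimately show "\<phi> t < frakH \<beta> t" by (simp add: phi_init)
qed

text \<open>The expression is exp (- 4 t) times the denominator of the second branch of
  \<open>frakL\<close>, whose sign is known.\<close>

lemma frakG_pos_arg:
  assumes "t \<le> 0"
  shows "sqrt (5 / 27) < \<beta> \<Longrightarrow> 0 < 5 * \<beta> * exp (- 4 * t) - (5 * \<beta> - 2)"
proof -
  assume l: "sqrt (5 / 27) < \<beta>"
  have "0 < exp (- 4 * t) * (5 * \<beta> - (5 * \<beta> - 2) * exp (4 * t))"
    using frakL_large_denominator(2)[OF l assms] by simp
  also have "exp (- 4 * t) * (5 * \<beta> - (5 * \<beta> - 2) * exp (4 * t))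
      = 5 * \<beta> * exp (- 4 * t) - (5 * \<beta> - 2) * (exp (- 4 * t) * exp (4 * t))"
    by (simp only: right_diff_distrib mult_ac)
  also have "exp (- 4 * t) * exp (4 * t) = 1" by (simp add: exp_minus)
  finally show ?thesis by simp
qed

lemma frakG_pos: "t \<le> 0 \<Longrightarrow> 0 < frakG \<beta> t"
proof -
  assume t: "t \<le> 0"
  have "0 < 225 * exp (- (454 * \<beta> * t / 45)) + 2" by (intro add_pos_pos mult_pos_pos) auto
  thus ?thesis using frakG_pos_arg[OF t] by (cases "\<beta> \<le> sqrt (5 / 27)") (auto simp: frakG_def)
qed

text \<open>With v the denominator inside \<open>frakG\<close>, the substitution L = - v' / (10 v)
  linearises L' = 10 L^2 - b L. The coefficient 10 thus becomes the exponent 1/10.\<close>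

lemma ln_frakG_deriv:
  assumes t: "t \<le> 0"
  shows "((\<lambda>t. ln (frakG \<beta> t)) has_real_derivative frakL \<beta> t) (at t)"
proof (cases "\<beta> \<le> sqrt (5 / 27)")
  case True
  define k where "k = 454 * \<beta> / 45"
  have pos: "0 < 225 * exp (- k * s) + 2" for s by (intro add_pos_pos mult_pos_pos) auto
  have eq: "ln (frakG \<beta> s) = 1 / 10 * (ln 227 - ln (225 * exp (- k * s) + 2))" for s
  proof -
    have "frakG \<beta> s = (227 / (225 * exp (- k * s) + 2)) powr (1 / 10)"
      using True by (simp add: frakG_def k_def)
    thus ?thesis using pos[of s] by (simp add: ln_powr ln_div)
  qed
  have "((\<lambda>s. exp (- k * s)) has_real_derivative exp (- k * t) * - k) (at t)"
    by (rule DERIV_fun_exp) (auto intro!: derivative_eq_intros)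
  from DERIV_add[OF DERIV_cmult[OF this] DERIV_const]
  have "((\<lambda>s. 225 * exp (- k * s) + 2) has_real_derivative 225 * (exp (- k * t) * - k) + 0) (at t)" .
  from DERIV_cmult[OF DERIV_diff[OF DERIV_const DERIV_chain2[OF DERIV_ln_divide[OF pos] this]]]
  have "((\<lambda>s. 1 / 10 * (ln 227 - ln (225 * exp (- k * s) + 2))) has_real_derivative
     1 / 10 * (0 - 1 / (225 * exp (- k * t) + 2) * (225 * (exp (- k * t) * - k) + 0))) (at t)" .
  moreover have "1 / 10 * (0 - 1 / (225 * exp (- k * t) + 2) * (225 * (exp (- k * t) * - k) + 0)) = frakL \<beta> t"
  proof -
    have "exp (454 * \<beta> * t / 45) = 1 / exp (- k * t)" by (simp add: k_def exp_minus inverse_eq_divide)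
    hence "frakL \<beta> t = 227 * \<beta> / (2 * (1 / exp (- k * t)) + 225)" using True by (simp add: frakL_def)
    also have "\<dots> = 227 * \<beta> * exp (- k * t) / (225 * exp (- k * t) + 2)"
      using pos[of t] by (simp add: field_simps add_pos_pos)
    finally show ?thesis by (simp add: k_def)
  qed
  ultimately show ?thesis by (simp add: eq)
next
  case False
  hence l: "sqrt (5 / 27) < \<beta>" by simp
  have pos: "0 < 5 * \<beta> * exp (- 4 * t) - (5 * \<beta> - 2)" by (rule frakG_pos_arg[OF t l])
  have eq: "frakG \<beta> = (\<lambda>s. (2 / (5 * \<beta> * exp (- 4 * s) - (5 * \<beta> - 2))) powr (1 / 10))"
    using False by (simp add: frakG_def[abs_def])
  have "((\<lambda>s. exp (- 4 * s)) has_real_derivative exp (- 4 * t) * - 4) (at t)"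
    by (rule DERIV_fun_exp) (auto intro!: derivative_eq_intros)
  from DERIV_diff[OF DERIV_cmult[OF this] DERIV_const]
  have "((\<lambda>s. 5 * \<beta> * exp (- 4 * s) - (5 * \<beta> - 2)) has_real_derivative 5 * \<beta> * (exp (- 4 * t) * - 4) - 0) (at t)" .
  from DERIV_cmult[OF DERIV_diff[OF DERIV_const DERIV_chain2[OF DERIV_ln_divide[OF pos] this]]]
  have D: "((\<lambda>s. 1 / 10 * (ln 2 - ln (5 * \<beta> * exp (- 4 * s) - (5 * \<beta> - 2)))) has_real_derivative
     1 / 10 * (0 - 1 / (5 * \<beta> * exp (- 4 * t) - (5 * \<beta> - 2)) * (5 * \<beta> * (exp (- 4 * t) * - 4) - 0))) (at t)" .
  \<comment> \<open>In this branch the expression turns negative at late times, so the logarithm can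
    be split only near t.\<close>
  have ev: "\<forall>\<^sub>F s in nhds t. 0 < 5 * \<beta> * exp (- 4 * s) - (5 * \<beta> - 2)"
  proof (rule order_tendstoD(1)[OF _ pos])
    show "((\<lambda>s. 5 * \<beta> * exp (- 4 * s) - (5 * \<beta> - 2)) \<longlongrightarrow> 5 * \<beta> * exp (- 4 * t) - (5 * \<beta> - 2)) (nhds t)"
      by (intro tendsto_intros filterlim_ident)
  qed
  have "\<forall>\<^sub>F s in nhds t. ln (frakG \<beta> s) = 1 / 10 * (ln 2 - ln (5 * \<beta> * exp (- 4 * s) - (5 * \<beta> - 2)))"
    using ev by (rule eventually_mono) (simp add: eq ln_powr ln_div)
  moreover have "1 / 10 * (0 - 1 / (5 * \<beta> * exp (- 4 * t) - (5 * \<beta> - 2)) * (5 * \<beta> * (exp (- 4 * t) * - 4) - 0)) = frakL \<beta> t"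
  proof -
    define E where "E = exp (- 4 * t)"
    have E: "0 < E" "exp (4 * t) = 1 / E" by (auto simp: E_def exp_minus inverse_eq_divide)
    have "5 * \<beta> - (5 * \<beta> - 2) * (1 / E) = (5 * \<beta> * E - (5 * \<beta> - 2)) / E" using E by (simp add: field_simps)
    hence "frakL \<beta> t = 2 * \<beta> * E / (5 * \<beta> * E - (5 * \<beta> - 2))" using False by (simp add: frakL_def E(2))
    thus ?thesis by (simp add: E_def)
  qed
  ultimately show ?thesis by (intro DERIV_cong_ev[OF refl, THEN iffD2, OF _ _ D]) simp_all
qed

lemma past_a_upper: assumes t: "t < 0" shows "a t < a0 * frakG \<beta> t"
proof -
  have "ln (a t) - ln (frakG \<beta> t) < ln (a 0) - ln (frakG \<beta> 0)"
  proof (rule strictly_increasing[where f = "\<lambda>t. ln (a t) - ln (frakG \<beta> t)",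
        OF t DERIV_diff[OF ln_a_deriv ln_frakG_deriv]])
    show "0 < H s - frakL \<beta> s" if "s \<in> {t<..<0}" for s
      using past_H(1)[of s] that by simp
  qed auto
  moreover have "frakG \<beta> 0 = 1" by (simp add: frakG_def)
  ultimately have "ln (a t) - ln (a 0) < ln (frakG \<beta> t)" by simp
  thus ?thesis using a_less_iff(1)[of "frakG \<beta> t"] frakG_pos[of t] t by simp
qed

lemma past_a_lower:
  assumes t: "t < 0"
  shows "a0 * (2 / ((sqrt 2 * \<beta> + 1) + (1 - sqrt 2 * \<beta>) * exp (3 * sqrt 2 * t))) powr (1 / 3) * exp (sqrt 2 / 2 * t) < a t"
proof -
  define D where "D = (\<lambda>t. (sqrt 2 * \<beta> + 1) + (1 - sqrt 2 * \<beta>) * exp (3 * sqrt 2 * t))"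
  have s2: "sqrt 2 * sqrt 2 = 2" by simp
  have "0 < sqrt 2 * (1 - sqrt 2 * \<beta>)"
    using planar_past.hubble_barrier_coeff_pos[OF past] by (simp add: right_diff_distrib mult.assoc[symmetric])
  hence b: "0 < 1 - sqrt 2 * \<beta>" by (simp add: zero_less_mult_iff)
  have D: "0 < D s" for s
    unfolding D_def using b \<beta> by (intro add_pos_pos mult_pos_pos) auto
  \<comment> \<open>An antiderivative of the upper barrier U for H; the exponent 1/3 comes from the
    coefficient 3 in X' = 3 X^2 - 3/2.\<close>
  define g where "g = (\<lambda>t. 1 / 3 * (ln 2 - ln (D t)) + sqrt 2 / 2 * t)"
  define U where "U = (\<lambda>t. (2 * \<beta> + sqrt 2 - (sqrt 2 - 2 * \<beta>) * exp (3 * sqrt 2 * t)) /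
               (sqrt 2 * (2 * \<beta> + sqrt 2 + (sqrt 2 - 2 * \<beta>) * exp (3 * sqrt 2 * t))))"
  have dg: "(g has_real_derivative U s) (at s)" for s
  proof -
    define E where "E = exp (3 * sqrt 2 * s)"
    have dE: "((\<lambda>t. exp (3 * sqrt 2 * t)) has_real_derivative E * (3 * sqrt 2)) (at s)"
      unfolding E_def by (rule DERIV_fun_exp) (auto intro!: derivative_eq_intros)
    have dD: "(D has_real_derivative 0 + (1 - sqrt 2 * \<beta>) * (E * (3 * sqrt 2))) (at s)"
      unfolding D_def by (rule DERIV_add[OF DERIV_const DERIV_cmult[OF dE]])
    have "(g has_real_derivative 1 / 3 * (0 - 1 / D s * (0 + (1 - sqrt 2 * \<beta>) * (E * (3 * sqrt 2)))) + sqrt 2 / 2 * 1) (at s)"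
      unfolding g_def
      by (rule DERIV_add[OF DERIV_cmult[OF DERIV_diff[OF DERIV_const DERIV_chain2[OF DERIV_ln_divide[OF D] dD]]]
            DERIV_cmult[OF DERIV_ident]])
    moreover have "1 / 3 * (0 - 1 / D s * (0 + (1 - sqrt 2 * \<beta>) * (E * (3 * sqrt 2)))) + sqrt 2 / 2 * 1 = U s"
    proof -
      define B where "B = sqrt 2 * \<beta>"
      have Ds: "D s = B + 1 + (1 - B) * E" by (simp add: D_def E_def B_def)
      have "U s = (sqrt 2 * (B + 1 - (1 - B) * E)) / (2 * (B + 1 + (1 - B) * E))"
        unfolding U_def E_def[symmetric] B_def
      proof (rule arg_cong2[where f = "(/)"])
        have "sqrt 2 * (sqrt 2 * \<beta> + 1 - (1 - sqrt 2 * \<beta>) * E)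
          = sqrt 2 * sqrt 2 * \<beta> + sqrt 2 - (sqrt 2 - sqrt 2 * sqrt 2 * \<beta>) * E"
          by (simp only: algebra_simps mult_1_left mult_1_right)
        thus "2 * \<beta> + sqrt 2 - (sqrt 2 - 2 * \<beta>) * E = sqrt 2 * (sqrt 2 * \<beta> + 1 - (1 - sqrt 2 * \<beta>) * E)"
          unfolding s2 ..
        have "sqrt 2 * (2 * \<beta> + sqrt 2 + (sqrt 2 - 2 * \<beta>) * E)
          = 2 * (sqrt 2 * \<beta>) + sqrt 2 * sqrt 2 + (sqrt 2 * sqrt 2 - 2 * (sqrt 2 * \<beta>)) * E"
          by (simp only: algebra_simps)
        thus "sqrt 2 * (2 * \<beta> + sqrt 2 + (sqrt 2 - 2 * \<beta>) * E) = 2 * (sqrt 2 * \<beta> + 1 + (1 - sqrt 2 * \<beta>) * E)"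
          unfolding s2 by (simp only: algebra_simps mult_1_left mult_1_right)
      qed
      also have "\<dots> = 1 / 3 * (0 - 1 / D s * (0 + (1 - B) * (E * (3 * sqrt 2)))) + sqrt 2 / 2 * 1"
      proof -
        define X where "X = B + 1 + (1 - B) * E"
        have X: "0 < X" using D[of s] by (simp add: X_def Ds)
        have "1 / 3 * (0 - 1 / X * (0 + (1 - B) * (E * (3 * sqrt 2)))) + sqrt 2 / 2 * 1
          = (sqrt 2 * (X - 2 * ((1 - B) * E))) / (2 * X)"
          using X by (simp add: field_simps)
        also have "X - 2 * ((1 - B) * E) = B + 1 - (1 - B) * E" by (simp add: X_def)
        finally show ?thesis by (simp add: Ds X_def)
      qed
      finally show ?thesis by (simp add: B_def)
    qed
    ultimately show ?thesis by simp
  qed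
  have "g t - ln (a t) < g 0 - ln (a 0)"
  proof (rule strictly_increasing[where f = "\<lambda>t. g t - ln (a t)", OF t DERIV_diff[OF dg ln_a_deriv]])
    show "0 < U s - H s" if "s \<in> {t<..<0}" for s
      using past_H(2)[of s] that by (simp add: U_def)
  qed
  moreover have "g 0 = 0" by (simp add: g_def D_def)
  ultimately have "g t < ln (a t) - ln (a 0)" by simp
  moreover define c where "c = (2 / D t) powr (1 / 3) * exp (sqrt 2 / 2 * t)"
  moreover have "ln c = g t"
    using D[of t] by (simp add: c_def g_def ln_mult ln_powr ln_div)
  moreover have "0 < c" using D[of t] by (simp add: c_def)
  ultimately have "a0 * c < a t" using a_less_iff(2)[of c t] by simp
  thus ?thesis by (simp add: c_def D_def mult.assoc)
qed

end

theorem theorem1p1: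
  fixes a0 \<alpha> \<beta> :: real
  assumes "0 < a0" and "\<alpha> = 0" and "\<beta> \<in> {0 <..< sqrt 3 / 3}"
  shows "(\<exists>!(a, \<phi>). esgb_flrw_ivp a0 \<beta> \<alpha> a \<phi>) \<and>
    (\<forall>a \<phi>. esgb_flrw_ivp a0 \<beta> \<alpha> a \<phi> \<longrightarrow>
      (\<forall>t<0. sqrt 3 / 12 * (1 - exp (- 12 * t)) < \<phi> t \<and> \<phi> t < frakH \<beta> t) \<and>
      (\<forall>t>0. (- 1 + sqrt (1 + 24 * \<beta>\<^sup>2 / 5 * ln (1 + 5 * \<beta> * t))) / (4 * sqrt 3 * \<beta>\<^sup>2) < \<phi> t \<and>
             \<phi> t < sqrt 3 * ln (\<beta> * t + 1)) \<and>
      (\<forall>t<0. frakL \<beta> t < hubble a t \<and>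
             hubble a t <
               (2 * \<beta> + sqrt 2 - (sqrt 2 - 2 * \<beta>) * exp (3 * sqrt 2 * t)) /
               (sqrt 2 * (2 * \<beta> + sqrt 2 + (sqrt 2 - 2 * \<beta>) * exp (3 * sqrt 2 * t))) \<and>
             (if \<beta> \<le> sqrt (5 / 27) then frakL \<beta> t > \<beta> else frakL \<beta> t > 2 / 5)) \<and>
      (\<forall>t>0. 1 / (5 * t + 1 / \<beta>) < hubble a t \<and> hubble a t < 1 / (t + 1 / \<beta>)) \<and>
      (\<forall>t<0. frakW \<beta> t < deriv \<phi> t \<and> deriv \<phi> t < sqrt 3 * exp (- 12 * t)) \<and>
      (\<forall>t>0. 1 / sqrt (1 + 12 * \<beta>\<^sup>2 * ln (\<beta> * t + 1)) * (sqrt 3 / (5 * t + 1 / \<beta>)) < deriv \<phi> t \<and>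
             deriv \<phi> t < sqrt 3 / (t + 1 / \<beta>)) \<and>
      (\<forall>t<0. a0 * (2 / ((sqrt 2 * \<beta> + 1) + (1 - sqrt 2 * \<beta>) * exp (3 * sqrt 2 * t))) powr (1 / 3)
               * exp (sqrt 2 / 2 * t) < a t \<and>
             a t < a0 * frakG \<beta> t) \<and>
      (\<forall>t>0. a0 * (5 * \<beta> * t + 1) powr (1 / 5) < a t \<and> a t < a0 * (\<beta> * t + 1)))"
proof -
  have \<beta>: "0 < \<beta>" "3 * \<beta>\<^sup>2 < 1"
  proof -
    show "0 < \<beta>" using assms(3) by simp
    hence "\<beta>\<^sup>2 < (sqrt 3 / 3)\<^sup>2" using assms(3) by (intro power_strict_mono) auto
    thus "3 * \<beta>\<^sup>2 < 1" by (simp add: power_divide)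
  qed
  obtain a \<phi> where ex: "esgb_flrw_ivp a0 \<beta> 0 a \<phi>"
    using ivp_exists[OF \<beta> assms(1)] .
  have unique: "\<exists>!(a, \<phi>). esgb_flrw_ivp a0 \<beta> \<alpha> a \<phi>"
  proof (rule ex1I[of _ "(a, \<phi>)"])
    show "case (a, \<phi>) of (a, \<phi>) \<Rightarrow> esgb_flrw_ivp a0 \<beta> \<alpha> a \<phi>" using ex assms(2) by simp
    show "y = (a, \<phi>)" if "case y of (a, \<phi>) \<Rightarrow> esgb_flrw_ivp a0 \<beta> \<alpha> a \<phi>" for y
      using that ivp_unique[OF \<beta> _ ex] assms(2) by (cases y) auto
  qed
  have I: "ivp a0 \<beta> a \<phi>" if "esgb_flrw_ivp a0 \<beta> \<alpha> a \<phi>" for a \<phi>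
    using that \<beta> assms(2) by (simp add: ivp_def)
  note bounds = ivp.past_phi ivp.future_phi_lower ivp.future_phi_upper ivp.past_H ivp.past_frakL ivp.future_H
    ivp.past_psi ivp.future_psi_lower ivp.future_psi_upper ivp.past_a_lower ivp.past_a_upper ivp.future_a
  show ?thesis
  proof (intro conjI allI impI)
    show "\<exists>!(a, \<phi>). esgb_flrw_ivp a0 \<beta> \<alpha> a \<phi>" by (rule unique)
  qed (rule bounds[OF I]; assumption)+
qed

end
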